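(* Consider the boundary value problem for $(\varphi,\eta)$: \[ \Delta\varphi=0\ \text{ in }\Omega,\qquad (\varphi_x-\gamma y,\varphi_y)\cdot N_{\mathcal B}=0\ \text{ on }\mathcal B_0,\qquad (\varphi_x-\gamma y,\varphi_y)\cdot N_{\mathcal S}=\eta_t\ \text{ on }\mathcal S_\eta, \] \[ \varphi_t-\gamma\,\partial_x^{-1}\eta_t+\tfrac12\varphi_y^2+\tfrac12(\varphi_x-\gamma y)^2+gy=f(\eta)\ \text{ on }\mathcal S_\eta . \] This boundary value problem is equivalent to the following pair of equations for $(\xi,\eta)$, where $\xi(x,t)=\varphi(x,\eta(x,t),t)$: \[ \int_{\mathbf R} e^{-\mathrm i kx}\big[\xi_x\sinh(k(\eta+h))-\mathrm i(\eta_t-\gamma\eta\eta_x)\cosh(k(\eta+h))\big]\,\mathrm dx=0\qquad\text{for all }k\in\mathbf R, \] \[ \xi_t+\tfrac12\xi_x^2-\gamma\,\partial_x^{-1}\eta_t+g\eta+\frac{\gamma\eta(2\eta_t\eta_x-2\xi_x+\gamma\eta)}{2(1+\eta_x^2)}-\frac{(\eta_t+\eta_x\xi_x)^2}{2(1+\eta_x^2)}=f(\eta). \]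
   Context: Two-dimensional water waves with constant vorticity $\gamma\in\mathbf R$ over a flat bottom. Coordinates are $(x,y)\in\mathbf R^2$ and $t\ge0$ is time. The bottom is $\mathcal B_0=\{y=-h\}$ with $h>0$ a constant depth, with exterior normal $N_{\mathcal B}=(0,-1)$; the free surface is $\mathcal S_\eta=\{(x,y): x\in\mathbf R,\ y=\eta(x,t)\}$ with $\eta>-h$ and exterior normal $N_{\mathcal S}=(-\eta_x,1)$; $\Omega$ is the region between them. The function $\varphi$ (pseudo-potential) is related to the velocity $(u,v)$ by $u=\varphi_x-\gamma y$, $v=\varphi_y$. Here $\partial_x^{-1}\eta_t(x,t)=\int_{-\infty}^x\eta_t(s,t)\,\mathrm ds$, $g>0$ is gravity, and \[ f(\eta)=\frac{\sigma}{\rho}\,\partial_x\left(\frac{\eta_x}{\sqrt{1+\eta_x^2}}\right) \] with constants $\sigma\ge0$ (surface tension) and $\rho>0$ (density). Standing assumption: the functions have sufficient regularity and decay as $|x|\to\infty$ for the integrals to exist and for boundary contributions at infinity to vanish. *)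

theory Defs
  imports "HOL-Analysis.Analysis"
begin

section \<open>Derivatives up to the boundary\<close>

text \<open>
  The derivative of u at p relative to S, in direction v. All sets S used below (open sets, a
  half-plane, regions under a C1 graph) contain at each of their points a truncated cone with
  nonempty interior, so wherever u is differentiable within S this derivative is uniquely
  determined, also at boundary points.
\<close>

definition dderiv :: "'a::euclidean_space set \<Rightarrow> 'a \<Rightarrow> ('a \<Rightarrow> real) \<Rightarrow> 'a \<Rightarrow> real" where
  "dderiv S v u p = frechet_derivative u (at p within S) v"

definition C1_on :: "'a::euclidean_space set \<Rightarrow> ('a \<Rightarrow> real) \<Rightarrow> bool" where
  "C1_on S u \<longleftrightarrow> u differentiable_on S \<and> (\<forall>v. continuous_on S (dderiv S v u))"

definition C2_on :: "'a::euclidean_space set \<Rightarrow> ('a \<Rightarrow> real) \<Rightarrow> bool" where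
  "C2_on S u \<longleftrightarrow> C1_on S u \<and> (\<forall>v. C1_on S (dderiv S v u))"

definition laplacian :: "'a::euclidean_space set \<Rightarrow> ('a \<Rightarrow> real) \<Rightarrow> 'a \<Rightarrow> real" where
  "laplacian S u p = (\<Sum>v\<in>Basis. dderiv S v (dderiv S v u) p)"


section \<open>Functions of (x, t) with t nonnegative\<close>

definition half_plane :: "(real \<times> real) set" where
  "half_plane = UNIV \<times> {0..}"

definition dx :: "(real \<times> real \<Rightarrow> real) \<Rightarrow> real \<times> real \<Rightarrow> real" where
  "dx = dderiv half_plane (1, 0)"

definition dt :: "(real \<times> real \<Rightarrow> real) \<Rightarrow> real \<times> real \<Rightarrow> real" where
  "dt = dderiv half_plane (0, 1)"

definition inv_dx :: "(real \<times> real \<Rightarrow> real) \<Rightarrow> real \<times> real \<Rightarrow> real" where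
  "inv_dx u = (\<lambda>(x, t). LINT s:{..x}|lborel. u (s, t))"

text \<open>Integrability in x and decay to 0 as x tends to plus or minus infinity, locally uniformly in t.\<close>

definition decaying :: "(real \<times> real \<Rightarrow> real) \<Rightarrow> bool" where
  "decaying u \<longleftrightarrow> (\<forall>T\<ge>0. \<exists>M. integrable lborel M \<and> (M \<longlongrightarrow> 0) at_infinity \<and>
     (\<forall>x. \<forall>t\<in>{0..T}. \<bar>u (x, t)\<bar> \<le> M x))"


section \<open>Fluid domain and boundary value problem\<close>

definition fluid :: "real \<Rightarrow> (real \<times> real \<Rightarrow> real) \<Rightarrow> real \<Rightarrow> (real \<times> real) set" where
  "fluid h \<eta> t = {(x, y). - h < y \<and> y < \<eta> (x, t)}"

definition closed_fluid :: "real \<Rightarrow> (real \<times> real \<Rightarrow> real) \<Rightarrow> real \<Rightarrow> (real \<times> real) set" where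
  "closed_fluid h \<eta> t = {(x, y). - h \<le> y \<and> y \<le> \<eta> (x, t)}"

definition spacetime :: "real \<Rightarrow> (real \<times> real \<Rightarrow> real) \<Rightarrow> (real \<times> real \<times> real) set" where
  "spacetime h \<eta> = {(x, y, t). 0 \<le> t \<and> - h \<le> y \<and> y \<le> \<eta> (x, t)}"

definition at_time :: "(real \<times> real \<times> real \<Rightarrow> real) \<Rightarrow> real \<Rightarrow> real \<times> real \<Rightarrow> real" where
  "at_time \<phi> t = (\<lambda>(x, y). \<phi> (x, y, t))"

definition pot_x ::
  "real \<Rightarrow> (real \<times> real \<Rightarrow> real) \<Rightarrow> (real \<times> real \<times> real \<Rightarrow> real) \<Rightarrow> real \<times> real \<times> real \<Rightarrow> real" where
  "pot_x h \<eta> \<phi> = (\<lambda>(x, y, t). dderiv (closed_fluid h \<eta> t) (1, 0) (at_time \<phi> t) (x, y))"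

definition pot_y ::
  "real \<Rightarrow> (real \<times> real \<Rightarrow> real) \<Rightarrow> (real \<times> real \<times> real \<Rightarrow> real) \<Rightarrow> real \<times> real \<times> real \<Rightarrow> real" where
  "pot_y h \<eta> \<phi> = (\<lambda>(x, y, t). dderiv (closed_fluid h \<eta> t) (0, 1) (at_time \<phi> t) (x, y))"

definition pot_t ::
  "real \<Rightarrow> (real \<times> real \<Rightarrow> real) \<Rightarrow> (real \<times> real \<times> real \<Rightarrow> real) \<Rightarrow> real \<times> real \<times> real \<Rightarrow> real" where
  "pot_t h \<eta> = dderiv (spacetime h \<eta>) (0, 0, 1)"

definition surface_tension :: "real \<Rightarrow> real \<Rightarrow> (real \<times> real \<Rightarrow> real) \<Rightarrow> real \<times> real \<Rightarrow> real" where
  "surface_tension \<sigma> \<rho> \<eta> p = \<sigma> / \<rho> * dx (\<lambda>q. dx \<eta> q / sqrt (1 + (dx \<eta> q)\<^sup>2)) p"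

definition solves_bvp ::
  "real \<Rightarrow> real \<Rightarrow> real \<Rightarrow> real \<Rightarrow> real \<Rightarrow>
   (real \<times> real \<times> real \<Rightarrow> real) \<Rightarrow> (real \<times> real \<Rightarrow> real) \<Rightarrow> bool" where
  "solves_bvp \<gamma> h g \<sigma> \<rho> \<phi> \<eta> \<longleftrightarrow> (\<forall>t\<ge>0.
     (\<forall>p\<in>fluid h \<eta> t. laplacian (fluid h \<eta> t) (at_time \<phi> t) p = 0) \<and>
     (\<forall>x. let y = - h in
        (pot_x h \<eta> \<phi> (x, y, t) - \<gamma> * y, pot_y h \<eta> \<phi> (x, y, t)) \<bullet> (0, - 1) = 0) \<and>
     (\<forall>x. let y = \<eta> (x, t) in
        (pot_x h \<eta> \<phi> (x, y, t) - \<gamma> * y, pot_y h \<eta> \<phi> (x, y, t)) \<bullet> (- dx \<eta> (x, t), 1)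
          = dt \<eta> (x, t)) \<and>
     (\<forall>x. let y = \<eta> (x, t) in
        pot_t h \<eta> \<phi> (x, y, t) - \<gamma> * inv_dx (dt \<eta>) (x, t)
          + 1/2 * (pot_y h \<eta> \<phi> (x, y, t))\<^sup>2
          + 1/2 * (pot_x h \<eta> \<phi> (x, y, t) - \<gamma> * y)\<^sup>2 + g * y
          = surface_tension \<sigma> \<rho> \<eta> (x, t)))"


section \<open>The equations on the free surface\<close>

definition nonlocal_equation ::
  "real \<Rightarrow> real \<Rightarrow> (real \<times> real \<Rightarrow> real) \<Rightarrow> (real \<times> real \<Rightarrow> real) \<Rightarrow> bool" where
  "nonlocal_equation \<gamma> h \<xi> \<eta> \<longleftrightarrow> (\<forall>t\<ge>0. \<forall>k::real.
     has_bochner_integral lborel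
       (\<lambda>x. exp (- \<i> * of_real (k * x)) *
          (of_real (dx \<xi> (x, t) * sinh (k * (\<eta> (x, t) + h)))
           - \<i> * of_real ((dt \<eta> (x, t) - \<gamma> * \<eta> (x, t) * dx \<eta> (x, t))
                          * cosh (k * (\<eta> (x, t) + h)))))
       (0::complex))"

definition surface_bernoulli ::
  "real \<Rightarrow> real \<Rightarrow> real \<Rightarrow> real \<Rightarrow> (real \<times> real \<Rightarrow> real) \<Rightarrow> (real \<times> real \<Rightarrow> real) \<Rightarrow> bool" where
  "surface_bernoulli \<gamma> g \<sigma> \<rho> \<xi> \<eta> \<longleftrightarrow> (\<forall>t\<ge>0. \<forall>x. let p = (x, t) in
     dt \<xi> p + 1/2 * (dx \<xi> p)\<^sup>2 - \<gamma> * inv_dx (dt \<eta>) p + g * \<eta> p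
     + \<gamma> * \<eta> p * (2 * dt \<eta> p * dx \<eta> p - 2 * dx \<xi> p + \<gamma> * \<eta> p) / (2 * (1 + (dx \<eta> p)\<^sup>2))
     - (dt \<eta> p + dx \<eta> p * dx \<xi> p)\<^sup>2 / (2 * (1 + (dx \<eta> p)\<^sup>2))
     = surface_tension \<sigma> \<rho> \<eta> p)"


section \<open>Regularity and decay\<close>

definition admissible_surface :: "real \<Rightarrow> (real \<times> real \<Rightarrow> real) \<Rightarrow> bool" where
  "admissible_surface h \<eta> \<longleftrightarrow>
     (\<forall>p\<in>half_plane. \<eta> p > - h) \<and> C2_on half_plane \<eta> \<and>
     decaying \<eta> \<and> decaying (dx \<eta>) \<and> decaying (dt \<eta>) \<and>
     decaying (dx (dx \<eta>)) \<and> decaying (dx (dt \<eta>))"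

text \<open>
  Only the derivatives of the trace decay: the potential itself may have different limits at the
  two ends of the channel.
\<close>

definition admissible_trace :: "(real \<times> real \<Rightarrow> real) \<Rightarrow> bool" where
  "admissible_trace \<xi> \<longleftrightarrow>
     C2_on half_plane \<xi> \<and> decaying (dx \<xi>) \<and> decaying (dx (dx \<xi>))"

text \<open>
  The potential is C2 inside the fluid, its spatial gradient is continuous up to the boundary
  (jointly in space and time) and tends to 0 at infinity uniformly in y, and it has a total
  space-time derivative at the points of the free surface, the only place where the problem
  involves a time derivative of the potential.
\<close>

definition admissible_potential ::
  "real \<Rightarrow> (real \<times> real \<Rightarrow> real) \<Rightarrow> (real \<times> real \<times> real \<Rightarrow> real) \<Rightarrow> bool" where
  "admissible_potential h \<eta> \<phi> \<longleftrightarrow>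
     (\<forall>t\<ge>0. C2_on (fluid h \<eta> t) (at_time \<phi> t)) \<and>
     (\<forall>t\<ge>0. at_time \<phi> t differentiable_on closed_fluid h \<eta> t) \<and>
     continuous_on (spacetime h \<eta>) (pot_x h \<eta> \<phi>) \<and>
     continuous_on (spacetime h \<eta>) (pot_y h \<eta> \<phi>) \<and>
     (\<forall>t\<ge>0. \<forall>x. \<phi> differentiable (at (x, \<eta> (x, t), t) within spacetime h \<eta>)) \<and>
     (\<forall>t\<ge>0. \<forall>\<epsilon>>0. \<exists>R. \<forall>(x, y)\<in>closed_fluid h \<eta> t. \<bar>x\<bar> > R \<longrightarrow>
        \<bar>pot_x h \<eta> \<phi> (x, y, t)\<bar> < \<epsilon> \<and> \<bar>pot_y h \<eta> \<phi> (x, y, t)\<bar> < \<epsilon>)"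

definition is_trace ::
  "(real \<times> real \<times> real \<Rightarrow> real) \<Rightarrow> (real \<times> real \<Rightarrow> real) \<Rightarrow> (real \<times> real \<Rightarrow> real) \<Rightarrow> bool" where
  "is_trace \<phi> \<eta> \<xi> \<longleftrightarrow> (\<forall>t\<ge>0. \<forall>x. \<xi> (x, t) = \<phi> (x, \<eta> (x, t), t))"

end

theory Submission
  imports Defs "HOL-Complex_Analysis.Complex_Analysis"
begin

text \<open>
  Shift the bottom to the real axis and write \<open>z = x + i(y + h)\<close>, \<open>H = \<eta> + h\<close>. The field
  \<open>f = \<phi>\<^sub>x - i \<phi>\<^sub>y\<close> is holomorphic in the fluid, real on the bottom, and on the surface
  \<open>f (1 + i \<eta>\<^sub>x) = G\<close> with \<open>G = \<xi>\<^sub>x - i(\<eta>\<^sub>t - \<gamma> \<eta> \<eta>\<^sub>x)\<close>. Cauchy's theorem for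
  \<open>f(z) exp(-ikz)\<close> and its conjugate with \<open>-k\<close> gives the nonlocal equation.

  Conversely, reflect the surface in the bottom and take the Cauchy integral of \<open>G\<close> and its conjugate
  over the two curves. The nonlocal equation for \<open>k > 0\<close> says that this integral vanishes above the surface.
  Subtracting its value at the mirror point above the surface turns the Cauchy kernel into a Poisson-like
  kernel, so the integral extends continuously, jointly in space and time, to the surface with value
  \<open>G / (1 + i \<eta>\<^sub>x)\<close>. The potential is recovered from \<open>\<xi>\<close> by vertical integration.

  Given the kinematic condition, the two Bernoulli equations agree by algebra, since
  \<open>\<xi>\<^sub>x = \<phi>\<^sub>x + \<phi>\<^sub>y \<eta>\<^sub>x\<close> and \<open>\<xi>\<^sub>t = \<phi>\<^sub>t + \<phi>\<^sub>y \<eta>\<^sub>t\<close> on the surface.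
\<close>

section \<open>Derivatives within sets\<close>

text \<open>In the difference of the kernels at two mirrored points, scaled by the distance d to the
  surface, everything is dominated by a multiple of 1/(s^2+1), with a constant depending only on the
  slope bound. Dominated convergence then replaces singular integrals, and a whole sequence of
  channels with common constants can be passed to the limit; this yields continuity in time as well.
  With the reflected curve included, the Cauchy integral is real on the bottom and holomorphic
  across it, so the bottom condition holds by symmetry. Positive \<open>k\<close> suffice in the
  converse because the integral for \<open>-k\<close> is minus the conjugate of the one for
  \<open>k\<close>. In the direct part the field is holomorphic only inside, so contours are the
  scaled graphs s H with 0 < s < 1, followed by limits in s. In the converse the field is only known
  to be continuous at the surface; integrating downwards from the trace makes that enough for
  differentiability there.\<close>

lemma has_derivative_unique_along_curve:
  fixes u :: "'a::real_normed_vector \<Rightarrow> real"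
  assumes D: "(u has_derivative D) (at (c 0) within S)" "(u has_derivative D') (at (c 0) within S)"
    and c: "(c has_vector_derivative v) (at 0 within {0..\<delta>})" and \<delta>: "\<delta> > 0"
    and sub: "\<And>s. s \<in> {0..\<delta>} \<Longrightarrow> c s \<in> S"
  shows "D v = D' v"
proof -
  have img: "c ` {0..\<delta>} \<subseteq> S" using sub by auto
  have *: "((\<lambda>s. u (c s)) has_vector_derivative E v) (at 0 within {0..\<delta>})"
    if "(u has_derivative E) (at (c 0) within S)" for E
  proof -
    have "(u has_derivative E) (at (c 0) within c ` {0..\<delta>})"
      using that img by (rule has_derivative_subset)
    then have "((u \<circ> c) has_derivative (E \<circ> (\<lambda>s. s *\<^sub>R v))) (at 0 within {0..\<delta>})"
      using c unfolding has_vector_derivative_def by (intro diff_chain_within)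
    moreover have "E \<circ> (\<lambda>s. s *\<^sub>R v) = (\<lambda>s. s *\<^sub>R E v)"
      using linear_scale[OF has_derivative_linear[OF that]] by auto
    ultimately show ?thesis by (simp add: has_vector_derivative_def o_def)
  qed
  have "at (0::real) within {0..\<delta>} \<noteq> bot" using \<delta> by (simp add: trivial_limit_within islimpt_greaterThanLessThan1 islimpt_Icc)
  then show ?thesis
    using vector_derivative_unique_within *[OF D(1)] *[OF D(2)] by blast
qed

lemma dderiv_open:
  assumes "open S" "p \<in> S" "(u has_derivative D) (at p)"
  shows "dderiv S v u p = D v"
  unfolding dderiv_def at_within_open[OF assms(2,1)] frechet_derivative_at[OF assms(3), symmetric] ..

lemma dderiv_cong:
  assumes "\<And>q. q \<in> S \<Longrightarrow> u q = v q" "p \<in> S"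
  shows "dderiv S d u p = dderiv S d v p"
proof -
  have "(u has_derivative D) (at p within S) \<longleftrightarrow> (v has_derivative D) (at p within S)" for D
    using assms by (metis has_derivative_transform)
  then show ?thesis by (simp add: dderiv_def frechet_derivative_def)
qed

lemma C1_on_cong:
  assumes "\<And>q. q \<in> S \<Longrightarrow> u q = v q"
  shows "C1_on S u \<longleftrightarrow> C1_on S v"
proof -
  have "u differentiable_on S \<longleftrightarrow> v differentiable_on S"
    using assms unfolding differentiable_on_def differentiable_def by (metis has_derivative_transform)
  moreover have "continuous_on S (dderiv S d u) \<longleftrightarrow> continuous_on S (dderiv S d v)" for d
    by (rule continuous_on_cong[OF refl]) (rule dderiv_cong[OF assms])
  ultimately show ?thesis by (simp add: C1_on_def)
qed

lemma dderiv_has_derivative: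
  assumes "u differentiable (at p within S)"
  shows "(u has_derivative (\<lambda>v. dderiv S v u p)) (at p within S)"
  using assms by (simp add: dderiv_def frechet_derivative_works)

lemma dderiv_pair:
  fixes u :: "real \<times> real \<Rightarrow> real"
  assumes "u differentiable (at p within S)"
  shows "dderiv S v u p = fst v * dderiv S (1, 0) u p + snd v * dderiv S (0, 1) u p"
proof -
  interpret linear "\<lambda>v. dderiv S v u p"
    using dderiv_has_derivative[OF assms] by (rule has_derivative_linear)
  have "v = fst v *\<^sub>R (1, 0) + snd v *\<^sub>R (0, 1)" by (simp add: prod_eq_iff)
  then show ?thesis by (metis add scale real_scaleR_def)
qed

lemma C1_onI:
  fixes u :: "real \<times> real \<Rightarrow> real"
  assumes S: "open S"
    and d: "\<And>p. p \<in> S \<Longrightarrow> (u has_derivative (\<lambda>v. fst v * a p + snd v * b p)) (at p)"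
    and c: "continuous_on S a" "continuous_on S b"
  shows "C1_on S u"
  unfolding C1_on_def
proof
  show "u differentiable_on S"
    using d differentiable_at_withinI by (force simp: differentiable_on_def differentiable_def)
  have "dderiv S v u p = fst v * a p + snd v * b p" if "p \<in> S" for v p
    using dderiv_open[OF S that d[OF that]] .
  moreover have "continuous_on S (\<lambda>p. fst v * a p + snd v * b p)" for v
    using c by (intro continuous_intros)
  ultimately show "\<forall>v. continuous_on S (dderiv S v u)"
    by (simp cong: continuous_on_cong)
qed

section \<open>Mixed partial derivatives\<close>

lemma has_derivative_partials:
  fixes u :: "real \<times> real \<Rightarrow> real"
  assumes "(u has_derivative (\<lambda>v. fst v * a + snd v * b)) (at (x, y))"
  shows "((\<lambda>s. u (s, y)) has_real_derivative a) (at x)"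
    "((\<lambda>s. u (x, s)) has_real_derivative b) (at y)"
proof -
  have "((\<lambda>s. u (s, y)) has_derivative (\<lambda>s. fst (s, 0::real) * a + snd (s, 0::real) * b)) (at x)"
    by (rule has_derivative_compose[where f = "\<lambda>s. (s, y)" and g = u, OF _ assms, simplified])
       (auto intro!: derivative_eq_intros)
  then show "((\<lambda>s. u (s, y)) has_real_derivative a) (at x)"
    by (simp add: has_field_derivative_def mult_commute_abs)
  have "((\<lambda>s. u (x, s)) has_derivative (\<lambda>s. fst (0::real, s) * a + snd (0::real, s) * b)) (at y)"
    by (rule has_derivative_compose[where f = "\<lambda>s. (x, s)" and g = u, OF _ assms, simplified])
       (auto intro!: derivative_eq_intros)
  then show "((\<lambda>s. u (x, s)) has_real_derivative b) (at y)"
    by (simp add: has_field_derivative_def mult_commute_abs)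
qed

text \<open>The mean value theorem is applied to \<open>s \<mapsto> u s (y+d) - u s y\<close>, then
  to \<open>p s\<close> at the \<open>s\<close> so found. The second difference is symmetric in the
  two variables, which makes the two orders of differentiation comparable.\<close>

lemma second_difference_mean_value:
  fixes u p r :: "real \<Rightarrow> real \<Rightarrow> real"
  assumes d: "d > 0"
    and u: "\<And>s t. s \<in> {x..x+d} \<Longrightarrow> t \<in> {y..y+d} \<Longrightarrow> ((\<lambda>s. u s t) has_real_derivative p s t) (at s)"
    and p: "\<And>s t. s \<in> {x..x+d} \<Longrightarrow> t \<in> {y..y+d} \<Longrightarrow> (p s has_real_derivative r s t) (at t)"
  shows "\<exists>s\<in>{x..x+d}. \<exists>t\<in>{y..y+d}. u (x+d) (y+d) - u (x+d) y - u x (y+d) + u x y = d\<^sup>2 * r s t"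
proof -
  have "\<exists>s>x. s < x+d \<and> (u (x+d) (y+d) - u (x+d) y) - (u x (y+d) - u x y) =
      (x+d-x) * (p s (y+d) - p s y)"
    using d by (intro MVT2) (auto intro!: derivative_intros u)
  then obtain s where s': "x < s" "s < x+d"
    "(u (x+d) (y+d) - u (x+d) y) - (u x (y+d) - u x y) = (x+d-x) * (p s (y+d) - p s y)"
    by blast
  then have s: "s \<in> {x..x+d}" by simp
  have "\<exists>t>y. t < y+d \<and> p s (y+d) - p s y = (y+d-y) * r s t"
    using d s by (intro MVT2) (auto intro!: p)
  then obtain t where t: "y < t" "t < y+d" "p s (y+d) - p s y = (y+d-y) * r s t"
    by blast
  have "u (x+d) (y+d) - u (x+d) y - u x (y+d) + u x y = d\<^sup>2 * r s t"
    using s'(3) unfolding t(3) by (simp add: power2_eq_square)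
  then show ?thesis using s t by (intro bexI[of _ s] bexI[of _ t]) auto
qed

text \<open>Evaluating one second difference over a small square in both orders shows that
  \<open>p2\<close> and \<open>q1\<close> take a common value at two points near \<open>z\<close>;
  continuity turns this into equality at \<open>z\<close>.\<close>

lemma mixed_partials_eq:
  fixes u p q :: "real \<times> real \<Rightarrow> real"
  assumes S: "open S" "z \<in> S"
    and u: "\<And>z. z \<in> S \<Longrightarrow> (u has_derivative (\<lambda>v. fst v * p z + snd v * q z)) (at z)"
    and p: "\<And>z. z \<in> S \<Longrightarrow> (p has_derivative (\<lambda>v. fst v * p1 z + snd v * p2 z)) (at z)"
    and q: "\<And>z. z \<in> S \<Longrightarrow> (q has_derivative (\<lambda>v. fst v * q1 z + snd v * q2 z)) (at z)"
    and c: "continuous_on S p2" "continuous_on S q1"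
  shows "p2 z = q1 z"
proof -
  obtain x y where z: "z = (x, y)" by force
  have "\<bar>p2 z - q1 z\<bar> < e" if "e > 0" for e
  proof -
    have "isCont p2 z" "isCont q1 z" using c S by (auto simp: continuous_on_eq_continuous_at)
    then have "\<forall>\<^sub>F w in at z. dist (p2 w) (p2 z) < e/2" "\<forall>\<^sub>F w in at z. dist (q1 w) (q1 z) < e/2"
      unfolding isCont_def using half_gt_zero[OF that] tendstoD by blast+
    moreover have "\<forall>\<^sub>F w in at z. w \<in> S"
      using S by (simp add: eventually_at_in_open')
    ultimately have "\<forall>\<^sub>F w in at z. w \<in> S \<and> dist (p2 w) (p2 z) < e/2 \<and> dist (q1 w) (q1 z) < e/2"
      by eventually_elim auto
    then obtain \<delta> where \<delta>: "\<delta> > 0"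
      "\<And>w. dist w z < \<delta> \<Longrightarrow> w \<in> S \<and> dist (p2 w) (p2 z) < e/2 \<and> dist (q1 w) (q1 z) < e/2"
      using S \<open>e > 0\<close> unfolding eventually_at by (metis dist_self half_gt_zero UNIV_I)
    \<comment> \<open>The distance to the corner \<open>z\<close> is at most the sum of the two side
      lengths, \<open>2 * \<delta> / 3\<close>, so the closed square stays inside the ball.\<close>
    define d where "d = \<delta>/3"
    have d: "d > 0" using \<delta> by (simp add: d_def)
    have near: "dist (s, t) z < \<delta>" if "s \<in> {x..x+d}" "t \<in> {y..y+d}" for s t
    proof -
      have "dist (s, t) z \<le> \<bar>s - x\<bar> + \<bar>t - y\<bar>"
        unfolding z dist_Pair_Pair dist_real_def by (rule sqrt_sum_squares_le_sum_abs[THEN order_trans]) simp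
      also have "\<dots> < \<delta>" using that \<delta>(1) by (auto simp: d_def)
      finally show ?thesis .
    qed
    have inS: "(s, t) \<in> S" if "s \<in> {x..x+d}" "t \<in> {y..y+d}" for s t
      using \<delta>(2)[OF near[OF that]] by simp
    obtain s t where st: "s \<in> {x..x+d}" "t \<in> {y..y+d}"
      "u (x+d, y+d) - u (x+d, y) - u (x, y+d) + u (x, y) = d\<^sup>2 * p2 (s, t)"
      using second_difference_mean_value[OF d, of x y "\<lambda>s t. u (s, t)" "\<lambda>s t. p (s, t)" "\<lambda>s t. p2 (s, t)"]
        has_derivative_partials(1)[OF u[OF inS]] has_derivative_partials(2)[OF p[OF inS]] by auto
    obtain t' s' where st': "s' \<in> {x..x+d}" "t' \<in> {y..y+d}"
      "u (x+d, y+d) - u (x, y+d) - u (x+d, y) + u (x, y) = d\<^sup>2 * q1 (s', t')"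
      using second_difference_mean_value[OF d, of y x "\<lambda>t s. u (s, t)" "\<lambda>t s. q (s, t)" "\<lambda>t s. q1 (s, t)"]
        has_derivative_partials(2)[OF u[OF inS]] has_derivative_partials(1)[OF q[OF inS]] by auto
    have "d\<^sup>2 * p2 (s, t) = d\<^sup>2 * q1 (s', t')" using st(3) st'(3) by linarith
    then have "p2 (s, t) = q1 (s', t')" using d by simp
    then show ?thesis
      using \<delta>(2)[OF near[OF st(1,2)]] \<delta>(2)[OF near[OF st'(1,2)]] unfolding dist_real_def by argo
  qed
  from this[of "\<bar>p2 z - q1 z\<bar>"] show ?thesis by (cases "p2 z = q1 z") auto
qed

section \<open>Harmonic and holomorphic functions\<close>

lemma has_derivative_shift:
  "((\<lambda>p. Complex (fst p) (snd p + h)) has_derivative (\<lambda>v. Complex (fst v) (snd v))) F"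
  unfolding Complex_eq by (auto intro!: derivative_eq_intros)

lemma has_derivative_holomorphic_shift:
  assumes "(f has_field_derivative f') (at (Complex x (y + h)))"
  shows "((\<lambda>p. f (Complex (fst p) (snd p + h))) has_derivative (\<lambda>v. f' * Complex (fst v) (snd v))) (at (x, y))"
  using has_derivative_compose[where f = "\<lambda>p. Complex (fst p) (snd p + h)" and g = f,
      OF has_derivative_shift, of "(*) f'" "(x, y)" UNIV] assms
  by (simp add: has_field_derivative_def)

text \<open>Of the two Cauchy-Riemann equations for the complex velocity, one is the symmetry of the
  mixed partials of \<open>u\<close> and the other is the Laplace equation.\<close>

lemma harmonic_imp_holomorphic:
  fixes u :: "real \<times> real \<Rightarrow> real"
  assumes S: "open S" and u: "C2_on S u" and lap: "\<And>p. p \<in> S \<Longrightarrow> laplacian S u p = 0"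
    and z: "(Re z, Im z - h) \<in> S"
  shows "(\<lambda>z. Complex (dderiv S (1, 0) u (Re z, Im z - h)) (- dderiv S (0, 1) u (Re z, Im z - h)))
     field_differentiable at z"
proof -
  define p q where "p = dderiv S (1, 0) u" and "q = dderiv S (0, 1) u"
  have C1: "C1_on S u" "C1_on S p" "C1_on S q" using u by (auto simp: C2_on_def p_def q_def)
  have *: "(w has_derivative (\<lambda>v. fst v * dderiv S (1, 0) w z + snd v * dderiv S (0, 1) w z)) (at z)"
    if "C1_on S w" "z \<in> S" for w z
  proof -
    have d: "w differentiable (at z within S)" using that by (auto simp: C1_on_def differentiable_on_def)
    have "(\<lambda>v. dderiv S v w z) = (\<lambda>v. fst v * dderiv S (1, 0) w z + snd v * dderiv S (0, 1) w z)"
      using dderiv_pair[OF d] by (rule ext)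
    then show ?thesis
      using dderiv_has_derivative[OF d] at_within_open[OF that(2) S] by (simp only:)
  qed
  have cont: "continuous_on S (dderiv S v w)" if "C1_on S w" for w v
    using that unfolding C1_on_def by blast
  have mixed: "dderiv S (0, 1) p w = dderiv S (1, 0) q w" if "w \<in> S" for w
    by (rule mixed_partials_eq[OF S that *[OF C1(1), folded p_def q_def] *[OF C1(2)] *[OF C1(3)]])
       (auto intro: cont C1)
  have lap': "dderiv S (0, 1) q w = - dderiv S (1, 0) p w" if "w \<in> S" for w
    using lap[OF that] by (simp add: laplacian_def Basis_prod_def p_def q_def sum.union_disjoint)
  let ?w = "(Re z, Im z - h)"
  let ?a = "dderiv S (1, 0) p ?w" and ?b = "dderiv S (1, 0) q ?w"
  have sh: "((\<lambda>z. (Re z, Im z - h)) has_derivative (\<lambda>v. (Re v, Im v))) (at z)"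
    by (auto intro!: derivative_eq_intros)
  have "((\<lambda>z. p (Re z, Im z - h)) has_derivative (\<lambda>v. Re v * ?a + Im v * ?b)) (at z)"
    using has_derivative_compose[OF sh *[OF C1(2) z]] mixed[OF z] by simp
  moreover have "((\<lambda>z. q (Re z, Im z - h)) has_derivative (\<lambda>v. Re v * ?b - Im v * ?a)) (at z)"
    using has_derivative_compose[OF sh *[OF C1(3) z]] lap'[OF z] by simp
  ultimately have "((\<lambda>z. of_real (p (Re z, Im z - h)) + \<i> * of_real (- q (Re z, Im z - h)))
     has_derivative (\<lambda>v. of_real (Re v * ?a + Im v * ?b) + \<i> * of_real (- (Re v * ?b - Im v * ?a)))) (at z)"
    by (auto intro!: derivative_eq_intros simp: algebra_simps)
  \<comment> \<open>The real derivative is multiplication by a single complex number, that is,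
    complex linear.\<close>
  moreover have "of_real (Re v * ?a + Im v * ?b) + \<i> * of_real (- (Re v * ?b - Im v * ?a)) =
       Complex ?a (- ?b) * v" for v
    by (simp add: complex_eq_iff algebra_simps)
  ultimately have "((\<lambda>z. of_real (p (Re z, Im z - h)) + \<i> * of_real (- q (Re z, Im z - h)))
     has_field_derivative Complex ?a (- ?b)) (at z)"
    by (simp add: has_field_derivative_def)
  then show ?thesis
    unfolding field_differentiable_def p_def q_def Complex_eq by blast
qed

text \<open>The gradient of \<open>Re P\<close> is \<open>(Re f, - Im f)\<close>, and
  \<open>f\<close>, being a derivative, is holomorphic itself. All second derivatives are therefore
  real and imaginary parts of \<open>deriv f\<close>, where the two pure ones cancel.\<close>

lemma holomorphic_imp_harmonic:
  fixes u :: "real \<times> real \<Rightarrow> real"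
  assumes V: "open V" and P: "\<And>z. z \<in> V \<Longrightarrow> (P has_field_derivative f z) (at z)"
    and S: "open S" and SV: "\<And>x y. (x, y) \<in> S \<Longrightarrow> Complex x (y + h) \<in> V"
    and u: "\<And>x y. (x, y) \<in> S \<Longrightarrow> u (x, y) = Re (P (Complex x (y + h))) + C"
  shows "C2_on S u" "p \<in> S \<Longrightarrow> laplacian S u p = 0"
proof -
  define T where "T = (\<lambda>p. Complex (fst p) (snd p + h))"
  have T: "T p \<in> V" if "p \<in> S" for p using SV that by (cases p) (auto simp: T_def)
  have "P holomorphic_on V" using P V holomorphic_on_open by blast
  moreover have fP: "f z = deriv P z" if "z \<in> V" for z using P[OF that] by (simp add: DERIV_imp_deriv)
  ultimately have f: "f holomorphic_on V"
    using holomorphic_deriv[OF _ V] by (metis holomorphic_cong)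
  define f' where "f' = deriv f"
  have f'h: "f' holomorphic_on V" unfolding f'_def using holomorphic_deriv[OF f V] .
  have f': "(f has_field_derivative f' z) (at z)" if "z \<in> V" for z
    using holomorphic_derivI[OF f V that] by (simp add: f'_def)
  have cT: "continuous_on S (\<lambda>p. k (T p))" if "k holomorphic_on V" for k
  proof -
    have "continuous_on S T" unfolding T_def Complex_eq by (intro continuous_intros)
    then show ?thesis using continuous_on_compose2[OF holomorphic_on_imp_continuous_on[OF that]] T
      by blast
  qed
  have Tp: "T p = Complex (fst p) (snd p + h)" for p by (simp add: T_def)
  have du0: "((\<lambda>p. Re (P (T p)) + C) has_derivative (\<lambda>v. fst v * Re (f (T p)) + snd v * - Im (f (T p)))) (at p)"
    if "p \<in> S" for p
  proof -
    have "((\<lambda>p. P (T p)) has_derivative (\<lambda>v. f (T p) * Complex (fst v) (snd v))) (at p)"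
      using has_derivative_holomorphic_shift[of P "f (T p)" "fst p" "snd p" h] P[OF T[OF that]]
      by (simp add: T_def)
    from has_derivative_add[OF has_derivative_Re[OF this] has_derivative_const[of C]]
    show ?thesis by (simp add: algebra_simps)
  qed
  have du: "(u has_derivative (\<lambda>v. fst v * Re (f (T p)) + snd v * - Im (f (T p)))) (at p)"
    if "p \<in> S" for p
    by (rule has_derivative_transform_within_open[OF du0[OF that] S that]) (use u in \<open>auto simp: T_def\<close>)
  have df: "((\<lambda>p. f (T p)) has_derivative (\<lambda>v. f' (T p) * Complex (fst v) (snd v))) (at p)"
    if "p \<in> S" for p
    using has_derivative_holomorphic_shift[of f "f' (T p)" "fst p" "snd p" h] f'[OF T[OF that]]
    by (simp add: T_def)
  have dd: "dderiv S v u p = fst v * Re (f (T p)) + snd v * - Im (f (T p))" if "p \<in> S" for p v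
    using dderiv_open[OF S that du[OF that]] .
  have dv: "((\<lambda>p. fst v * Re (f (T p)) + snd v * - Im (f (T p))) has_derivative
     (\<lambda>d. fst d * (fst v * Re (f' (T p)) - snd v * Im (f' (T p)))
        + snd d * (- fst v * Im (f' (T p)) - snd v * Re (f' (T p))))) (at p)" if "p \<in> S" for p v
    using df[OF that] by (auto intro!: derivative_eq_intros ext simp: algebra_simps)
  have "C1_on S u"
    by (rule C1_onI[OF S du]) (auto intro!: continuous_intros cT f)
  moreover have "C1_on S (dderiv S v u)" for v
  proof -
    have "C1_on S (\<lambda>p. fst v * Re (f (T p)) + snd v * - Im (f (T p)))"
      by (rule C1_onI[OF S dv]) (auto intro!: continuous_intros cT f'h)
    then show ?thesis by (subst C1_on_cong[OF dd])
  qed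
  ultimately show "C2_on S u" by (simp add: C2_on_def)
  assume p: "p \<in> S"
  have "dderiv S w (dderiv S v u) p = fst w * (fst v * Re (f' (T p)) - snd v * Im (f' (T p)))
        + snd w * (- fst v * Im (f' (T p)) - snd v * Re (f' (T p)))" for v w
  proof -
    have "dderiv S w (dderiv S v u) p = dderiv S w (\<lambda>p. fst v * Re (f (T p)) + snd v * - Im (f (T p))) p"
      by (rule dderiv_cong[OF dd p])
    also have "\<dots> = fst w * (fst v * Re (f' (T p)) - snd v * Im (f' (T p)))
        + snd w * (- fst v * Im (f' (T p)) - snd v * Re (f' (T p)))"
      by (rule dderiv_open[OF S p dv[OF p]])
    finally show ?thesis .
  qed
  then show "laplacian S u p = 0"
    by (simp add: laplacian_def Basis_prod_def sum.union_disjoint)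
qed

section \<open>Integrals over the real line\<close>

lemma tendsto_integral_sequence:
  fixes s :: "nat \<Rightarrow> real \<Rightarrow> 'b::{banach, second_countable_topology}"
  assumes [measurable]: "\<And>n. s n \<in> borel_measurable lborel" "l \<in> borel_measurable lborel"
    and w: "integrable lborel w"
    and bd: "\<forall>\<^sub>F n in sequentially. \<forall>x. norm (s n x) \<le> w x"
    and lim: "\<And>x. (\<lambda>n. s n x) \<longlonglongrightarrow> l x"
  shows "(\<lambda>n. integral\<^sup>L lborel (s n)) \<longlonglongrightarrow> integral\<^sup>L lborel l"
proof -
  obtain N where N: "\<And>n x. n \<ge> N \<Longrightarrow> norm (s n x) \<le> w x"
    using bd by (auto simp: eventually_sequentially)
  have "(\<lambda>n. integral\<^sup>L lborel (s (n + N))) \<longlonglongrightarrow> integral\<^sup>L lborel l"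
    by (rule integral_dominated_convergence[where w = w])
       (use w N LIMSEQ_ignore_initial_segment[OF lim] in auto)
  then show ?thesis by (rule LIMSEQ_offset)
qed

text \<open>Dominated convergence concerns sequences; limits at a point of a metric space can be
  tested on sequences, which reduces this filter version to the previous one.\<close>

lemma tendsto_integral_at_within:
  fixes f :: "'p::metric_space \<Rightarrow> real \<Rightarrow> 'b::{banach, second_countable_topology}"
  assumes [measurable]: "\<And>p. f p \<in> borel_measurable lborel" "l \<in> borel_measurable lborel"
    and w: "integrable lborel w"
    and bd: "\<forall>\<^sub>F p in at p0 within U. \<forall>x. norm (f p x) \<le> w x"
    and lim: "\<And>x. ((\<lambda>p. f p x) \<longlongrightarrow> l x) (at p0 within U)"
  shows "((\<lambda>p. integral\<^sup>L lborel (f p)) \<longlongrightarrow> integral\<^sup>L lborel l) (at p0 within U)"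
  unfolding tendsto_at_iff_sequentially o_def
proof safe
  fix X assume X: "\<forall>i. X i \<in> U - {p0}" "X \<longlonglongrightarrow> p0"
  have F: "filterlim X (at p0 within U) sequentially"
    using X by (auto simp: filterlim_at)
  show "(\<lambda>n. integral\<^sup>L lborel (f (X n))) \<longlonglongrightarrow> integral\<^sup>L lborel l"
  proof (rule tendsto_integral_sequence[OF _ _ w])
    show "\<forall>\<^sub>F n in sequentially. \<forall>x. norm (f (X n) x) \<le> w x"
      using bd F by (rule eventually_compose_filterlim)
  qed (auto intro: filterlim_compose[OF lim F])
qed

text \<open>The primitive is \<open>arctan (s / m) / m\<close>. This is the dominating function for
  both halves of the Poisson-like kernel: \<open>m = 1\<close> after rescaling at the surface, and
  the minimal depth on the mirror curve.\<close>

lemma integrable_inverse_square_plus: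
  assumes m: "(m::real) > 0"
  shows "integrable lborel (\<lambda>s. 1 / (s\<^sup>2 + m\<^sup>2))"
proof -
  have "set_integrable lborel (einterval (-\<infinity>) \<infinity>) (\<lambda>s. 1 / (s\<^sup>2 + m\<^sup>2))"
  proof (rule interval_integral_FTC_nonneg(1)[where F = "\<lambda>s. arctan (s / m) / m"])
    fix x :: real
    have "((\<lambda>s. arctan (s / m) / m) has_real_derivative (1 / m) / (1 + (x / m)\<^sup>2) / m) (at x)"
      by (auto intro!: derivative_eq_intros simp: divide_simps)
    moreover have "(1 / m) / (1 + (x / m)\<^sup>2) / m = 1 / (x\<^sup>2 + m\<^sup>2)"
    proof -
      have "m * m * (1 + (x / m)\<^sup>2) = x\<^sup>2 + m\<^sup>2"
        using m by (simp add: power_divide algebra_simps power2_eq_square)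
      then show ?thesis by (simp add: mult.commute mult.left_commute)
    qed
    ultimately show "((\<lambda>s. arctan (s / m) / m) has_real_derivative 1 / (x\<^sup>2 + m\<^sup>2)) (at x)" by simp
    have "x\<^sup>2 + m\<^sup>2 \<noteq> 0" using m by (simp add: sum_power2_eq_zero_iff)
    then show "isCont (\<lambda>s. 1 / (s\<^sup>2 + m\<^sup>2)) x" by (intro continuous_intros) auto
  next
    have "filterlim (\<lambda>x. x / m) at_top at_top"
      using m by real_asymp
    from filterlim_compose[OF tendsto_arctan_at_top this]
    show "(((\<lambda>s. arctan (s / m) / m) \<circ> real_of_ereal) \<longlongrightarrow> pi / 2 / m) (at_left \<infinity>)"
      unfolding ereal_tendsto_simps by (intro tendsto_divide tendsto_const) (use m in auto)
    have "filterlim (\<lambda>x. x / m) at_bot at_bot"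
      using m by real_asymp
    from filterlim_compose[OF tendsto_arctan_at_bot this]
    show "(((\<lambda>s. arctan (s / m) / m) \<circ> real_of_ereal) \<longlongrightarrow> - (pi / 2) / m) (at_right (-\<infinity>))"
      unfolding ereal_tendsto_simps by (intro tendsto_divide tendsto_const) (use m in auto)
  qed (auto)
  then show ?thesis by (simp add: set_integrable_def einterval_def)
qed

text \<open>This writes a Cauchy kernel as a superposition of exponentials with positive wave
  number. With \<open>\<zeta>\<close> a curve point minus \<open>z\<close>, the sign condition says
  that \<open>z\<close> lies higher than the curve point.\<close>

lemma integral_exp_half_line:
  fixes \<zeta> :: complex
  assumes \<zeta>: "Im \<zeta> < 0"
  shows "integrable lborel (\<lambda>k::real. indicator {0<..} k *\<^sub>R exp (- \<i> * of_real k * \<zeta>))"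
    and "(LINT k|lborel. indicator {0<..} k *\<^sub>R exp (- \<i> * of_real k * \<zeta>)) = 1 / (\<i> * \<zeta>)"
proof -
  have nz: "\<zeta> \<noteq> 0" using \<zeta> by auto
  define r where "r = - Im \<zeta>"
  have r: "r > 0" using \<zeta> by (simp add: r_def)
  have norm: "norm (exp (- \<i> * of_real k * \<zeta>)) = exp (- (r * k))" for k
    by (simp add: norm_exp_eq_Re r_def mult.commute)
  have e0: "einterval 0 \<infinity> = {0<..}" by (auto simp: einterval_def)
  have lim0: "((\<lambda>k. exp (- (r * k))) \<longlongrightarrow> 0) at_top"
    using r by real_asymp
  have "set_integrable lborel (einterval 0 \<infinity>) (\<lambda>k. exp (- (r * k)))"
  proof (rule interval_integral_FTC_nonneg(1)[where F = "\<lambda>k. - exp (- (r * k)) / r"])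
    show "((\<lambda>k. - exp (- (r * k)) / r) has_real_derivative exp (- (r * x))) (at x)" for x
      using r by (auto intro!: derivative_eq_intros)
    show "(((\<lambda>k. - exp (- (r * k)) / r) \<circ> real_of_ereal) \<longlongrightarrow> - 1 / r) (at_right 0)"
      unfolding zero_ereal_def ereal_tendsto_simps using r by (auto intro!: tendsto_eq_intros)
    show "(((\<lambda>k. - exp (- (r * k)) / r) \<circ> real_of_ereal) \<longlongrightarrow> - 0 / r) (at_left \<infinity>)"
      unfolding ereal_tendsto_simps using r by (intro tendsto_intros lim0) auto
  qed auto
  then have int: "integrable lborel (\<lambda>k. indicator {0<..} k *\<^sub>R exp (- (r * k)))"
    by (simp add: set_integrable_def e0)
  show int': "integrable lborel (\<lambda>k::real. indicator {0<..} k *\<^sub>R exp (- \<i> * of_real k * \<zeta>))"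
    by (rule Bochner_Integration.integrable_bound[OF int])
       (auto simp: r_def mult.commute norm_exp_eq_Re indicator_def)
  have "(LBINT k=0..\<infinity>. exp (- \<i> * of_real k * \<zeta>)) = 0 - (- (1 / (\<i> * \<zeta>)))"
  proof (rule interval_integral_FTC_integrable[where F = "\<lambda>k. - exp (- \<i> * of_real k * \<zeta>) / (\<i> * \<zeta>)"])
    show "((\<lambda>k. - exp (- \<i> * of_real k * \<zeta>) / (\<i> * \<zeta>)) has_vector_derivative exp (- \<i> * of_real x * \<zeta>)) (at x)" for x
    proof -
      have "((\<lambda>k. - exp (- \<i> * k * \<zeta>) / (\<i> * \<zeta>)) has_field_derivative exp (- \<i> * of_real x * \<zeta>)) (at (of_real x))"
        using nz by (auto intro!: derivative_eq_intros)
      from has_vector_derivative_real_field[OF this] show ?thesis by simp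
    qed
    show "isCont (\<lambda>k. exp (- \<i> * of_real k * \<zeta>)) x" for x :: real by (intro continuous_intros)
    show "set_integrable lborel (einterval 0 \<infinity>) (\<lambda>k. exp (- \<i> * of_real k * \<zeta>))"
      using int' by (simp add: set_integrable_def e0)
    have "((\<lambda>k::real. - exp (- \<i> * of_real k * \<zeta>) / (\<i> * \<zeta>)) \<longlongrightarrow> - exp (- \<i> * of_real 0 * \<zeta>) / (\<i> * \<zeta>)) (at_right 0)"
      using nz by (intro tendsto_intros) auto
    then show "(((\<lambda>k. - exp (- \<i> * of_real k * \<zeta>) / (\<i> * \<zeta>)) \<circ> real_of_ereal) \<longlongrightarrow> - (1 / (\<i> * \<zeta>))) (at_right 0)"
      unfolding zero_ereal_def ereal_tendsto_simps by simp
    have "((\<lambda>k::real. exp (- \<i> * of_real k * \<zeta>)) \<longlongrightarrow> 0) at_top"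
      by (rule tendsto_norm_zero_cancel) (use lim0 norm in simp)
    then have "((\<lambda>k::real. - exp (- \<i> * of_real k * \<zeta>) / (\<i> * \<zeta>)) \<longlongrightarrow> - 0 / (\<i> * \<zeta>)) at_top"
      using nz by (intro tendsto_intros) auto
    then show "(((\<lambda>k. - exp (- \<i> * of_real k * \<zeta>) / (\<i> * \<zeta>)) \<circ> real_of_ereal) \<longlongrightarrow> 0) (at_left \<infinity>)"
      unfolding ereal_tendsto_simps by simp
  qed auto
  then show "(LINT k|lborel. indicator {0<..} k *\<^sub>R exp (- \<i> * of_real k * \<zeta>)) = 1 / (\<i> * \<zeta>)"
    by (simp add: interval_lebesgue_integral_def set_lebesgue_integral_def e0)
qed

lemma integrable_divide_away:
  fixes c g :: "real \<Rightarrow> complex"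
  assumes g: "integrable lborel g" and c[measurable]: "c \<in> borel_measurable borel"
    and \<delta>: "\<delta> > 0" "\<And>x. \<delta> \<le> norm (c x)"
  shows "integrable lborel (\<lambda>x. g x / c x)"
proof (rule Bochner_Integration.integrable_bound)
  show "integrable lborel (\<lambda>x. norm (g x) / \<delta>)" using g by simp
  have [measurable]: "g \<in> borel_measurable borel" using g by auto
  show "(\<lambda>x. g x / c x) \<in> borel_measurable lborel" by measurable
  show "AE x in lborel. norm (g x / c x) \<le> norm (norm (g x) / \<delta>)"
    using \<delta> less_le_trans[OF \<delta>] by (intro AE_I2) (auto simp: norm_divide intro!: divide_left_mono mult_pos_pos)
qed

text \<open>The difference quotient of \<open>1 / (c x - z)\<close> between \<open>z\<close> and
  \<open>y\<close> is exactly \<open>1 / ((c x - y) * (c x - z))\<close>. For \<open>y\<close>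
  within \<open>\<delta> / 2\<close> of \<open>z\<close> it is bounded by
  \<open>2 / \<delta>^2\<close>, so the limit may be taken under the integral.\<close>

lemma has_field_derivative_cauchy_type_integral:
  fixes c g :: "real \<Rightarrow> complex"
  assumes g: "integrable lborel g" and c[measurable]: "c \<in> borel_measurable borel"
    and \<delta>: "\<delta> > 0" "\<And>x. \<delta> \<le> norm (c x - z)"
  shows "((\<lambda>z. LINT x|lborel. g x / (c x - z)) has_field_derivative
           (LINT x|lborel. g x / (c x - z)\<^sup>2)) (at z)"
proof -
  have [measurable]: "g \<in> borel_measurable borel" using g by auto
  have near: "\<forall>\<^sub>F y in at z. \<forall>x. \<delta> / 2 \<le> norm (c x - y)"
  proof -
    have "\<forall>\<^sub>F y in at z. dist y z < \<delta> / 2"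
      using \<delta>(1) by (metis eventually_at half_gt_zero)
    then show ?thesis
    proof eventually_elim
      case (elim y)
      have "\<delta> / 2 \<le> norm (c x - y)" for x
        using norm_triangle_ineq[of "c x - y" "y - z"] \<delta>(2)[of x] elim by (simp add: dist_norm)
      then show ?case by blast
    qed
  qed
  have "((\<lambda>y. LINT x|lborel. g x / ((c x - y) * (c x - z))) \<longlongrightarrow> (LINT x|lborel. g x / (c x - z)\<^sup>2)) (at z)"
  proof (rule tendsto_integral_at_within)
    show "integrable lborel (\<lambda>x. norm (g x) / (\<delta> / 2 * \<delta>))" using g by simp
    show "\<forall>\<^sub>F y in at z. \<forall>x. norm (g x / ((c x - y) * (c x - z))) \<le> norm (g x) / (\<delta> / 2 * \<delta>)"
      using near
    proof eventually_elim
      case (elim y)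
      have "\<delta> / 2 * \<delta> \<le> norm (c x - y) * norm (c x - z)" for x
        using elim \<delta> by (intro mult_mono) auto
      moreover have "0 < \<delta> / 2 * \<delta>" using \<delta>(1) by simp
      ultimately show ?case unfolding norm_divide norm_mult
        by (intro allI frac_le norm_ge_zero order_refl)
    qed
    show "((\<lambda>y. g x / ((c x - y) * (c x - z))) \<longlongrightarrow> g x / (c x - z)\<^sup>2) (at z)" for x
    proof -
      have "c x - z \<noteq> 0" using \<delta>(1) \<delta>(2)[of x] by auto
      then show ?thesis by (auto intro!: tendsto_eq_intros simp: power2_eq_square)
    qed
  qed auto
  moreover have "\<forall>\<^sub>F y in at z. (LINT x|lborel. g x / ((c x - y) * (c x - z))) =
     ((LINT x|lborel. g x / (c x - y)) - (LINT x|lborel. g x / (c x - z))) / (y - z)"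
    using near eventually_neq_at_within[of z z UNIV]
  proof eventually_elim
    case (elim y)
    have int: "integrable lborel (\<lambda>x. g x / (c x - y))" "integrable lborel (\<lambda>x. g x / (c x - z))"
      using integrable_divide_away[OF g, of "\<lambda>x. c x - y" "\<delta>/2"] elim(1)
        integrable_divide_away[OF g, of "\<lambda>x. c x - z" \<delta>] \<delta> by auto
    have ne: "c x - y \<noteq> 0" "c x - z \<noteq> 0" for x
      using elim(1)[rule_format, of x] \<delta>(1) \<delta>(2)[of x] by auto
    have "g x / ((c x - y) * (c x - z)) = (g x / (c x - y) - g x / (c x - z)) / (y - z)" for x
      using ne[of x] elim(2) by (simp add: divide_simps) (simp add: algebra_simps)
    then show ?case using int by (simp add: Bochner_Integration.integral_diff)
  qed
  ultimately show ?thesis unfolding has_field_derivative_iff by (rule Lim_transform_eventually)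
qed

section \<open>Regions below a graph\<close>

text \<open>Scaling heights by \<open>H (Re z)\<close> maps a straight strip, which is convex,
  homeomorphically onto the region. The value \<open>l = 0\<close> gives the fluid,
  \<open>l = -1\<close> the fluid doubled by reflection in the bottom.\<close>

lemma simply_connected_between_graphs:
  fixes H :: "real \<Rightarrow> real" and l :: real
  assumes H: "continuous_on UNIV H" and pos: "\<And>x. H x > 0"
  shows "simply_connected {z. l * H (Re z) < Im z \<and> Im z < H (Re z)}"
proof -
  let ?S = "{z. l < Im z \<and> Im z < 1}" and ?T = "{z. l * H (Re z) < Im z \<and> Im z < H (Re z)}"
  have "convex ?S"
    using convex_Int[OF convex_halfspace_Im_gt[of l] convex_halfspace_Im_lt[of 1]]
    by (simp add: Int_def)
  then have "simply_connected ?S" by (rule convex_imp_simply_connected)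
  moreover have "?S homeomorphic ?T"
  proof (rule homeomorphicI)
    let ?f = "\<lambda>z. Complex (Re z) (Im z * H (Re z))" and ?g = "\<lambda>z. Complex (Re z) (Im z / H (Re z))"
    have HR: "continuous_on A (\<lambda>z. H (Re z))" for A
      by (rule continuous_on_compose2[OF H]) (auto intro!: continuous_intros)
    have ne: "H x \<noteq> 0" for x using pos[of x] by simp
    show "continuous_on ?S ?f" "continuous_on ?T ?g" unfolding Complex_eq
      by (intro continuous_intros HR; simp add: ne)+
    have f: "?f z \<in> ?T" if "z \<in> ?S" for z using that pos[of "Re z"] by simp
    have g: "?g z \<in> ?S" if "z \<in> ?T" for z using that pos[of "Re z"] by (simp add: pos_less_divide_eq)
    show gf: "?g (?f z) = z" if "z \<in> ?S" for z using ne by (simp add: complex_eq_iff)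
    show fg: "?f (?g z) = z" if "z \<in> ?T" for z using ne by (simp add: complex_eq_iff)
    show "?f ` ?S = ?T"
    proof
      show "?f ` ?S \<subseteq> ?T" using f by (rule image_subsetI)
      show "?T \<subseteq> ?f ` ?S" 
      proof
        fix z assume z: "z \<in> ?T"
        have "?f (?g z) \<in> ?f ` ?S" by (rule imageI[OF g[OF z]])
        then show "z \<in> ?f ` ?S" unfolding fg[OF z] .
      qed
    qed
    show "?g ` ?T = ?S"
    proof
      show "?g ` ?T \<subseteq> ?S" using g by (rule image_subsetI)
      show "?S \<subseteq> ?g ` ?T" 
      proof
        fix z assume z: "z \<in> ?S"
        have "?g (?f z) \<in> ?g ` ?T" by (rule imageI[OF f[OF z]])
        then show "z \<in> ?g ` ?T" unfolding gf[OF z] .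
      qed
    qed
  qed
  ultimately show ?thesis using homeomorphic_simply_connected by blast
qed

text \<open>The region is a vertical shear of the upper half-plane. Connectedness permits analytic
  continuation from heights above all crests down to the surface.\<close>

lemma connected_above_graph:
  fixes H :: "real \<Rightarrow> real"
  assumes H: "continuous_on UNIV H"
  shows "connected {z. H (Re z) < Im z}"
proof -
  have "connected ((\<lambda>z. Complex (Re z) (Im z + H (Re z))) ` {z. 0 < Im z})"
  proof (rule connected_continuous_image)
    show "continuous_on {z. 0 < Im z} (\<lambda>z. Complex (Re z) (Im z + H (Re z)))" unfolding Complex_eq
      by (intro continuous_intros continuous_on_compose2[OF H]) auto
    show "connected {z. 0 < Im z}" by (simp add: convex_connected convex_halfspace_Im_gt)
  qed
  also have "(\<lambda>z. Complex (Re z) (Im z + H (Re z))) ` {z. 0 < Im z} = {z. H (Re z) < Im z}"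
  proof (rule set_eqI, rule iffI)
    fix z assume "z \<in> {z. H (Re z) < Im z}"
    then show "z \<in> (\<lambda>z. Complex (Re z) (Im z + H (Re z))) ` {z. 0 < Im z}"
      by (intro image_eqI[of _ _ "Complex (Re z) (Im z - H (Re z))"]) auto
  qed auto
  finally show ?thesis .
qed

lemma open_graph_regions:
  fixes H :: "real \<Rightarrow> real" and l :: real
  assumes H: "continuous_on UNIV H"
  shows "open {z. H (Re z) < Im z}" "open {z. l * H (Re z) < Im z \<and> Im z < H (Re z)}"
proof -
  have HR: "continuous_on UNIV (\<lambda>z. H (Re z))"
    by (rule continuous_on_compose2[OF H]) (auto intro!: continuous_intros)
  have Im: "continuous_on UNIV Im" by (intro continuous_intros)
  show "open {z. H (Re z) < Im z}" by (rule open_Collect_less[OF HR Im])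
  show "open {z. l * H (Re z) < Im z \<and> Im z < H (Re z)}"
    by (rule open_Collect_conj[OF open_Collect_less[OF continuous_on_mult_left[OF HR] Im] open_Collect_less[OF Im HR]])
qed

lemma primitive_between_graphs:
  fixes H :: "real \<Rightarrow> real" and l :: real
  assumes H: "continuous_on UNIV H" "\<And>x. H x > 0"
    and f: "f holomorphic_on {z. l * H (Re z) < Im z \<and> Im z < H (Re z)}"
  obtains P where "\<And>z. l * H (Re z) < Im z \<Longrightarrow> Im z < H (Re z) \<Longrightarrow> (P has_field_derivative f z) (at z)"
proof -
  have "\<exists>P. \<forall>z\<in>{z. l * H (Re z) < Im z \<and> Im z < H (Re z)}. (P has_field_derivative f z) (at z)"
    using simply_connected_eq_global_primitive[OF open_graph_regions(2)[OF H(1), of l], THEN iffD1,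
        OF simply_connected_between_graphs[OF H, of l], THEN conjunct2, THEN spec, THEN mp, OF f]
    unfolding Ball_def by simp
  then show thesis using that by blast
qed

section \<open>The Cauchy integral of the surface data\<close>

definition graph :: "(real \<Rightarrow> real) \<Rightarrow> real \<Rightarrow> complex" where
  "graph H x = Complex x (H x)"

text \<open>The Cauchy integral over the boundary of the doubled fluid, traversed counterclockwise:
  the mirror curve from left to right, the surface from right to left, hence the minus sign. The
  factor dz is already contained in \<open>G\<close>, which stands for the field times the tangent
  \<open>Complex 1 (a x)\<close>.\<close>

definition cauchy :: "(real \<Rightarrow> real) \<Rightarrow> (real \<Rightarrow> complex) \<Rightarrow> complex \<Rightarrow> complex" where
  "cauchy H G z = 1 / (2 * of_real pi * \<i>) *
     ((LINT x|lborel. cnj (G x) / (cnj (graph H x) - z)) - (LINT x|lborel. G x / (graph H x - z)))"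

text \<open>Twice the integrand of the nonlocal equation, with the hyperbolic functions split into
  exponentials: one term lives on the surface, the other on its mirror image.\<close>

abbreviation modes :: "(real \<Rightarrow> real) \<Rightarrow> (real \<Rightarrow> complex) \<Rightarrow> real \<Rightarrow> real \<Rightarrow> complex" where
  "modes H G k x \<equiv> exp (- \<i> * of_real k * graph H x) * G x - exp (- \<i> * of_real k * cnj (graph H x)) * cnj (G x)"

text \<open>The two poles lie at equal vertical distance below and above the surface point. Compared
  with a single Cauchy kernel, the difference gains a factor \<open>d\<close> and one more order of
  decay.\<close>

definition kernel :: "(real \<Rightarrow> real) \<Rightarrow> real \<Rightarrow> real \<Rightarrow> complex \<Rightarrow> complex" where
  "kernel H x d w = 1 / (w - Complex x (H x - d)) - 1 / (w - Complex x (H x + d))"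

text \<open>The surface integral after the substitution \<open>x + d * s\<close>, which measures
  lengths in units of the distance \<open>d\<close>. Only the deviation of the boundary field from
  its value at \<open>x\<close> remains as density, so the term can be controlled down to
  \<open>d = 0\<close>.\<close>

definition top_term :: "(real \<Rightarrow> real) \<Rightarrow> (real \<Rightarrow> real) \<Rightarrow> (real \<Rightarrow> complex) \<Rightarrow> real \<Rightarrow> real \<Rightarrow> real \<Rightarrow> complex" where
  "top_term H a G x d s = (G (x + d * s) / Complex 1 (a (x + d * s)) - G x / Complex 1 (a x)) *
     Complex 1 (a (x + d * s)) * (of_real d * kernel H x d (graph H (x + d * s)))"

text \<open>Here the variable is only translated, not rescaled: the mirror curve stays away from
  both poles, so nothing becomes singular as \<open>d\<close> tends to 0.\<close>

definition bottom_term :: "(real \<Rightarrow> real) \<Rightarrow> (real \<Rightarrow> complex) \<Rightarrow> real \<Rightarrow> real \<Rightarrow> real \<Rightarrow> complex" where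
  "bottom_term H G x d s = cnj (G (x + s)) * kernel H x d (cnj (graph H (x + s)))"

text \<open>A formula in terms of the depth \<open>d\<close> below the surface that makes sense for
  \<open>d = 0\<close> too, where both integrals vanish and the prescribed boundary value is left.
  For \<open>d > 0\<close> it equals the Cauchy integral provided that integral vanishes at the
  mirror point.\<close>

definition surface_field :: "(real \<Rightarrow> real) \<Rightarrow> (real \<Rightarrow> real) \<Rightarrow> (real \<Rightarrow> complex) \<Rightarrow> real \<Rightarrow> real \<Rightarrow> complex" where
  "surface_field H a G x d = G x / Complex 1 (a x) + 1 / (2 * of_real pi * \<i>) *
     ((LINT s|lborel. bottom_term H G x d s) - (LINT s|lborel. top_term H a G x d s))"

lemma kernel_zero [simp]: "kernel H x 0 w = 0"
  by (simp add: kernel_def)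

lemma norm_kernel:
  assumes "w \<noteq> Complex x (H x - d)" "w \<noteq> Complex x (H x + d)"
  shows "norm (kernel H x d w) =
    2 * \<bar>d\<bar> / (norm (w - Complex x (H x - d)) * norm (w - Complex x (H x + d)))"
proof -
  have "kernel H x d w = (Complex x (H x - d) - Complex x (H x + d)) /
      ((w - Complex x (H x - d)) * (w - Complex x (H x + d)))"
    using assms by (simp add: kernel_def divide_simps)
  moreover have "Complex x (H x - d) - Complex x (H x + d) = \<i> * of_real (- 2 * d)"
    by (simp add: complex_eq_iff)
  ultimately show ?thesis by (simp add: norm_divide norm_mult)
qed

lemma norm_Complex_1_ge: "1 \<le> norm (Complex 1 r)"
  by (metis complex.sel(1) abs_Re_le_cmod abs_one)

lemma Complex_1_nonzero [simp]: "Complex 1 r \<noteq> 0"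
  by (simp add: complex_eq_iff)

lemma norm_Complex_le: "norm (Complex r s) \<le> \<bar>r\<bar> + \<bar>s\<bar>"
  using cmod_le[of "Complex r s"] by simp

text \<open>The fluid at one instant. The bounds are parameters rather than existential statements,
  so that a family of channels can share them and hence share dominating functions.\<close>

locale channel =
  fixes H a :: "real \<Rightarrow> real" and G :: "real \<Rightarrow> complex" and m S L B :: real
  assumes H_deriv: "\<And>x. (H has_real_derivative a x) (at x)"
    and a_cont: "continuous_on UNIV a"
    and G_cont: "continuous_on UNIV G"
    and G_int: "integrable lborel G"
    and m_pos: "0 < m" and H_ge: "\<And>x. m \<le> H x" and H_le: "\<And>x. H x \<le> S"
    and a_bd: "\<And>x. \<bar>a x\<bar> \<le> L" and G_bd: "\<And>x. norm (G x) \<le> B"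
begin

lemma H_cont: "continuous_on UNIV H"
  using H_deriv by (meson DERIV_continuous_on has_field_derivative_at_within)

lemma H_pos: "0 < H x" using m_pos H_ge[of x] by linarith

lemma L_nonneg: "0 \<le> L" using a_bd[of 0] by linarith
lemma B_nonneg: "0 \<le> B" using G_bd[of 0] norm_ge_zero order_trans by blast
lemma S_pos: "0 < S" using H_pos H_le less_le_trans by blast

lemma graph_cont: "continuous_on A (graph H)"
  unfolding graph_def[abs_def] Complex_eq
  by (intro continuous_intros continuous_on_subset[OF H_cont]) auto

lemma measurables [measurable]:
  "H \<in> borel_measurable borel" "a \<in> borel_measurable borel" "G \<in> borel_measurable borel"
  "graph H \<in> borel_measurable borel"
  using H_cont a_cont G_cont graph_cont by (auto intro: borel_measurable_continuous_onI)

lemma measurable_tangent [measurable]: "(\<lambda>x. Complex 1 (a x)) \<in> borel_measurable borel"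
  unfolding Complex_eq by measurable

lemma measurable_cnj [measurable]: "f \<in> borel_measurable M \<Longrightarrow> (\<lambda>x. cnj (f x)) \<in> borel_measurable M"
  by (rule borel_measurable_continuous_on[OF continuous_on_cnj]) (auto intro: continuous_on_id)

lemma H_lipschitz: "\<bar>H x - H y\<bar> \<le> L * \<bar>x - y\<bar>"
  using field_differentiable_bound[of UNIV H a L x y] H_deriv a_bd by (auto intro: has_field_derivative_at_within)

text \<open>With \<open>X\<close> and \<open>Y\<close> the horizontal and vertical distances, the
  slope bound gives \<open>\<bar>d\<bar> \<le> Y + L * X\<close>, so \<open>d^2\<close> is at most
  \<open>1 + L^2\<close> times \<open>X^2 + Y^2\<close> by Cauchy-Schwarz. The remaining unit in
  \<open>2 + L^2\<close> absorbs \<open>X^2\<close>. The sign of \<open>d\<close> is free, which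
  covers both mirrored points.\<close>

lemma graph_distance:
  "(x - x0)\<^sup>2 + d\<^sup>2 \<le> (2 + L\<^sup>2) * (norm (graph H x - Complex x0 (H x0 + d)))\<^sup>2"
proof -
  define X Y where "X = \<bar>x - x0\<bar>" and "Y = \<bar>H x - (H x0 + d)\<bar>"
  have "\<bar>d\<bar> \<le> Y + L * X" using H_lipschitz[of x x0] by (simp add: X_def Y_def)
  then have "d\<^sup>2 \<le> (Y + L * X)\<^sup>2" by (metis abs_ge_zero power2_abs power_mono)
  also have "\<dots> \<le> (1 + L\<^sup>2) * (X\<^sup>2 + Y\<^sup>2)"
  proof -
    have "0 \<le> (X - L * Y)\<^sup>2" by simp
    then show ?thesis by (simp add: power2_eq_square algebra_simps)
  qed
  finally have "X\<^sup>2 + d\<^sup>2 \<le> (2 + L\<^sup>2) * (X\<^sup>2 + Y\<^sup>2)"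
    by (simp add: algebra_simps) (smt (verit) zero_le_power2)
  moreover have "(norm (graph H x - Complex x0 (H x0 + d)))\<^sup>2 = X\<^sup>2 + Y\<^sup>2"
    by (simp add: cmod_power2 graph_def X_def Y_def)
  ultimately show ?thesis by (simp add: X_def)
qed

lemma graph_distance_pos:
  assumes "d \<noteq> 0"
  shows "graph H x \<noteq> Complex x0 (H x0 + d)"
proof
  assume "graph H x = Complex x0 (H x0 + d)"
  then have "(x - x0)\<^sup>2 + d\<^sup>2 \<le> 0" using graph_distance[of x x0 d] by simp
  moreover have "0 < d\<^sup>2" using assms by simp
  ultimately show False by (smt (verit) zero_le_power2)
qed

lemma norm_kernel_graph_le:
  assumes d: "d > 0"
  shows "norm (kernel H x0 d (graph H x)) \<le> 2 * d * (2 + L\<^sup>2) / ((x - x0)\<^sup>2 + d\<^sup>2)"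
proof -
  let ?A = "norm (graph H x - Complex x0 (H x0 - d))" and ?A' = "norm (graph H x - Complex x0 (H x0 + d))"
  let ?q = "((x - x0)\<^sup>2 + d\<^sup>2) / (2 + L\<^sup>2)"
  have L: "0 < 2 + L\<^sup>2" by (smt (verit) zero_le_power2)
  have d2: "0 < (x - x0)\<^sup>2 + d\<^sup>2" using d by (smt (verit) zero_less_power zero_le_power2)
  have "?q \<le> ?A\<^sup>2" "?q \<le> ?A'\<^sup>2"
    using graph_distance[of x x0 d] graph_distance[of x x0 "- d"] L by (simp_all add: field_simps)
  then have "sqrt ?q \<le> ?A" "sqrt ?q \<le> ?A'" by (auto intro: real_le_lsqrt)
  then have "sqrt ?q * sqrt ?q \<le> ?A * ?A'" using d2 L by (intro mult_mono) auto
  then have "?q \<le> ?A * ?A'" using d2 L by simp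
  moreover have "0 < ?q" using d2 L by simp
  moreover have "norm (kernel H x0 d (graph H x)) = 2 * d / (?A * ?A')"
    using graph_distance_pos[of d x x0] graph_distance_pos[of "- d" x x0] d by (subst norm_kernel) auto
  moreover have "2 * d / (?A * ?A') \<le> 2 * d / ?q"
    using d by (intro frac_le calculation) simp_all
  ultimately have "norm (kernel H x0 d (graph H x)) \<le> 2 * d / ?q" by simp
  then show ?thesis by simp
qed

lemma norm_field_top_le: "norm (G x / Complex 1 (a x)) \<le> B"
  using frac_le[OF B_nonneg G_bd zero_less_one norm_Complex_1_ge] by (simp add: norm_divide)

lemma norm_tangent_le: "norm (Complex 1 (a x)) \<le> 1 + L"
  using norm_Complex_le[of 1 "a x"] a_bd[of x] by simp

text \<open>Both the kernel bound and the substituted variable scale with \<open>d\<close>, and all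
  powers of \<open>d\<close> cancel. The resulting bound is uniform down to \<open>d = 0\<close>,
  where the kernel vanishes identically.\<close>

lemma norm_scaled_kernel_le:
  assumes d: "d \<ge> 0"
  shows "norm (of_real d * kernel H x d (graph H (x + d * s))) \<le> 2 * (2 + L\<^sup>2) / (s\<^sup>2 + 1\<^sup>2)"
proof (cases "d = 0")
  case False
  with d have d: "d > 0" by simp
  have p: "0 < s\<^sup>2 + 1" by (smt (verit) zero_le_power2)
  have "norm (of_real d * kernel H x d (graph H (x + d * s))) \<le> d * (2 * d * (2 + L\<^sup>2) / ((d * s)\<^sup>2 + d\<^sup>2))"
    using mult_left_mono[OF norm_kernel_graph_le[OF d, of x "x + d * s"], of d] d unfolding norm_mult by simp
  also have "(d * s)\<^sup>2 + d\<^sup>2 = d\<^sup>2 * (s\<^sup>2 + 1)" by (simp add: algebra_simps power2_eq_square)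
  also have "d * (2 * d * (2 + L\<^sup>2) / (d\<^sup>2 * (s\<^sup>2 + 1))) = 2 * (2 + L\<^sup>2) / (s\<^sup>2 + 1\<^sup>2)"
    using d p by (simp add: power2_eq_square)
  finally show ?thesis .
qed simp

lemma norm_top_term_le:
  assumes d: "d \<ge> 0"
  shows "norm (top_term H a G x d s) \<le> 2 * B * (1 + L) * (2 * (2 + L\<^sup>2)) * (1 / (s\<^sup>2 + 1\<^sup>2))"
proof -
  have "norm (G (x + d * s) / Complex 1 (a (x + d * s)) - G x / Complex 1 (a x)) \<le> 2 * B"
    using norm_triangle_ineq4 norm_field_top_le[of "x + d * s"] norm_field_top_le[of x]
    by (smt (verit))
  then have "norm (top_term H a G x d s) \<le> 2 * B * (1 + L) * (2 * (2 + L\<^sup>2) / (s\<^sup>2 + 1\<^sup>2))"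
    unfolding top_term_def norm_mult[of _ "of_real d * _"] norm_mult[of _ "Complex _ _"]
    using norm_tangent_le norm_scaled_kernel_le[OF d] B_nonneg L_nonneg
    by (intro mult_mono) auto
  then show ?thesis by simp
qed

lemma cnj_graph_distance:
  assumes "0 \<le> y"
  shows "(x - x0)\<^sup>2 + m\<^sup>2 \<le> (norm (cnj (graph H x) - Complex x0 y))\<^sup>2"
proof -
  have "m\<^sup>2 \<le> (H x + y)\<^sup>2" using assms H_ge[of x] m_pos by (intro power_mono) auto
  moreover have "(norm (cnj (graph H x) - Complex x0 y))\<^sup>2 = (x - x0)\<^sup>2 + (H x + y)\<^sup>2"
    by (simp add: cmod_power2 graph_def) (simp add: power2_eq_square algebra_simps)
  ultimately show ?thesis by simp
qed

text \<open>The factor \<open>norm (G (x + s))\<close> is kept because the decay of the field at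
  infinity comes from it; the primed variant replaces it by \<open>B\<close> to obtain a dominating
  function independent of \<open>x\<close>.\<close>

lemma norm_bottom_term_le:
  assumes d: "0 \<le> d" "d \<le> H x"
  shows "norm (bottom_term H G x d s) \<le> norm (G (x + s)) * (2 * S * (1 / (s\<^sup>2 + m\<^sup>2)))"
proof -
  let ?w = "cnj (graph H (x + s))"
  let ?A = "norm (?w - Complex x (H x - d))" and ?A' = "norm (?w - Complex x (H x + d))"
  have q: "0 < s\<^sup>2 + m\<^sup>2" using m_pos by (smt (verit) zero_less_power zero_le_power2)
  have A: "s\<^sup>2 + m\<^sup>2 \<le> ?A\<^sup>2" "s\<^sup>2 + m\<^sup>2 \<le> ?A'\<^sup>2"
    using cnj_graph_distance[of "H x - d" "x + s" x] cnj_graph_distance[of "H x + d" "x + s" x] d H_pos[of x] by auto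
  then have "sqrt (s\<^sup>2 + m\<^sup>2) \<le> ?A" "sqrt (s\<^sup>2 + m\<^sup>2) \<le> ?A'" by (auto intro: real_le_lsqrt)
  then have "sqrt (s\<^sup>2 + m\<^sup>2) * sqrt (s\<^sup>2 + m\<^sup>2) \<le> ?A * ?A'" using q by (intro mult_mono) auto
  then have AA: "s\<^sup>2 + m\<^sup>2 \<le> ?A * ?A'" using q by simp
  have "norm (kernel H x d ?w) = 2 * d / (?A * ?A')"
    using A q d by (subst norm_kernel) auto
  also have "\<dots> \<le> 2 * S / (s\<^sup>2 + m\<^sup>2)"
    using AA q d H_le[of x] by (intro frac_le) auto
  finally show ?thesis
    unfolding bottom_term_def norm_mult complex_mod_cnj by (intro mult_left_mono) auto
qed

lemma norm_bottom_term_le':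
  assumes "0 \<le> d" "d \<le> H x"
  shows "norm (bottom_term H G x d s) \<le> B * (2 * S) * (1 / (s\<^sup>2 + m\<^sup>2))"
proof -
  have "norm (G (x + s)) * (2 * S * (1 / (s\<^sup>2 + m\<^sup>2))) \<le> B * (2 * S * (1 / (s\<^sup>2 + m\<^sup>2)))"
    using S_pos by (intro mult_right_mono G_bd) auto
  with norm_bottom_term_le[OF assms, of s] show ?thesis by simp
qed

lemma measurable_terms [measurable]:
  "top_term H a G x d \<in> borel_measurable borel" "bottom_term H G x d \<in> borel_measurable borel"
  unfolding top_term_def[abs_def] bottom_term_def[abs_def] kernel_def
  by measurable

lemma integrable_poisson: "0 < c \<Longrightarrow> integrable lborel (\<lambda>s. C * (1 / (s\<^sup>2 + (c::real)\<^sup>2)))"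
  by (intro integrable_mult_right integrable_inverse_square_plus)

text \<open>The surface and its mirror image together form the closed set
  \<open>\<bar>Im z\<bar> = H (Re z)\<close>, and a point outside a closed set has positive distance
  from it.\<close>

lemma separated_from_graphs:
  assumes "\<bar>Im z\<bar> \<noteq> H (Re z)"
  obtains \<delta> where "\<delta> > 0" "\<And>x. \<delta> \<le> norm (graph H x - z)" "\<And>x. \<delta> \<le> norm (cnj (graph H x) - z)"
proof -
  have HR: "continuous_on UNIV (\<lambda>z. H (Re z))"
    by (rule continuous_on_compose2[OF H_cont]) (auto intro!: continuous_intros)
  have cl: "closed {z. \<bar>Im z\<bar> = H (Re z)}" by (intro closed_Collect_eq HR continuous_intros)
  obtain \<delta> where \<delta>: "\<delta> > 0" "\<And>w. w \<in> {z. \<bar>Im z\<bar> = H (Re z)} \<Longrightarrow> \<delta> \<le> dist z w"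
    using separate_point_closed[OF cl, of z] assms by auto
  show thesis
  proof (rule that[OF \<delta>(1)])
    show "\<delta> \<le> norm (graph H x - z)" "\<delta> \<le> norm (cnj (graph H x) - z)" for x
      using \<delta>(2)[of "graph H x"] \<delta>(2)[of "cnj (graph H x)"] H_pos[of x]
      by (simp_all add: graph_def dist_norm norm_minus_commute)
  qed
qed

lemma cnj_G_int: "integrable lborel (\<lambda>x. cnj (G x))"
  using G_int by simp

lemma cauchy_field_differentiable:
  assumes "\<bar>Im z\<bar> \<noteq> H (Re z)"
  shows "cauchy H G field_differentiable at z"
proof -
  obtain \<delta> where \<delta>: "\<delta> > 0" "\<And>x. \<delta> \<le> norm (graph H x - z)" "\<And>x. \<delta> \<le> norm (cnj (graph H x) - z)"
    using separated_from_graphs[OF assms] by blast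
  have "((\<lambda>z. LINT x|lborel. cnj (G x) / (cnj (graph H x) - z)) has_field_derivative
       (LINT x|lborel. cnj (G x) / (cnj (graph H x) - z)\<^sup>2)) (at z)"
    using \<delta> by (intro has_field_derivative_cauchy_type_integral[OF cnj_G_int]) auto
  note d1 = this
  have d2: "((\<lambda>z. LINT x|lborel. G x / (graph H x - z)) has_field_derivative
       (LINT x|lborel. G x / (graph H x - z)\<^sup>2)) (at z)"
    using \<delta> by (intro has_field_derivative_cauchy_type_integral[OF G_int]) auto
  show ?thesis
    unfolding field_differentiable_def cauchy_def[abs_def]
    using DERIV_cmult[OF DERIV_diff[OF d1 d2]] by blast
qed

text \<open>On the real axis the two integrals are conjugate to each other, so their difference is
  purely imaginary, and division by \<open>2 * pi * \<i>\<close> makes it real. This becomes the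
  impermeability of the bottom.\<close>

lemma cauchy_real_on_axis: "Im z = 0 \<Longrightarrow> Im (cauchy H G z) = 0"
proof -
  assume "Im z = 0"
  then have z: "cnj z = z" by (simp add: complex_eq_iff)
  let ?I = "LINT x|lborel. G x / (graph H x - z)"
  have "(LINT x|lborel. cnj (G x) / (cnj (graph H x) - z)) = (LINT x|lborel. cnj (G x / (graph H x - z)))"
    using z by simp
  also have "\<dots> = cnj ?I" by (rule Bochner_Integration.integral_cnj)
  finally have "cauchy H G z = 1 / (2 * of_real pi * \<i>) * (cnj ?I - ?I)" by (simp add: cauchy_def)
  also have "cnj ?I - ?I = - (2 * \<i>) * of_real (Im ?I)" by (simp add: complex_eq_iff)
  also have "1 / (2 * of_real pi * \<i>) * (- (2 * \<i>) * of_real (Im ?I)) = of_real (- Im ?I / pi)"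
    by (simp add: divide_simps)
  finally show ?thesis by (metis Im_complex_of_real)
qed

text \<open>
  The integrand is the logarithmic derivative of the quotient of the differences from the graph to
  two points mirrored in it; that quotient avoids the nonnegative reals and tends to 1 at both ends,
  so its argument changes by a full turn.
\<close>

lemma integral_tangent_kernel:
  assumes d: "d > 0"
  shows "integrable lborel (\<lambda>x. Complex 1 (a x) * kernel H x0 d (graph H x))"
    and "(LINT x|lborel. Complex 1 (a x) * kernel H x0 d (graph H x)) = - 2 * of_real pi * \<i>"
proof -
  define z z' where "z = Complex x0 (H x0 - d)" and "z' = Complex x0 (H x0 + d)"
  let ?f = "\<lambda>x. Complex 1 (a x) * kernel H x0 d (graph H x)"
  have [measurable]: "?f \<in> borel_measurable borel" unfolding kernel_def by measurable
  have ne: "graph H x \<noteq> z" "graph H x \<noteq> z'" for x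
    using graph_distance_pos[of d x x0] graph_distance_pos[of "- d" x x0] d by (auto simp: z_def z'_def)
  have "integrable lborel (\<lambda>x. (1 + L) * (2 * d * (2 + L\<^sup>2)) * (1 / ((- x0 + 1 * x)\<^sup>2 + d\<^sup>2)))"
    by (rule integrable_mult_right[OF lborel_integrable_real_affine[OF integrable_inverse_square_plus[OF d]]]) simp
  then show int: "integrable lborel ?f"
  proof (rule Bochner_Integration.integrable_bound)
    have "norm (?f x) \<le> (1 + L) * (2 * d * (2 + L\<^sup>2) / ((x - x0)\<^sup>2 + d\<^sup>2))" for x
      unfolding norm_mult using norm_tangent_le norm_kernel_graph_le[OF d] L_nonneg
      by (intro mult_mono) auto
    moreover have "(1 + L) * (2 * d * (2 + L\<^sup>2) / ((x - x0)\<^sup>2 + d\<^sup>2)) =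
        (1 + L) * (2 * d * (2 + L\<^sup>2)) * (1 / ((- x0 + 1 * x)\<^sup>2 + d\<^sup>2))" for x
      by simp
    ultimately have "norm (?f x) \<le> norm ((1 + L) * (2 * d * (2 + L\<^sup>2)) * (1 / ((- x0 + 1 * x)\<^sup>2 + d\<^sup>2)))" for x
      by (metis abs_ge_self order_trans real_norm_def)
    then show "AE x in lborel. norm (?f x) \<le> norm ((1 + L) * (2 * d * (2 + L\<^sup>2)) * (1 / ((- x0 + 1 * x)\<^sup>2 + d\<^sup>2)))"
      by simp
  qed simp
  define q where "q x = (graph H x - z) / (graph H x - z')" for x
  have q0: "q x \<noteq> 0" for x using ne by (simp add: q_def)
  have gd: "(graph H has_vector_derivative Complex 1 (a x)) (at x)" for x
  proof -
    have "((\<lambda>x. of_real x + \<i> * of_real (H x)) has_vector_derivative (1 + \<i> * of_real (a x))) (at x)"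
      using H_deriv[of x] by (auto intro!: derivative_eq_intros simp: has_real_derivative_iff_has_vector_derivative)
    then show ?thesis by (simp add: graph_def[abs_def] Complex_eq)
  qed
  have Imq: "Im (q x) = 2 * (x - x0) * d / (norm (graph H x - z'))\<^sup>2" for x
  proof -
    have "Im (q x) = Im ((graph H x - z) * cnj (graph H x - z')) / (norm (graph H x - z'))\<^sup>2"
      unfolding q_def complex_div_cnj[of _ "graph H x - z'"]
      by (metis Im_divide_of_real of_real_power)
    also have "Im ((graph H x - z) * cnj (graph H x - z')) = 2 * (x - x0) * d"
      by (simp add: graph_def z_def z'_def algebra_simps)
    finally show ?thesis .
  qed
  have normpos: "0 < (norm (graph H x - z'))\<^sup>2" for x using ne[of x] by simp
  have "q x0 = - 1"
  proof -
    have "graph H x0 - z = \<i> * of_real d" "graph H x0 - z' = - (\<i> * of_real d)"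
      by (simp_all add: graph_def z_def z'_def complex_eq_iff)
    then show ?thesis using d by (simp add: q_def)
  qed
  \<comment> \<open>The imaginary part of \<open>q\<close> vanishes only at \<open>x0\<close>, and
    there \<open>q\<close> is -1. So \<open>- q\<close> never meets the branch cut of
    \<open>Ln\<close>, which is why the logarithm is taken of \<open>- q\<close> and not of
    \<open>q\<close>.\<close>
  then have slit: "- q x \<notin> \<real>\<^sub>\<le>\<^sub>0" for x
    using Imq[of x] normpos[of x] d by (cases "x = x0") (auto simp: complex_nonpos_Reals_iff)
  have qd: "(q has_vector_derivative ?f x * q x) (at x)" for x
  proof -
    have "((\<lambda>w. (w - z) / (w - z')) has_field_derivative
        (1 * (graph H x - z') - (graph H x - z) * 1) / ((graph H x - z') * (graph H x - z'))) (at (graph H x))"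
      using ne[of x] by (intro DERIV_divide) (auto intro!: derivative_eq_intros)
    from field_vector_diff_chain_at[OF gd this] have "(q has_vector_derivative
        (Complex 1 (a x) * (graph H x - z') - (graph H x - z) * Complex 1 (a x)) / (graph H x - z')\<^sup>2) (at x)"
      by (simp add: q_def[abs_def] o_def power2_eq_square algebra_simps)
    moreover have "(Complex 1 (a x) * (graph H x - z') - (graph H x - z) * Complex 1 (a x)) / (graph H x - z')\<^sup>2 = ?f x * q x"
      using ne[of x] by (simp add: q_def kernel_def flip: z_def z'_def) (simp add: divide_simps power2_eq_square, simp add: algebra_simps)
    ultimately show ?thesis by simp
  qed
  have Fd: "((\<lambda>x. Ln (- q x)) has_vector_derivative ?f x) (at x)" for x
  proof -
    have "((\<lambda>x. - q x) has_vector_derivative - (?f x * q x)) (at x)"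
      using qd by (rule has_vector_derivative_minus)
    then have "((Ln \<circ> (\<lambda>x. - q x)) has_vector_derivative - (?f x * q x) * inverse (- q x)) (at x)"
      by (rule field_vector_diff_chain_at) (rule has_field_derivative_Ln[OF slit])
    moreover have "- (?f x * q x) * inverse (- q x) = ?f x" using q0[of x] by simp
    ultimately show ?thesis unfolding o_def by (simp only:)
  qed
  have q1: "(q \<longlongrightarrow> 1) F" if "filterlim (\<lambda>x. \<bar>x - x0\<bar>) at_top F" for F
  proof -
    have "\<forall>\<^sub>F x in F. 1 \<le> \<bar>x - x0\<bar>" using that by (simp add: filterlim_at_top)
    then have "\<forall>\<^sub>F x in F. norm (q x - 1) \<le> 2 * d / \<bar>x - x0\<bar>"
    proof eventually_elim
      case (elim x)
      have "q x - 1 = (z' - z) / (graph H x - z')" using ne[of x] by (simp add: q_def divide_simps)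
      moreover have "z' - z = \<i> * of_real (2 * d)" by (simp add: z_def z'_def complex_eq_iff)
      moreover have "\<bar>x - x0\<bar> \<le> norm (graph H x - z')"
        using abs_Re_le_cmod[of "graph H x - z'"] by (simp add: graph_def z'_def)
      ultimately show ?case using d elim by (auto simp: norm_divide norm_mult intro!: frac_le)
    qed
    moreover have "((\<lambda>x. 2 * d / \<bar>x - x0\<bar>) \<longlongrightarrow> 0) F"
      using that by (intro tendsto_divide_0[OF tendsto_const] filterlim_at_top_imp_at_infinity)
    ultimately have "((\<lambda>x. q x - 1) \<longlongrightarrow> 0) F" by (rule Lim_null_comparison)
    then show ?thesis by (simp add: LIM_zero_iff)
  qed
  have Lnq: "((\<lambda>x. Ln (q x)) \<longlongrightarrow> 0) F" if "filterlim (\<lambda>x. \<bar>x - x0\<bar>) at_top F" for F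
    using tendsto_Ln[OF q1[OF that]] by simp
  have "(LBINT x=-\<infinity>..\<infinity>. ?f x) = (0 - \<i> * of_real pi) - (0 + \<i> * of_real pi)"
  proof (rule interval_integral_FTC_integrable[where F = "\<lambda>x. Ln (- q x)"])
    show "((\<lambda>x. Ln (- q x)) has_vector_derivative ?f x) (at x)" for x using Fd .
    show "isCont ?f x" for x
    proof -
      have "isCont (graph H) x" "isCont a x"
        using graph_cont[of UNIV] a_cont by (auto simp: continuous_on_eq_continuous_at)
      then show ?thesis using ne[of x] unfolding kernel_def z_def z'_def Complex_eq
        by (intro continuous_intros) auto
    qed
    show "set_integrable lborel (einterval (-\<infinity>) \<infinity>) ?f"
      using int by (simp add: set_integrable_def einterval_def)
    have "filterlim (\<lambda>x. \<bar>x - x0\<bar>) at_top at_top" "filterlim (\<lambda>x. \<bar>x - x0\<bar>) at_top at_bot"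
      by real_asymp+
    note lims = Lnq[OF this(1)] Lnq[OF this(2)]
    \<comment> \<open>At both ends \<open>q\<close> tends to 1, but from opposite sides of the real
      axis. To the right of \<open>x0\<close> it lies in the upper half-plane, so
      \<open>Ln (- q)\<close> is \<open>Ln q\<close> minus i pi; to the left the sign is reversed.
      The jump between the limits is the full turn.\<close>
    have "((\<lambda>x. Ln (- q x)) \<longlongrightarrow> 0 - \<i> * of_real pi) at_top"
    proof (rule Lim_transform_eventually[OF tendsto_diff[OF lims(1) tendsto_const]])
      show "\<forall>\<^sub>F x in at_top. Ln (q x) - \<i> * of_real pi = Ln (- q x)"
        using eventually_gt_at_top[of x0]
      proof eventually_elim
        case (elim x)
        have "0 < Im (q x)" unfolding Imq using elim d normpos[of x] by simp
        then show ?case using Ln_minus[OF q0[of x]] by simp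
      qed
    qed
    then show "(((\<lambda>x. Ln (- q x)) \<circ> real_of_ereal) \<longlongrightarrow> 0 - \<i> * of_real pi) (at_left \<infinity>)"
      unfolding ereal_tendsto_simps .
    have "((\<lambda>x. Ln (- q x)) \<longlongrightarrow> 0 + \<i> * of_real pi) at_bot"
    proof (rule Lim_transform_eventually[OF tendsto_add[OF lims(2) tendsto_const]])
      show "\<forall>\<^sub>F x in at_bot. Ln (q x) + \<i> * of_real pi = Ln (- q x)"
        using eventually_gt_at_bot[of x0]
      proof eventually_elim
        case (elim x)
        have "2 * (x - x0) * d < 0" by (rule mult_neg_pos) (use elim d in auto)
        then have "Im (q x) < 0" unfolding Imq using normpos[of x] by (rule divide_neg_pos)
        then show ?case using Ln_minus[OF q0[of x]] by simp
      qed
    qed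
    then show "(((\<lambda>x. Ln (- q x)) \<circ> real_of_ereal) \<longlongrightarrow> 0 + \<i> * of_real pi) (at_right (-\<infinity>))"
      unfolding ereal_tendsto_simps .
  qed simp
  then show "integral\<^sup>L lborel ?f = - 2 * of_real pi * \<i>"
    by (simp add: interval_lebesgue_integral_def set_lebesgue_integral_def einterval_def)
qed

end

section \<open>Vanishing above the surface and the boundary representation below it\<close>

context channel
begin

lemma integrable_over_distance:
  assumes "\<bar>Im z\<bar> \<noteq> H (Re z)"
  shows "integrable lborel (\<lambda>x. G x / (graph H x - z))"
    "integrable lborel (\<lambda>x. cnj (G x) / (cnj (graph H x) - z))"
proof -
  obtain \<delta> where \<delta>: "\<delta> > 0" "\<And>x. \<delta> \<le> norm (graph H x - z)" "\<And>x. \<delta> \<le> norm (cnj (graph H x) - z)"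
    using separated_from_graphs[OF assms] by blast
  show "integrable lborel (\<lambda>x. G x / (graph H x - z))"
    by (rule integrable_divide_away[OF G_int _ \<delta>(1,2)]) measurable
  show "integrable lborel (\<lambda>x. cnj (G x) / (cnj (graph H x) - z))"
    by (rule integrable_divide_away[OF cnj_G_int _ \<delta>(1,3)]) measurable
qed

text \<open>
  Above the surface the Cauchy kernel is the Laplace transform in k of the exponentials that appear
  in the nonlocal equation.
\<close>

lemma cauchy_vanishes_far_above:
  assumes nonlocal: "\<And>k. k > 0 \<Longrightarrow> (LINT x|lborel. modes H G k x) = 0"
    and z: "S < Im z"
  shows "cauchy H G z = 0"
proof -
  \<comment> \<open>The gap above the highest possible crest. It makes every exponential at most
    \<open>exp (- (r * k))\<close> uniformly in \<open>x\<close>; a point merely above the surface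
    could lie below a crest elsewhere, where the exponential would grow in \<open>k\<close>.\<close>
  define r where "r = Im z - S"
  have r: "r > 0" using z by (simp add: r_def)
  define \<Phi> where "\<Phi> k x = indicator {0<..} k *\<^sub>R exp (- \<i> * of_real k * (graph H x - z)) * G x
      - indicator {0<..} k *\<^sub>R exp (- \<i> * of_real k * (cnj (graph H x) - z)) * cnj (G x)" for k x
  have Im_neg: "Im (graph H x - z) \<le> - r" "Im (cnj (graph H x) - z) \<le> - r" for x
    using H_le[of x] H_pos[of x] S_pos by (auto simp: graph_def r_def)
  have bound: "norm (\<Phi> k x) \<le> indicator {0<..} k *\<^sub>R exp (- (r * k)) * (2 * norm (G x))" for k x
  proof (cases "k > 0")
    case True
    have "k * Im (graph H x - z) \<le> k * - r" "k * Im (cnj (graph H x) - z) \<le> k * - r"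
      using Im_neg[of x] True by (intro mult_left_mono; simp)+
    then have "norm (exp (- \<i> * of_real k * (graph H x - z))) \<le> exp (- (r * k))"
      "norm (exp (- \<i> * of_real k * (cnj (graph H x) - z))) \<le> exp (- (r * k))"
      by (simp_all add: norm_exp_eq_Re mult.commute)
    then have "norm (\<Phi> k x) \<le> exp (- (r * k)) * norm (G x) + exp (- (r * k)) * norm (cnj (G x))"
      unfolding \<Phi>_def using True
      by (intro order_trans[OF norm_triangle_ineq4] add_mono) (simp_all add: norm_mult mult_right_mono)
    then show ?thesis using True by (simp add: mult_ac)
  qed (simp add: \<Phi>_def)
  have int_exp: "integrable lborel (\<lambda>k. indicator {0<..} k *\<^sub>R exp (- (r * k)))"
  proof -
    have "integrable lborel (\<lambda>k::real. norm (indicator {0<..} k *\<^sub>R exp (- \<i> * of_real k * (- \<i> * of_real r))))"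
      using integral_exp_half_line(1)[of "- \<i> * of_real r"] r by (intro integrable_norm) simp
    then show ?thesis by (simp add: norm_exp_eq_Re mult.commute)
  qed
  have [measurable]: "(\<lambda>(k, x). \<Phi> k x) \<in> borel_measurable (lborel \<Otimes>\<^sub>M lborel)"
    unfolding \<Phi>_def by measurable
  have int\<Phi>: "integrable lborel (\<Phi> k)" for k
    by (rule Bochner_Integration.integrable_bound[where f = "\<lambda>x. indicator {0<..} k *\<^sub>R exp (- (r * k)) * (2 * norm (G x))"])
       (use G_int bound in \<open>auto intro!: AE_I2 simp del: scaleR_conv_of_real simp: abs_mult intro: order_trans[OF bound]\<close>)
  have int: "integrable (lborel \<Otimes>\<^sub>M lborel) (\<lambda>(k, x). \<Phi> k x)"
  proof (rule lborel_pair.Fubini_integrable)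
    show "integrable lborel (\<lambda>k. LINT x|lborel. norm (case (k, x) of (k, x) \<Rightarrow> \<Phi> k x))"
    proof (rule Bochner_Integration.integrable_bound[where f = "\<lambda>k. (indicator {0<..} k *\<^sub>R exp (- (r * k))) * (LINT x|lborel. 2 * norm (G x))"])
      show "integrable lborel (\<lambda>k. (indicator {0<..} k *\<^sub>R exp (- (r * k))) * (LINT x|lborel. 2 * norm (G x)))"
        using int_exp by (rule integrable_mult_left)
      show "AE k in lborel. norm (LINT x|lborel. norm (case (k, x) of (k, x) \<Rightarrow> \<Phi> k x))
        \<le> norm ((indicator {0<..} k *\<^sub>R exp (- (r * k))) * (LINT x|lborel. 2 * norm (G x)))"
      proof (rule AE_I2)
        fix k :: real
        have "(LINT x|lborel. norm (\<Phi> k x)) \<le> (LINT x|lborel. (indicator {0<..} k *\<^sub>R exp (- (r * k))) * (2 * norm (G x)))"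
          using int\<Phi> G_int bound by (intro integral_mono integrable_norm) auto
        also have "\<dots> = (indicator {0<..} k *\<^sub>R exp (- (r * k))) * (LINT x|lborel. 2 * norm (G x))"
          by (rule integral_mult_right_zero)
        finally show "norm (LINT x|lborel. norm (case (k, x) of (k, x) \<Rightarrow> \<Phi> k x))
          \<le> norm ((indicator {0<..} k *\<^sub>R exp (- (r * k))) * (LINT x|lborel. 2 * norm (G x)))"
          by (simp add: integral_nonneg_AE)
      qed
    qed measurable
  qed (use int\<Phi> in auto)
  \<comment> \<open>Integrated in \<open>x\<close> first, \<open>\<Phi>\<close> is an exponential
    factor times the nonlocal integral; integrated in \<open>k\<close> first, it produces the Cauchy
    kernels of both curves. Fubini equates the two.\<close>
  have inner0: "(LINT x|lborel. \<Phi> k x) = 0" for k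
  proof (cases "k > 0")
    case True
    have "\<Phi> k x = exp (\<i> * of_real k * z) * (modes H G k x)" for x
      using True by (simp add: \<Phi>_def algebra_simps flip: exp_add)
    then show ?thesis using nonlocal[OF True] by simp
  qed (simp add: \<Phi>_def)
  have inner1: "(LINT k|lborel. \<Phi> k x) = - \<i> * (G x / (graph H x - z) - cnj (G x) / (cnj (graph H x) - z))" for x
  proof -
    have neg: "Im (graph H x - z) < 0" "Im (cnj (graph H x) - z) < 0" using Im_neg[of x] r by linarith+
    note I = integral_exp_half_line[OF neg(1)] integral_exp_half_line[OF neg(2)]
    have "(LINT k|lborel. \<Phi> k x) = 1 / (\<i> * (graph H x - z)) * G x - 1 / (\<i> * (cnj (graph H x) - z)) * cnj (G x)"
      unfolding \<Phi>_def
      by (subst Bochner_Integration.integral_diff)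
         (intro integrable_mult_left I, intro integrable_mult_left I, simp only: integral_mult_left_zero I)
    then show ?thesis by (simp add: algebra_simps divide_simps)
  qed
  have "\<bar>Im z\<bar> \<noteq> H (Re z)" using z H_le[of "Re z"] S_pos by auto
  note ints = integrable_over_distance[OF this]
  have "(LINT x|lborel. LINT k|lborel. \<Phi> k x) = (LINT k|lborel. LINT x|lborel. \<Phi> k x)"
    by (rule lborel_pair.Fubini_integral[OF int])
  then have "(LINT x|lborel. G x / (graph H x - z) - cnj (G x) / (cnj (graph H x) - z)) = 0"
    unfolding inner0 inner1 by simp
  then show ?thesis using ints by (simp add: cauchy_def)
qed

text \<open>The Laplace representation works only above all crests, but the Cauchy integral is
  holomorphic on the connected region above the surface, so the identity theorem carries the zero
  down to it.\<close>

lemma cauchy_vanishes_above: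
  assumes nonlocal: "\<And>k. k > 0 \<Longrightarrow> (LINT x|lborel. modes H G k x) = 0"
    and z: "H (Re z) < Im z"
  shows "cauchy H G z = 0"
proof (rule analytic_continuation_open[where f = "cauchy H G" and g = "\<lambda>_. 0" and z = z])
  show "open {z. S < Im z}" by (rule open_halfspace_Im_gt)
  show "open {z. H (Re z) < Im z}" by (rule open_graph_regions[OF H_cont])
  show "connected {z. H (Re z) < Im z}" by (rule connected_above_graph[OF H_cont])
  have "Complex 0 (S + 1) \<in> {z. S < Im z}" by simp
  then show "{z. S < Im z} \<noteq> {}" by blast
  show "{z. S < Im z} \<subseteq> {z. H (Re z) < Im z}" using H_le le_less_trans by blast
  have "cauchy H G field_differentiable at w" if "H (Re w) < Im w" for w
    using that H_pos[of "Re w"] by (intro cauchy_field_differentiable) auto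
  then show "cauchy H G holomorphic_on {z. H (Re z) < Im z}"
    by (auto simp: holomorphic_on_def intro: field_differentiable_at_within)
  show "z \<in> {z. H (Re z) < Im z}" using z by simp
qed (use cauchy_vanishes_far_above[OF nonlocal] in auto)

text \<open>Subtracting the vanishing value at the mirror point replaces each Cauchy kernel by
  \<open>kernel\<close>. The surface density is then split into its deviation from
  \<open>F x0\<close> and the constant \<open>F x0\<close>; the constant part is integrated exactly
  by \<open>integral_tangent_kernel\<close> and becomes the boundary value.\<close>

lemma cauchy_eq_surface_field:
  assumes d: "0 < d" "d \<le> H x0"
    and vanish: "cauchy H G (Complex x0 (H x0 + d)) = 0"
  shows "cauchy H G (Complex x0 (H x0 - d)) = surface_field H a G x0 d"
proof -
  define z z' where "z = Complex x0 (H x0 - d)" and "z' = Complex x0 (H x0 + d)"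
  define F where "F x = G x / Complex 1 (a x)" for x
  let ?K = "\<lambda>x. kernel H x0 d (graph H x)" and ?K' = "\<lambda>x. kernel H x0 d (cnj (graph H x))"
  have "\<bar>Im z\<bar> \<noteq> H (Re z)" "\<bar>Im z'\<bar> \<noteq> H (Re z')" using d by (auto simp: z_def z'_def)
  note ints = integrable_over_distance[OF this(1)] integrable_over_distance[OF this(2)]
  have K: "G x * ?K x = G x / (graph H x - z) - G x / (graph H x - z')"
    "cnj (G x) * ?K' x = cnj (G x) / (cnj (graph H x) - z) - cnj (G x) / (cnj (graph H x) - z')" for x
    by (simp_all add: kernel_def z_def z'_def algebra_simps)
  have GK: "integrable lborel (\<lambda>x. G x * ?K x)" unfolding K using ints by auto
  have "cauchy H G z = cauchy H G z - cauchy H G z'" using vanish by (simp add: z'_def)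
  also have "\<dots> = 1 / (2 * of_real pi * \<i>) *
      ((LINT x|lborel. cnj (G x) * ?K' x) - (LINT x|lborel. G x * ?K x))"
    unfolding K using ints by (simp add: cauchy_def algebra_simps)
  also have "(LINT x|lborel. cnj (G x) * ?K' x) = (LINT s|lborel. bottom_term H G x0 d s)"
    using lborel_integral_real_affine[of 1 "\<lambda>x. cnj (G x) * ?K' x" x0] by (simp add: bottom_term_def)
  also have "(LINT x|lborel. G x * ?K x) = (LINT s|lborel. top_term H a G x0 d s) - F x0 * (2 * of_real pi * \<i>)"
  proof -
    have eq: "G x * ?K x = (F x - F x0) * Complex 1 (a x) * ?K x + F x0 * (Complex 1 (a x) * ?K x)" for x
      by (simp add: F_def algebra_simps)
    note I = integral_tangent_kernel[OF d(1), of x0]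
    have eq': "(F x - F x0) * Complex 1 (a x) * ?K x = G x * ?K x - F x0 * (Complex 1 (a x) * ?K x)" for x
      by (simp add: F_def algebra_simps)
    have int1: "integrable lborel (\<lambda>x. (F x - F x0) * Complex 1 (a x) * ?K x)"
      unfolding eq' by (intro Bochner_Integration.integrable_diff integrable_mult_right GK I)
    have "(LINT x|lborel. G x * ?K x) = (LINT x|lborel. (F x - F x0) * Complex 1 (a x) * ?K x)
        + (LINT x|lborel. F x0 * (Complex 1 (a x) * ?K x))"
      unfolding eq by (intro Bochner_Integration.integral_add int1 integrable_mult_right I)
    also have "(LINT x|lborel. F x0 * (Complex 1 (a x) * ?K x)) = - (F x0 * (2 * of_real pi * \<i>))"
      by (simp only: integral_mult_right_zero I) simp
    \<comment> \<open>The substitution \<open>x0 + d * s\<close> contributes the Jacobian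
      \<open>d\<close>, which is the factor standing next to the kernel in
      \<open>top_term\<close>.\<close>
    also have "(LINT x|lborel. (F x - F x0) * Complex 1 (a x) * ?K x) = (LINT s|lborel. top_term H a G x0 d s)"
    proof -
      have "(LINT x|lborel. (F x - F x0) * Complex 1 (a x) * ?K x) =
         d *\<^sub>R (LINT s|lborel. (F (x0 + d * s) - F x0) * Complex 1 (a (x0 + d * s)) * ?K (x0 + d * s))"
        using lborel_integral_real_affine[of d "\<lambda>x. (F x - F x0) * Complex 1 (a x) * ?K x" x0] d by simp
      also have "\<dots> = (LINT s|lborel. d *\<^sub>R ((F (x0 + d * s) - F x0) * Complex 1 (a (x0 + d * s)) * ?K (x0 + d * s)))"
        by (rule integral_scaleR_right[symmetric])
      finally show ?thesis by (simp add: top_term_def F_def scaleR_conv_of_real mult_ac)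
    qed
    finally show ?thesis by simp
  qed
  finally show ?thesis
    unfolding z_def[symmetric] surface_field_def F_def[symmetric] by (simp add: field_simps)
qed

lemma cauchy_field_differentiable_below:
  assumes "- H (Re z) < Im z" "Im z < H (Re z)"
  shows "cauchy H G field_differentiable at z"
  using assms by (intro cauchy_field_differentiable) auto

end

section \<open>Continuity up to the surface\<close>

lemma norm_mult3_le:
  fixes A B C :: complex
  assumes "norm B \<le> b" "norm C \<le> c"
  shows "norm (A * B * C) \<le> norm A * (b * c)"
proof -
  have "norm B * norm C \<le> b * c"
    using assms order_trans[OF norm_ge_zero assms(1)] by (intro mult_mono) auto
  then show ?thesis by (simp add: norm_mult mult.assoc mult_left_mono)
qed

lemma tendsto_kernel:
  assumes H: "(\<lambda>n. Hn n (xn n)) \<longlonglongrightarrow> H x" and x: "xn \<longlonglongrightarrow> x" and d: "dn \<longlonglongrightarrow> d" and w: "wn \<longlonglongrightarrow> w"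
    and ne: "w \<noteq> Complex x (H x - d)" "w \<noteq> Complex x (H x + d)"
  shows "(\<lambda>n. kernel (Hn n) (xn n) (dn n) (wn n)) \<longlonglongrightarrow> kernel H x d w"
  unfolding kernel_def using ne by (intro tendsto_intros tendsto_Complex H x d w) auto

text \<open>The channel is allowed to vary along with the point, as it does when time varies.
  Continuous convergence of the data gives pointwise convergence of the two integrands, and the
  common constants give one dominating function for each.\<close>

lemma surface_field_tendsto:
  assumes chn: "\<And>n. channel (Hn n) (an n) (Gn n) m S L B" and ch: "channel H a G m S L B"
    and H: "\<And>un u. un \<longlonglongrightarrow> u \<Longrightarrow> (\<lambda>n. Hn n (un n)) \<longlonglongrightarrow> H u"
    and a: "\<And>un u. un \<longlonglongrightarrow> u \<Longrightarrow> (\<lambda>n. an n (un n)) \<longlonglongrightarrow> a u"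
    and G: "\<And>un u. un \<longlonglongrightarrow> u \<Longrightarrow> (\<lambda>n. Gn n (un n)) \<longlonglongrightarrow> G u"
    and x: "xn \<longlonglongrightarrow> x" and d: "dn \<longlonglongrightarrow> d" and dn: "\<And>n. 0 \<le> dn n" "\<And>n. dn n \<le> Hn n (xn n)"
  shows "(\<lambda>n. surface_field (Hn n) (an n) (Gn n) (xn n) (dn n)) \<longlonglongrightarrow> surface_field H a G x d"
proof -
  interpret channel H a G m S L B by (rule ch)
  have d0: "0 \<le> d" using d dn(1) by (intro LIMSEQ_le_const) auto
  have dH: "d \<le> H x" by (rule LIMSEQ_le[OF d H[OF x]]) (use dn(2) in auto)
  note [measurable] = channel.measurable_terms[OF chn]
  have bottom: "(\<lambda>n. LINT s|lborel. bottom_term (Hn n) (Gn n) (xn n) (dn n) s)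
      \<longlonglongrightarrow> (LINT s|lborel. bottom_term H G x d s)"
  proof (rule tendsto_integral_sequence)
    show "integrable lborel (\<lambda>s. B * (2 * S) * (1 / (s\<^sup>2 + m\<^sup>2)))" using m_pos by (rule integrable_poisson)
    show "\<forall>\<^sub>F n in sequentially. \<forall>s. norm (bottom_term (Hn n) (Gn n) (xn n) (dn n) s) \<le> B * (2 * S) * (1 / (s\<^sup>2 + m\<^sup>2))"
      by (intro always_eventually allI channel.norm_bottom_term_le'[OF chn] dn)
    fix s
    have xs: "(\<lambda>n. xn n + s) \<longlonglongrightarrow> x + s" using x by (intro tendsto_intros)
    have "cnj (graph H (x + s)) \<noteq> Complex x (H x - d)" "cnj (graph H (x + s)) \<noteq> Complex x (H x + d)"
      using d0 dH H_pos[of x] H_pos[of "x + s"] by (auto simp: graph_def complex_eq_iff)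
    then show "(\<lambda>n. bottom_term (Hn n) (Gn n) (xn n) (dn n) s) \<longlonglongrightarrow> bottom_term H G x d s"
      unfolding bottom_term_def
      by (intro tendsto_intros tendsto_kernel H G x d xs) (auto simp: graph_def intro!: tendsto_Complex tendsto_intros xs H)
  qed measurable
  define F Fn where "F x = G x / Complex 1 (a x)" and "Fn n x = Gn n x / Complex 1 (an n x)" for x n
  have F: "(\<lambda>n. Fn n (un n)) \<longlonglongrightarrow> F u" if "un \<longlonglongrightarrow> u" for un u
    unfolding F_def Fn_def by (intro tendsto_intros G a tendsto_Complex that) auto
  have top: "(\<lambda>n. LINT s|lborel. top_term (Hn n) (an n) (Gn n) (xn n) (dn n) s)
      \<longlonglongrightarrow> (LINT s|lborel. top_term H a G x d s)"
  proof (rule tendsto_integral_sequence)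
    show "integrable lborel (\<lambda>s. 2 * B * (1 + L) * (2 * (2 + L\<^sup>2)) * (1 / (s\<^sup>2 + 1\<^sup>2)))"
      by (rule integrable_poisson) simp
    show "\<forall>\<^sub>F n in sequentially. \<forall>s. norm (top_term (Hn n) (an n) (Gn n) (xn n) (dn n) s)
        \<le> 2 * B * (1 + L) * (2 * (2 + L\<^sup>2)) * (1 / (s\<^sup>2 + 1\<^sup>2))"
      by (intro always_eventually allI channel.norm_top_term_le[OF chn] dn)
    fix s
    have xs: "(\<lambda>n. xn n + dn n * s) \<longlonglongrightarrow> x + d * s" using x d by (intro tendsto_intros)
    show "(\<lambda>n. top_term (Hn n) (an n) (Gn n) (xn n) (dn n) s) \<longlonglongrightarrow> top_term H a G x d s"
    proof (cases "d = 0")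
      case False
      then have "graph H (x + d * s) \<noteq> Complex x (H x - d)" "graph H (x + d * s) \<noteq> Complex x (H x + d)"
        using graph_distance_pos[of d "x + d * s" x] graph_distance_pos[of "- d" "x + d * s" x] by auto
      then show ?thesis unfolding top_term_def F_def[symmetric] Fn_def[symmetric]
        by (intro tendsto_intros tendsto_kernel F H a tendsto_Complex x d xs)
           (auto simp: graph_def intro!: tendsto_Complex tendsto_intros xs H)
    next
      \<comment> \<open>When the point reaches the surface the scaled kernel need not converge. It
        stays bounded, and it multiplies a difference of boundary values whose arguments merge, so
        the product tends to 0.\<close>
      case True
      let ?c = "(1 + L) * (2 * (2 + L\<^sup>2) / (s\<^sup>2 + 1\<^sup>2))"
      have "(\<lambda>n. Fn n (xn n + dn n * s) - Fn n (xn n)) \<longlonglongrightarrow> F (x + d * s) - F x"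
        by (intro tendsto_diff F xs x)
      then have "(\<lambda>n. norm (Fn n (xn n + dn n * s) - Fn n (xn n)) * ?c) \<longlonglongrightarrow> 0"
        using True by (intro tendsto_mult_left_zero tendsto_norm_zero) simp
      moreover have "norm (top_term (Hn n) (an n) (Gn n) (xn n) (dn n) s)
          \<le> norm (Fn n (xn n + dn n * s) - Fn n (xn n)) * ?c" for n
        unfolding top_term_def F_def[symmetric] Fn_def[symmetric]
        by (rule norm_mult3_le[OF channel.norm_tangent_le[OF chn] channel.norm_scaled_kernel_le[OF chn dn(1)]])
      then have "\<forall>n. norm (top_term (Hn n) (an n) (Gn n) (xn n) (dn n) s)
          \<le> norm (Fn n (xn n + dn n * s) - Fn n (xn n)) * ?c" by (rule allI)
      ultimately have "(\<lambda>n. top_term (Hn n) (an n) (Gn n) (xn n) (dn n) s) \<longlonglongrightarrow> 0"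
        by (rule Lim_null_comparison[OF always_eventually, rotated])
      then show ?thesis using True by (simp add: top_term_def)
    qed
  qed measurable
  show ?thesis
    unfolding surface_field_def F_def[symmetric] Fn_def[symmetric]
    by (intro tendsto_intros F x top bottom)
qed

text \<open>For fixed \<open>s\<close> the shifts \<open>s\<close> and \<open>dn n * s\<close> are
  bounded, because the depth is at most \<open>S\<close>. All values of \<open>G\<close> involved
  are therefore taken far out and tend to 0, and the dominating functions do not depend on the
  position.\<close>

lemma (in channel) surface_field_decays:
  assumes G: "(G \<longlongrightarrow> 0) at_infinity"
    and x: "filterlim xn at_infinity sequentially" and dn: "\<And>n. 0 \<le> dn n" "\<And>n. dn n \<le> H (xn n)"
  shows "(\<lambda>n. surface_field H a G (xn n) (dn n)) \<longlonglongrightarrow> 0"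
proof -
  have dS: "\<bar>dn n\<bar> \<le> S" for n using dn H_le order_trans by (metis abs_of_nonneg)
  have shift: "(\<lambda>n. G (xn n + un n)) \<longlonglongrightarrow> 0" if "\<And>n. \<bar>un n\<bar> \<le> C" for un C
  proof (rule filterlim_compose[OF G])
    have "filterlim (\<lambda>n. - C + norm (xn n)) at_top sequentially"
      using x by (intro filterlim_tendsto_add_at_top[OF tendsto_const]) (rule filterlim_at_infinity_imp_norm_at_top[OF x])
    then have "filterlim (\<lambda>n. norm (xn n + un n)) at_top sequentially"
    proof (rule filterlim_at_top_mono[OF _ always_eventually], intro allI)
      show "- C + norm (xn n) \<le> norm (xn n + un n)" for n using that[of n] unfolding real_norm_def by linarith
    qed
    then show "filterlim (\<lambda>n. xn n + un n) at_infinity sequentially"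
      by (rule filterlim_norm_at_top_imp_at_infinity)
  qed
  have sd: "\<bar>dn n * s\<bar> \<le> S * \<bar>s\<bar>" for n s using dS[of n] by (simp add: abs_mult mult_right_mono)
  note G0 = shift[of "\<lambda>_. 0" 0, simplified]
  have Flim: "(\<lambda>n. G (un n) / Complex 1 (a (un n))) \<longlonglongrightarrow> 0" if "(\<lambda>n. G (un n)) \<longlonglongrightarrow> 0" for un
  proof (rule Lim_null_comparison[OF always_eventually tendsto_norm_zero[OF that]], intro allI)
    show "norm (G (un n) / Complex 1 (a (un n))) \<le> norm (G (un n))" for n
      using frac_le[OF norm_ge_zero order_refl zero_less_one norm_Complex_1_ge] by (simp add: norm_divide)
  qed
  have bottom: "(\<lambda>n. LINT s|lborel. bottom_term H G (xn n) (dn n) s) \<longlonglongrightarrow> (LINT (s::real)|lborel. (0::complex))"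
  proof (rule tendsto_integral_sequence)
    show "integrable lborel (\<lambda>s. B * (2 * S) * (1 / (s\<^sup>2 + m\<^sup>2)))" using m_pos by (rule integrable_poisson)
    show "\<forall>\<^sub>F n in sequentially. \<forall>s. norm (bottom_term H G (xn n) (dn n) s) \<le> B * (2 * S) * (1 / (s\<^sup>2 + m\<^sup>2))"
      by (intro always_eventually allI norm_bottom_term_le' dn)
    show "(\<lambda>n. bottom_term H G (xn n) (dn n) s) \<longlonglongrightarrow> 0" for s
    proof (rule Lim_null_comparison[OF always_eventually], intro allI)
      show "norm (bottom_term H G (xn n) (dn n) s) \<le> norm (G (xn n + s)) * (2 * S * (1 / (s\<^sup>2 + m\<^sup>2)))" for n
        by (rule norm_bottom_term_le[OF dn])
      show "(\<lambda>n. norm (G (xn n + s)) * (2 * S * (1 / (s\<^sup>2 + m\<^sup>2)))) \<longlonglongrightarrow> 0"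
        by (intro tendsto_mult_left_zero tendsto_norm_zero shift[of _ "\<bar>s\<bar>"]) simp
    qed
  qed measurable
  have top: "(\<lambda>n. LINT s|lborel. top_term H a G (xn n) (dn n) s) \<longlonglongrightarrow> (LINT (s::real)|lborel. (0::complex))"
  proof (rule tendsto_integral_sequence)
    show "integrable lborel (\<lambda>s. 2 * B * (1 + L) * (2 * (2 + L\<^sup>2)) * (1 / (s\<^sup>2 + 1\<^sup>2)))"
      by (rule integrable_poisson) simp
    show "\<forall>\<^sub>F n in sequentially. \<forall>s. norm (top_term H a G (xn n) (dn n) s)
        \<le> 2 * B * (1 + L) * (2 * (2 + L\<^sup>2)) * (1 / (s\<^sup>2 + 1\<^sup>2))"
      by (intro always_eventually allI norm_top_term_le dn)
    show "(\<lambda>n. top_term H a G (xn n) (dn n) s) \<longlonglongrightarrow> 0" for s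
    proof (rule Lim_null_comparison[OF always_eventually], intro allI)
      let ?D = "\<lambda>n. G (xn n + dn n * s) / Complex 1 (a (xn n + dn n * s)) - G (xn n) / Complex 1 (a (xn n))"
      let ?c = "(1 + L) * (2 * (2 + L\<^sup>2) / (s\<^sup>2 + 1\<^sup>2))"
      show "norm (top_term H a G (xn n) (dn n) s) \<le> norm (?D n) * ?c" for n
        unfolding top_term_def by (rule norm_mult3_le[OF norm_tangent_le norm_scaled_kernel_le[OF dn(1)]])
      have "?D \<longlonglongrightarrow> 0 - 0" by (intro tendsto_diff Flim G0 shift[OF sd])
      then show "(\<lambda>n. norm (?D n) * ?c) \<longlonglongrightarrow> 0"
        by (intro tendsto_mult_left_zero tendsto_norm_zero) simp
    qed
  qed measurable
  have "(\<lambda>n. surface_field H a G (xn n) (dn n)) \<longlonglongrightarrow>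
      0 + 1 / (2 * of_real pi * \<i>) * ((LINT (s::real)|lborel. (0::complex)) - (LINT (s::real)|lborel. (0::complex)))"
    unfolding surface_field_def by (intro tendsto_intros Flim G0 top bottom) auto
  then show ?thesis by simp
qed

section \<open>Contour integrals along scaled graphs\<close>

definition below_graph :: "(real \<Rightarrow> real) \<Rightarrow> complex set" where
  "below_graph H = {z. 0 \<le> Im z \<and> Im z \<le> H (Re z)}"

text \<open>Continuity holds up to both boundary curves, while a primitive is available only
  strictly between them. The scaled graphs with parameter \<open>s\<close> interpolate between the
  bottom (\<open>s = 0\<close>) and the surface (\<open>s = 1\<close>).\<close>

locale strip_function =
  fixes H a :: "real \<Rightarrow> real" and f :: "complex \<Rightarrow> complex"
  assumes H_deriv: "\<And>x. (H has_real_derivative a x) (at x)"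
    and a_cont: "continuous_on UNIV a"
    and H_pos: "\<And>x. 0 < H x"
    and f_cont: "continuous_on (below_graph H) f"
begin

lemma H_cont: "continuous_on UNIV H"
  using H_deriv by (meson DERIV_continuous_on has_field_derivative_at_within)

definition scaled_integrand :: "real \<Rightarrow> real \<Rightarrow> complex" where
  "scaled_integrand s x = f (Complex x (s * H x)) * Complex 1 (s * a x)"

lemma scaled_in: "0 \<le> s \<Longrightarrow> s \<le> 1 \<Longrightarrow> Complex x (s * H x) \<in> below_graph H"
  using H_pos[of x] by (simp add: below_graph_def mult_left_le_one_le)

lemma scaled_integrand_continuous:
  "continuous_on ({0..1} \<times> UNIV) (\<lambda>(s, x). scaled_integrand s x)"
proof -
  have c: "continuous_on ({0..1} \<times> UNIV) (\<lambda>p::real\<times>real. H (snd p))"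
    "continuous_on ({0..1} \<times> UNIV) (\<lambda>p::real\<times>real. a (snd p))"
    by (rule continuous_on_compose2[OF H_cont] continuous_on_compose2[OF a_cont]; auto intro!: continuous_intros)+
  have "continuous_on ({0..1} \<times> UNIV) (\<lambda>p. f (Complex (snd p) (fst p * H (snd p))))"
  proof (rule continuous_on_compose2[OF f_cont])
    show "continuous_on ({0..1} \<times> UNIV) (\<lambda>p. Complex (snd p) (fst p * H (snd p)))"
      unfolding Complex_eq by (intro continuous_intros c)
    show "(\<lambda>p. Complex (snd p) (fst p * H (snd p))) ` ({0..1} \<times> UNIV) \<subseteq> below_graph H"
      using scaled_in by auto
  qed
  moreover have "continuous_on ({0..1} \<times> UNIV) (\<lambda>p. Complex 1 (fst p * a (snd p)))"
    unfolding Complex_eq by (intro continuous_intros c)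
  ultimately show ?thesis
    unfolding scaled_integrand_def case_prod_beta by (rule continuous_on_mult)
qed

lemma scaled_integrand_continuous_snd:
  assumes "0 \<le> s" "s \<le> 1"
  shows "continuous_on A (scaled_integrand s)"
proof -
  have "continuous_on A (\<lambda>x. (\<lambda>(s, x). scaled_integrand s x) (s, x))"
    by (rule continuous_on_compose2[OF scaled_integrand_continuous]) (use assms in \<open>auto intro!: continuous_intros\<close>)
  then show ?thesis by simp
qed

lemma scaled_integral_continuous:
  "continuous_on {0..1} (\<lambda>s. integral {\<alpha>..\<beta>} (scaled_integrand s))"
proof -
  have "continuous_on ({0..1} \<times> cbox \<alpha> \<beta>) (\<lambda>(s, x). scaled_integrand s x)"
    using scaled_integrand_continuous by (rule continuous_on_subset) auto
  from integral_continuous_on_param[OF this] show ?thesis by (simp add: box_real)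
qed

lemma scaled_integral_eq:
  assumes P: "\<And>z. 0 < Im z \<Longrightarrow> Im z < H (Re z) \<Longrightarrow> (P has_field_derivative f z) (at z)"
    and s: "0 < s" "s < 1" and "\<alpha> \<le> \<beta>"
  shows "integral {\<alpha>..\<beta>} (scaled_integrand s) = P (Complex \<beta> (s * H \<beta>)) - P (Complex \<alpha> (s * H \<alpha>))"
proof (rule integral_unique, rule fundamental_theorem_of_calculus)
  fix x assume "x \<in> {\<alpha>..\<beta>}"
  have "((\<lambda>x. of_real x + \<i> * of_real (s * H x)) has_vector_derivative (1 + \<i> * of_real (s * a x))) (at x)"
    using H_deriv[of x] by (auto intro!: derivative_eq_intros simp: has_real_derivative_iff_has_vector_derivative)
  then have "((\<lambda>x. Complex x (s * H x)) has_vector_derivative Complex 1 (s * a x)) (at x)"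
    by (simp add: Complex_eq)
  moreover have "(P has_field_derivative f (Complex x (s * H x))) (at (Complex x (s * H x)))"
    using s H_pos[of x] by (intro P) (auto simp: mult_less_cancel_right2)
  ultimately have "((P \<circ> (\<lambda>x. Complex x (s * H x))) has_vector_derivative
      (Complex 1 (s * a x) * f (Complex x (s * H x)))) (at x)"
    by (rule field_vector_diff_chain_at)
  then show "((\<lambda>x. P (Complex x (s * H x))) has_vector_derivative scaled_integrand s x) (at x within {\<alpha>..\<beta>})"
    unfolding o_def scaled_integrand_def mult.commute[of "Complex 1 _"]
    by (rule has_vector_derivative_at_within)
qed (fact assms)

text \<open>Cauchy's theorem on a truncated strip: the integrals over the top and the bottom differ
  only by the two vertical sides, each contributing at most \<open>\<epsilon>\<close> times the
  height bound \<open>S\<close>.\<close>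

lemma scaled_integral_difference_le:
  assumes P: "\<And>z. 0 < Im z \<Longrightarrow> Im z < H (Re z) \<Longrightarrow> (P has_field_derivative f z) (at z)"
    and "\<alpha> \<le> \<beta>" and S: "\<And>x. H x \<le> S"
    and small: "\<And>x y. x = \<alpha> \<or> x = \<beta> \<Longrightarrow> 0 < y \<Longrightarrow> y < H x \<Longrightarrow> norm (f (Complex x y)) \<le> \<epsilon>"
  shows "norm (integral {\<alpha>..\<beta>} (scaled_integrand 1) - integral {\<alpha>..\<beta>} (scaled_integrand 0)) \<le> 2 * \<epsilon> * S"
proof -
  let ?I = "\<lambda>s. integral {\<alpha>..\<beta>} (scaled_integrand s)"
  have vert: "norm (P (Complex x (s1 * H x)) - P (Complex x (s0 * H x))) \<le> \<epsilon> * S"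
    if x: "x = \<alpha> \<or> x = \<beta>" and s: "0 < s0" "s0 < 1" "0 < s1" "s1 < 1" for x s0 s1
  proof -
    let ?V = "{z. Re z = x \<and> 0 < Im z \<and> Im z < H x}"
    have V: "?V = ({z. x \<le> Re z} \<inter> {z. Re z \<le> x}) \<inter> ({z. 0 < Im z} \<inter> {z. Im z < H x})" by auto
    have "convex ?V" unfolding V
      by (intro convex_Int convex_halfspace_Im_gt convex_halfspace_Im_lt convex_halfspace_Re_ge convex_halfspace_Re_le)
    then have "norm (P (Complex x (s1 * H x)) - P (Complex x (s0 * H x))) \<le>
        \<epsilon> * norm (Complex x (s1 * H x) - Complex x (s0 * H x))"
    proof (rule field_differentiable_bound[where f = P and f' = f])
      show "(P has_field_derivative f z) (at z within ?V)" if "z \<in> ?V" for z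
        by (rule has_field_derivative_at_within, rule P) (use that in auto)
      show "norm (f z) \<le> \<epsilon>" if "z \<in> ?V" for z
      proof -
        have "Complex x (Im z) = z" using that by (simp add: complex_eq_iff)
        then show ?thesis using that small[OF x, of "Im z"] by simp
      qed
    qed (use s H_pos[of x] in \<open>auto simp: mult_less_cancel_right2\<close>)
    also have "Complex x (s1 * H x) - Complex x (s0 * H x) = \<i> * of_real ((s1 - s0) * H x)"
      by (simp add: complex_eq_iff algebra_simps)
    also have "\<epsilon> * norm (\<i> * of_real ((s1 - s0) * H x)) \<le> \<epsilon> * S"
    proof (rule mult_left_mono)
      have "\<bar>s1 - s0\<bar> * \<bar>H x\<bar> \<le> 1 * S" using s S[of x] H_pos[of x] by (intro mult_mono) auto
      then show "norm (\<i> * of_real ((s1 - s0) * H x)) \<le> S"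
        unfolding norm_mult norm_ii norm_of_real abs_mult by simp
      show "0 \<le> \<epsilon>"
        by (rule order_trans[OF norm_ge_zero small[OF x, of "H x / 2"]]) (use H_pos[of x] in auto)
    qed
    finally show ?thesis .
  qed
  have inner: "norm (?I s1 - ?I s0) \<le> 2 * \<epsilon> * S" if s: "0 < s0" "s0 < 1" "0 < s1" "s1 < 1" for s0 s1
  proof -
    have "?I s1 - ?I s0 = (P (Complex \<beta> (s1 * H \<beta>)) - P (Complex \<beta> (s0 * H \<beta>)))
       - (P (Complex \<alpha> (s1 * H \<alpha>)) - P (Complex \<alpha> (s0 * H \<alpha>)))"
      using scaled_integral_eq[OF P _ _ \<open>\<alpha> \<le> \<beta>\<close>] s by simp
    also have "norm \<dots> \<le> \<epsilon> * S + \<epsilon> * S"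
      by (rule order_trans[OF norm_triangle_ineq4]) (intro add_mono vert s; simp)
    finally show ?thesis by (simp add: mult_ac)
  qed
  \<comment> \<open>The primitive covers only parameters strictly between 0 and 1. The estimate
    reaches the boundary curves by continuity of the integrals in \<open>s\<close>, first at the
    surface, then at the bottom.\<close>
  have lim1: "(?I \<longlongrightarrow> ?I 1) (at_left 1)" and lim0: "(?I \<longlongrightarrow> ?I 0) (at_right 0)"
    using continuous_on_Icc_at_leftD[OF scaled_integral_continuous]
      continuous_on_Icc_at_rightD[OF scaled_integral_continuous] by simp_all
  have step: "norm (?I 1 - ?I s0) \<le> 2 * \<epsilon> * S" if "0 < s0" "s0 < 1" for s0
  proof (rule tendsto_upperbound)
    show "((\<lambda>s. norm (?I s - ?I s0)) \<longlongrightarrow> norm (?I 1 - ?I s0)) (at_left 1)"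
      by (intro tendsto_intros lim1)
    show "\<forall>\<^sub>F s in at_left 1. norm (?I s - ?I s0) \<le> 2 * \<epsilon> * S"
      using eventually_at_left_real[of 0 "1::real"] by (rule eventually_mono) (use inner that in auto)
  qed simp
  show ?thesis
  proof (rule tendsto_upperbound)
    show "((\<lambda>s. norm (?I 1 - ?I s)) \<longlongrightarrow> norm (?I 1 - ?I 0)) (at_right 0)"
      by (intro tendsto_intros lim0)
    show "\<forall>\<^sub>F s in at_right 0. norm (?I 1 - ?I s) \<le> 2 * \<epsilon> * S"
      using eventually_at_right_real[of 0 "1::real"] by (rule eventually_mono) (use step in auto)
  qed simp
qed

end

section \<open>From the field to the nonlocal equation\<close>

lemma integral_zero_if_limit_zero:
  fixes \<Psi> :: "real \<Rightarrow> complex"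
  assumes int: "integrable lborel \<Psi>"
    and lim: "\<And>\<epsilon>. \<epsilon> > 0 \<Longrightarrow> \<forall>\<^sub>F n in sequentially. norm (integral {- real n..real n} \<Psi>) \<le> \<epsilon>"
  shows "integral\<^sup>L lborel \<Psi> = 0"
proof -
  have [measurable]: "\<Psi> \<in> borel_measurable borel" using int by auto
  have "(\<lambda>n. LINT x|lborel. indicator {- real n..real n} x *\<^sub>R \<Psi> x) \<longlonglongrightarrow> integral\<^sup>L lborel \<Psi>"
  proof (rule tendsto_integral_sequence)
    show "integrable lborel (\<lambda>x. norm (\<Psi> x))" using int by (rule integrable_norm)
    show "\<forall>\<^sub>F n in sequentially. \<forall>x. norm (indicator {- real n..real n} x *\<^sub>R \<Psi> x) \<le> norm (\<Psi> x)"
      by (auto simp: indicator_def)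
    fix x :: real
    have "\<forall>\<^sub>F n in sequentially. \<Psi> x = indicator {- real n..real n} x *\<^sub>R \<Psi> x"
      using eventually_ge_at_top[of "nat \<lceil>\<bar>x\<bar>\<rceil>"] by eventually_elim (auto simp: indicator_def abs_le_iff nat_le_iff ceiling_le_iff)
    then show "(\<lambda>n. indicator {- real n..real n} x *\<^sub>R \<Psi> x) \<longlonglongrightarrow> \<Psi> x"
      by (rule Lim_transform_eventually[OF tendsto_const])
  qed measurable
  moreover have "(LINT x|lborel. indicator {- real n..real n} x *\<^sub>R \<Psi> x) = integral {- real n..real n} \<Psi>" for n
    using set_borel_integral_eq_integral(2)[of "{- real n..real n}" \<Psi>]
      integrable_mult_indicator[OF _ int, of "{- real n..real n}"]
    by (simp add: set_lebesgue_integral_def set_integrable_def)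
  moreover have "(\<lambda>n. integral {- real n..real n} \<Psi>) \<longlonglongrightarrow> 0"
  proof (rule tendstoI)
    fix \<epsilon> :: real assume "\<epsilon> > 0"
    then have "\<forall>\<^sub>F n in sequentially. norm (integral {- real n..real n} \<Psi>) \<le> \<epsilon> / 2"
      by (intro lim) simp
    then show "\<forall>\<^sub>F n in sequentially. dist (integral {- real n..real n} \<Psi>) 0 < \<epsilon>"
      by eventually_elim (use \<open>\<epsilon> > 0\<close> in simp)
  qed
  ultimately show ?thesis using LIMSEQ_unique by fastforce
qed

lemma norm_exp_strip_le:
  assumes "0 \<le> Im z" "Im z \<le> S"
  shows "norm (exp (- \<i> * of_real k * z)) \<le> exp (\<bar>k\<bar> * S)"
proof -
  have "k * Im z \<le> \<bar>k\<bar> * S" using assms by (intro mult_mono) auto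
  then show ?thesis by (simp add: norm_exp_eq_Re)
qed

text \<open>
  The field times an exponential is integrated over the boundary of the fluid; on the flat bottom
  the field is real, so conjugation with k reversed removes the bottom contribution.
\<close>

lemma nonlocal_integral_zero:
  assumes "strip_function H a f" and S: "\<And>x. H x \<le> S"
    and hol: "f holomorphic_on {z. 0 * H (Re z) < Im z \<and> Im z < H (Re z)}"
    and top: "\<And>x. f (Complex x (H x)) * Complex 1 (a x) = G x"
    and bottom: "\<And>x. Im (f (Complex x 0)) = 0"
    and decay: "\<And>\<epsilon>. \<epsilon> > 0 \<Longrightarrow> \<exists>R. \<forall>z\<in>below_graph H. \<bar>Re z\<bar> > R \<longrightarrow> norm (f z) \<le> \<epsilon>"
    and int: "\<And>k. integrable lborel (\<lambda>x. modes H G k x)"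
  shows "(LINT x|lborel. modes H G k x) = 0"
proof (rule integral_zero_if_limit_zero[OF int])
  interpret strip_function H a f by fact
  define fk where "fk k z = f z * exp (- \<i> * of_real k * z)" for k :: real and z
  have sf: "strip_function H a (fk k)" for k
  proof unfold_locales
    show "continuous_on (below_graph H) (fk k)" unfolding fk_def by (intro continuous_intros f_cont)
  qed (use H_deriv a_cont H_pos in auto)
  define I where "I k s n = integral {- real n..real n} (strip_function.scaled_integrand H a (fk k) s)" for k s n
  have scaled: "strip_function.scaled_integrand H a (fk k) s x = fk k (Complex x (s * H x)) * Complex 1 (s * a x)" for k s x
    by (simp add: strip_function.scaled_integrand_def[OF sf])
  have Spos: "0 < S" using H_pos S less_le_trans by blast
  have small: "\<forall>\<^sub>F n in sequentially. norm (I k 1 n - I k 0 n) \<le> \<epsilon>" if \<epsilon>: "\<epsilon> > 0" for k \<epsilon>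
  proof -
    \<comment> \<open>Chosen to cancel the growth \<open>exp (\<bar>k\<bar> * S)\<close> of the
      exponential across the strip and the factor \<open>2 * S\<close> coming from the two vertical
      sides.\<close>
    define \<epsilon>' where "\<epsilon>' = \<epsilon> / (2 * S * exp (\<bar>k\<bar> * S))"
    have \<epsilon>': "\<epsilon>' > 0" using \<epsilon> Spos by (simp add: \<epsilon>'_def)
    obtain R where R: "\<And>z. z \<in> below_graph H \<Longrightarrow> \<bar>Re z\<bar> > R \<Longrightarrow> norm (f z) \<le> \<epsilon>'"
      using decay[OF \<epsilon>'] by blast
    have "fk k holomorphic_on {z. 0 * H (Re z) < Im z \<and> Im z < H (Re z)}"
      unfolding fk_def by (intro holomorphic_intros hol)
    then obtain P where P: "\<And>z. 0 * H (Re z) < Im z \<Longrightarrow> Im z < H (Re z) \<Longrightarrow> (P has_field_derivative fk k z) (at z)"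
      using primitive_between_graphs[OF H_cont H_pos] by blast
    show ?thesis using eventually_gt_at_top[of "nat \<lceil>\<bar>R\<bar>\<rceil>"]
    proof eventually_elim
      case (elim n)
      have n: "real n > R" using elim by linarith
      have "norm (I k 1 n - I k 0 n) \<le> 2 * (\<epsilon>' * exp (\<bar>k\<bar> * S)) * S"
        unfolding I_def
      proof (rule strip_function.scaled_integral_difference_le[OF sf P _ S])
        fix x y assume x: "x = - real n \<or> x = real n" and y: "0 < y" "y < H x"
        have "norm (f (Complex x y)) \<le> \<epsilon>'" using x y n by (intro R) (auto simp: below_graph_def)
        moreover have "norm (exp (- \<i> * of_real k * Complex x y)) \<le> exp (\<bar>k\<bar> * S)"
          using y S[of x] by (intro norm_exp_strip_le) auto
        ultimately show "norm (fk k (Complex x y)) \<le> \<epsilon>' * exp (\<bar>k\<bar> * S)"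
          unfolding fk_def norm_mult using \<epsilon>' by (intro mult_mono) auto
      qed auto
      also have "2 * (\<epsilon>' * exp (\<bar>k\<bar> * S)) * S = \<epsilon>" using Spos by (simp add: \<epsilon>'_def field_simps)
      finally show ?case .
    qed
  qed
  have real_f: "cnj (f (Complex x 0)) = f (Complex x 0)" for x using bottom[of x] by (simp add: complex_eq_iff)
  have integrable: "strip_function.scaled_integrand H a (fk k) s integrable_on {- real n..real n}" if "0 \<le> s" "s \<le> 1" for k s n
    using strip_function.scaled_integrand_continuous_snd[OF sf that] by (rule integrable_continuous_real)
  have cnj_exp: "cnj (exp (- \<i> * of_real (- k) * z)) = exp (- \<i> * of_real k * cnj z)" for k z
    by (simp add: exp_cnj)
  have bot: "cnj (I (- k) 0 n) = I k 0 n" for n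
  proof -
    have "cnj (fk (- k) (Complex x 0)) = fk k (Complex x 0)" for x
    proof -
      have "cnj (Complex x 0) = Complex x 0" by (simp add: complex_eq_iff)
      then show ?thesis unfolding fk_def complex_cnj_mult cnj_exp real_f by simp
    qed
    moreover have "Complex 1 0 = 1" by (simp add: complex_eq_iff)
    ultimately show ?thesis
      by (simp add: I_def scaled[abs_def] Henstock_Kurzweil_Integration.integral_cnj)
  qed
  have top_eq: "integral {- real n..real n} (\<lambda>x. modes H G k x) = I k 1 n - cnj (I (- k) 1 n)" for n
  proof -
    have 1: "strip_function.scaled_integrand H a (fk k) 1 x = exp (- \<i> * of_real k * graph H x) * G x" for k x
      using top[of x] by (simp add: scaled fk_def graph_def mult_ac)
    have 2: "cnj (strip_function.scaled_integrand H a (fk (- k)) 1 x) = exp (- \<i> * of_real k * cnj (graph H x)) * cnj (G x)" for x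
      unfolding 1 complex_cnj_mult cnj_exp ..
    show ?thesis
      unfolding I_def 1[of k, symmetric] 2[symmetric] Henstock_Kurzweil_Integration.integral_cnj
      by (intro Henstock_Kurzweil_Integration.integral_diff) (auto simp: integrable_on_cnj_iff intro: integrable)
  qed
  fix \<epsilon> :: real assume "\<epsilon> > 0"
  then have "\<epsilon>/2 > 0" by simp
  from small[OF this, of k] small[OF this, of "- k"]
  show "\<forall>\<^sub>F n in sequentially. norm (integral {- real n..real n} (\<lambda>x. modes H G k x)) \<le> \<epsilon>"
  proof eventually_elim
    case (elim n)
    have "I k 1 n - cnj (I (- k) 1 n) = (I k 1 n - I k 0 n) - cnj (I (- k) 1 n - I (- k) 0 n)"
      by (simp add: bot)
    then have "norm (I k 1 n - cnj (I (- k) 1 n)) \<le> norm (I k 1 n - I k 0 n) + norm (cnj (I (- k) 1 n - I (- k) 0 n))"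
      by (metis norm_triangle_ineq4)
    then show ?case using elim unfolding top_eq complex_mod_cnj by linarith
  qed
qed

section \<open>The potential at a fixed time\<close>

context channel
begin

text \<open>Defined by the surface formula rather than the Cauchy integral, hence meaningful and
  continuous on the closed strip whether or not the nonlocal equation holds. That equation enters
  only when the two are identified below the surface.\<close>

definition bulk_field :: "complex \<Rightarrow> complex" where
  "bulk_field z = surface_field H a G (Re z) (H (Re z) - Im z)"

lemma bulk_field_top: "bulk_field (Complex x (H x)) = G x / Complex 1 (a x)"
  by (simp add: bulk_field_def surface_field_def bottom_term_def[abs_def] top_term_def[abs_def])

lemma tendsto_continuous_UNIV:
  fixes u :: "real \<Rightarrow> 'b::t2_space"
  shows "continuous_on UNIV u \<Longrightarrow> xn \<longlonglongrightarrow> x \<Longrightarrow> (\<lambda>n. u (xn n)) \<longlonglongrightarrow> u x"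
  by (rule isCont_tendsto_compose) (auto simp: continuous_on_eq_continuous_at)

lemma bulk_field_continuous: "continuous_on (below_graph H) bulk_field"
  unfolding continuous_on_sequentially o_def
proof safe
  fix un u assume un: "\<forall>n. un n \<in> below_graph H" and lim: "un \<longlonglongrightarrow> u"
  have Re: "(\<lambda>n. Re (un n)) \<longlonglongrightarrow> Re u" and Im: "(\<lambda>n. Im (un n)) \<longlonglongrightarrow> Im u"
    using lim by (auto intro: tendsto_intros)
  show "(\<lambda>n. bulk_field (un n)) \<longlonglongrightarrow> bulk_field u"
    unfolding bulk_field_def
  proof (rule surface_field_tendsto)
    show "channel H a G m S L B" "channel H a G m S L B" by unfold_locales
    show "(\<lambda>n. H (Re (un n)) - Im (un n)) \<longlonglongrightarrow> H (Re u) - Im u"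
      by (intro tendsto_diff tendsto_continuous_UNIV[OF H_cont] Re Im)
    show "0 \<le> H (Re (un n)) - Im (un n)" "H (Re (un n)) - Im (un n) \<le> H (Re (un n))" for n
      using un by (auto simp: below_graph_def)
  qed (use tendsto_continuous_UNIV H_cont a_cont G_cont Re in blast)+
qed

lemma bulk_strip_function: "strip_function H a bulk_field"
  by unfold_locales (use H_deriv a_cont H_pos bulk_field_continuous in auto)

lemma bulk_field_eq_cauchy:
  assumes vanish: "\<And>z. H (Re z) < Im z \<Longrightarrow> cauchy H G z = 0"
    and z: "0 \<le> Im z" "Im z < H (Re z)"
  shows "bulk_field z = cauchy H G z"
proof -
  have "cauchy H G (Complex (Re z) (H (Re z) - (H (Re z) - Im z))) = surface_field H a G (Re z) (H (Re z) - Im z)"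
    using z by (intro cauchy_eq_surface_field vanish) auto
  then show ?thesis by (simp add: bulk_field_def)
qed

lemma bulk_field_decays:
  assumes G: "(G \<longlongrightarrow> 0) at_infinity" and \<epsilon>: "\<epsilon> > 0"
  shows "\<exists>R. \<forall>z\<in>below_graph H. \<bar>Re z\<bar> > R \<longrightarrow> norm (bulk_field z) < \<epsilon>"
proof (rule ccontr)
  assume "\<not> ?thesis"
  then have "\<forall>n. \<exists>z. z \<in> below_graph H \<and> \<bar>Re z\<bar> > real n \<and> \<not> norm (bulk_field z) < \<epsilon>"
    by blast
  then obtain zn where zn: "\<And>n. zn n \<in> below_graph H" "\<And>n. \<bar>Re (zn n)\<bar> > real n" "\<And>n. \<not> norm (bulk_field (zn n)) < \<epsilon>"
    by metis
  have "filterlim (\<lambda>n. norm (Re (zn n))) at_top sequentially"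
    by (rule filterlim_at_top_mono[OF filterlim_real_sequentially always_eventually]) (use zn(2) less_imp_le in auto)
  then have "filterlim (\<lambda>n. Re (zn n)) at_infinity sequentially" by (rule filterlim_norm_at_top_imp_at_infinity)
  then have "(\<lambda>n. bulk_field (zn n)) \<longlonglongrightarrow> 0"
    unfolding bulk_field_def using zn(1) by (intro surface_field_decays[OF G]) (auto simp: below_graph_def)
  then have "\<forall>\<^sub>F n in sequentially. norm (bulk_field (zn n)) < \<epsilon>"
    using \<epsilon> by (auto simp: tendsto_iff)
  then obtain n where "norm (bulk_field (zn n)) < \<epsilon>" by (auto simp: eventually_sequentially)
  with zn(3) show False by blast
qed

text \<open>The imaginary part of the field stands for minus the vertical velocity, so adding this
  integral to the trace continues the potential from the surface down to height
  \<open>y\<close>.\<close>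

definition vertical_integral :: "real \<Rightarrow> real \<Rightarrow> real" where
  "vertical_integral x y = integral {y..H x} (\<lambda>\<sigma>. Im (bulk_field (Complex x \<sigma>)))"

lemma vertical_continuous:
  assumes "0 \<le> y"
  shows "continuous_on {y..H x} (\<lambda>\<sigma>. Im (bulk_field (Complex x \<sigma>)))"
proof -
  have "continuous_on {y..H x} (\<lambda>\<sigma>. bulk_field (Complex x \<sigma>))"
    by (rule continuous_on_compose2[OF bulk_field_continuous])
       (use assms in \<open>auto simp: below_graph_def Complex_eq intro!: continuous_intros\<close>)
  then show ?thesis by (intro continuous_intros)
qed

text \<open>On each vertical line both sides have the same derivative, so they differ by a function
  of \<open>x\<close>. Comparing increments along the surface shows that this function is constant.
  The primitive is taken on the doubled fluid, so the bottom counts as interior.\<close>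

lemma potential_eq_Re_primitive:
  assumes vanish: "\<And>z. H (Re z) < Im z \<Longrightarrow> cauchy H G z = 0"
    and \<xi>: "\<And>x. (\<xi> has_real_derivative Re (G x)) (at x)"
  obtains P C where
    "\<And>z. - H (Re z) < Im z \<Longrightarrow> Im z < H (Re z) \<Longrightarrow> (P has_field_derivative cauchy H G z) (at z)"
    "\<And>x y. 0 \<le> y \<Longrightarrow> y < H x \<Longrightarrow> \<xi> x + vertical_integral x y = Re (P (Complex x y)) + C"
proof -
  interpret sf: strip_function H a bulk_field by (rule bulk_strip_function)
  have "cauchy H G field_differentiable at z within V" if "- H (Re z) < Im z" "Im z < H (Re z)" for z V
    using cauchy_field_differentiable_below[OF that] by (rule field_differentiable_at_within)
  then have "cauchy H G holomorphic_on {z. (- 1) * H (Re z) < Im z \<and> Im z < H (Re z)}"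
    by (auto simp: holomorphic_on_def)
  then obtain P where "\<And>z. (- 1) * H (Re z) < Im z \<Longrightarrow> Im z < H (Re z) \<Longrightarrow> (P has_field_derivative cauchy H G z) (at z)"
    using primitive_between_graphs[OF H_cont H_pos] by blast
  then have P: "(P has_field_derivative cauchy H G z) (at z)" if "- H (Re z) < Im z" "Im z < H (Re z)" for z
    using that by simp
  have P': "(P has_field_derivative bulk_field z) (at z)" if "0 \<le> Im z" "Im z < H (Re z)" for z
    using P[of z] bulk_field_eq_cauchy[OF vanish that] that H_pos[of "Re z"] by simp
  \<comment> \<open>This will be the limit of \<open>Re P\<close> at the surface point above
    \<open>x\<close>; \<open>P\<close> has its derivative only strictly below the surface, so the
    value is expressed through the bottom and the continuous vertical integral.\<close>
  define \<l> where "\<l> x = Re (P (Complex x 0)) - vertical_integral x 0" for x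
  have vert: "Re (P (Complex x y)) - vertical_integral x y = \<l> x" if y: "0 \<le> y" "y < H x" for x y
  proof -
    have "((\<lambda>\<sigma>. - Im (bulk_field (Complex x \<sigma>))) has_integral (Re (P (Complex x y)) - Re (P (Complex x 0)))) {0..y}"
    proof (rule fundamental_theorem_of_calculus[OF y(1)])
      fix \<sigma> assume \<sigma>: "\<sigma> \<in> {0..y}"
      have "((\<lambda>\<sigma>. of_real x + \<i> * of_real \<sigma>) has_vector_derivative \<i>) (at \<sigma>)"
        by (auto intro!: derivative_eq_intros)
      then have "((\<lambda>\<sigma>. Complex x \<sigma>) has_vector_derivative \<i>) (at \<sigma>)" by (simp add: Complex_eq)
      moreover have "(P has_field_derivative bulk_field (Complex x \<sigma>)) (at (Complex x \<sigma>))"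
        using \<sigma> y by (intro P') auto
      ultimately have "((P \<circ> (\<lambda>\<sigma>. Complex x \<sigma>)) has_vector_derivative \<i> * bulk_field (Complex x \<sigma>)) (at \<sigma>)"
        by (rule field_vector_diff_chain_at)
      then have "((\<lambda>\<sigma>. Re ((P \<circ> (\<lambda>\<sigma>. Complex x \<sigma>)) \<sigma>)) has_vector_derivative Re (\<i> * bulk_field (Complex x \<sigma>))) (at \<sigma>)"
        by (rule bounded_linear.has_vector_derivative[OF bounded_linear_Re])
      then show "((\<lambda>\<sigma>. Re (P (Complex x \<sigma>))) has_vector_derivative - Im (bulk_field (Complex x \<sigma>))) (at \<sigma> within {0..y})"
        by (simp add: o_def has_vector_derivative_at_within)
    qed
    from integral_unique[OF has_integral_neg[OF this]]
    have "integral {0..y} (\<lambda>\<sigma>. Im (bulk_field (Complex x \<sigma>))) = - (Re (P (Complex x y)) - Re (P (Complex x 0)))"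
      by simp
    moreover have "integral {0..y} (\<lambda>\<sigma>. Im (bulk_field (Complex x \<sigma>))) + vertical_integral x y = vertical_integral x 0"
      unfolding vertical_integral_def using y
      by (intro Henstock_Kurzweil_Integration.integral_combine integrable_continuous_real vertical_continuous) auto
    ultimately show ?thesis unfolding \<l>_def by simp
  qed
  have lim: "((\<lambda>s. Re (P (Complex x (s * H x)))) \<longlongrightarrow> \<l> x) (at_left 1)" for x
  proof -
    have "continuous_on {0..H x} (\<lambda>y. vertical_integral x y)"
      unfolding vertical_integral_def
      by (intro indefinite_integral_continuous_1' integrable_continuous_real vertical_continuous) auto
    then have c: "continuous_on {0..1} (\<lambda>s. vertical_integral x (s * H x))"
      by (rule continuous_on_compose2)
         (use H_pos[of x] in \<open>auto intro!: continuous_intros simp: mult_left_le_one_le\<close>)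
    have v0: "vertical_integral x (1 * H x) = 0" by (simp add: vertical_integral_def)
    have "((\<lambda>s. vertical_integral x (s * H x)) \<longlongrightarrow> 0) (at_left 1)"
      using continuous_on_Icc_at_leftD[OF c] unfolding v0 by simp
    then have "((\<lambda>s. \<l> x + vertical_integral x (s * H x)) \<longlongrightarrow> \<l> x + 0) (at_left 1)"
      by (intro tendsto_add tendsto_const)
    moreover have "\<forall>\<^sub>F s in at_left 1. \<l> x + vertical_integral x (s * H x) = Re (P (Complex x (s * H x)))"
      using eventually_at_left_real[of 0 "1::real", OF zero_less_one]
    proof eventually_elim
      case (elim s)
      then show ?case using vert[of "s * H x" x] H_pos[of x] by (simp add: mult_less_cancel_right2)
    qed
    ultimately have "((\<lambda>s. Re (P (Complex x (s * H x)))) \<longlongrightarrow> \<l> x + 0) (at_left 1)"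
      by (rule Lim_transform_eventually)
    then show ?thesis by simp
  qed
  have top1: "sf.scaled_integrand 1 x = G x" for x
    by (simp add: sf.scaled_integrand_def bulk_field_top)
  \<comment> \<open>As \<open>s\<close> tends to 1, the contour integral over the scaled graph tends
    to the integral of \<open>G\<close>, whose real part is the increment of \<open>\<xi>\<close>.
    Through the primitive, the same limit is the increment of \<open>\<l>\<close>.\<close>
  have const: "\<xi> \<beta> - \<l> \<beta> = \<xi> \<alpha> - \<l> \<alpha>" if "\<alpha> \<le> \<beta>" for \<alpha> \<beta>
  proof -
    let ?I = "\<lambda>s. integral {\<alpha>..\<beta>} (sf.scaled_integrand s)"
    have "((\<lambda>s. Re (?I s)) \<longlongrightarrow> Re (?I 1)) (at_left 1)"
      using continuous_on_Icc_at_leftD[OF sf.scaled_integral_continuous] by (intro tendsto_intros) simp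
    moreover have "\<forall>\<^sub>F s in at_left 1. Re (?I s) = Re (P (Complex \<beta> (s * H \<beta>))) - Re (P (Complex \<alpha> (s * H \<alpha>)))"
      using eventually_at_left_real[of 0 "1::real", OF zero_less_one]
    proof eventually_elim
      case (elim s)
      then show ?case using sf.scaled_integral_eq[OF P' _ _ that, of s] by simp
    qed
    ultimately have "((\<lambda>s. Re (P (Complex \<beta> (s * H \<beta>))) - Re (P (Complex \<alpha> (s * H \<alpha>)))) \<longlongrightarrow> Re (?I 1)) (at_left 1)"
      by (rule Lim_transform_eventually)
    moreover have "((\<lambda>s. Re (P (Complex \<beta> (s * H \<beta>))) - Re (P (Complex \<alpha> (s * H \<alpha>)))) \<longlongrightarrow> \<l> \<beta> - \<l> \<alpha>) (at_left 1)"
      by (intro tendsto_diff lim)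
    ultimately have "Re (?I 1) = \<l> \<beta> - \<l> \<alpha>"
      using tendsto_unique trivial_limit_at_left_real by blast
    moreover have "Re (?I 1) = \<xi> \<beta> - \<xi> \<alpha>"
    proof -
      have G: "sf.scaled_integrand 1 = G" using top1 by (rule ext)
      have "G integrable_on {\<alpha>..\<beta>}" by (intro integrable_continuous_real continuous_on_subset[OF G_cont]) simp
      then have "Re (integral {\<alpha>..\<beta>} G) = integral {\<alpha>..\<beta>} (\<lambda>x. Re (G x))"
        using integral_linear[OF _ bounded_linear_Re, of G] by (simp add: o_def)
      moreover have "((\<lambda>x. Re (G x)) has_integral (\<xi> \<beta> - \<xi> \<alpha>)) {\<alpha>..\<beta>}"
        by (rule fundamental_theorem_of_calculus[OF that], rule has_vector_derivative_at_within)
           (use \<xi> in \<open>simp add: has_real_derivative_iff_has_vector_derivative\<close>)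
      ultimately show ?thesis unfolding G by (simp add: integral_unique)
    qed
    ultimately show ?thesis by linarith
  qed
  have C: "\<xi> x - \<l> x = \<xi> 0 - \<l> 0" for x
  proof (cases "x \<le> 0")
    case True show ?thesis by (rule const[OF True, symmetric])
  next
    case False show ?thesis by (rule const) (use False in simp)
  qed
  show thesis
  proof (rule that[OF P])
    show "\<xi> x + vertical_integral x y = Re (P (Complex x y)) + (\<xi> 0 - \<l> 0)" if "0 \<le> y" "y < H x" for x y
      using C[of x] vert[OF that] by linarith
  qed
qed

end

section \<open>Derivatives on the closed fluid domain\<close>

locale surface =
  fixes h :: real and \<eta> :: "real \<times> real \<Rightarrow> real"
  assumes h_pos: "h > 0"
    and surface_above: "\<And>p. p \<in> half_plane \<Longrightarrow> - h < \<eta> p"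
    and \<eta>_C1: "C1_on half_plane \<eta>"
begin

abbreviation at_surface :: "real \<Rightarrow> real \<Rightarrow> (real \<times> real \<times> real) filter" where
  "at_surface x t \<equiv> at (x, \<eta> (x, t), t) within spacetime h \<eta>"

lemma \<eta>_above: "0 \<le> t \<Longrightarrow> - h < \<eta> (x, t)"
  by (simp add: surface_above half_plane_def)

end

section \<open>Partial derivatives of functions of x and t\<close>

lemma C1_half_plane_derivative:
  assumes "C1_on half_plane u" "0 \<le> t"
  shows "(u has_derivative (\<lambda>v. fst v * dx u (x, t) + snd v * dt u (x, t))) (at (x, t) within half_plane)"
proof -
  have d: "u differentiable (at (x, t) within half_plane)"
    using assms by (auto simp: C1_on_def differentiable_on_def half_plane_def)
  have "(\<lambda>v. dderiv half_plane v u (x, t)) = (\<lambda>v. fst v * dx u (x, t) + snd v * dt u (x, t))"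
    unfolding dx_def dt_def using dderiv_pair[OF d] by (rule ext)
  with dderiv_has_derivative[OF d] show ?thesis by (simp only:)
qed

lemma C1_half_plane_dx:
  assumes "C1_on half_plane u" "0 \<le> t"
  shows "((\<lambda>x. u (x, t)) has_real_derivative dx u (x, t)) (at x)"
proof -
  have "((\<lambda>x. (x, t)) has_derivative (\<lambda>v. (v, 0))) (at x)" by (auto intro!: derivative_eq_intros)
  moreover have "(u has_derivative (\<lambda>v. fst v * dx u (x, t) + snd v * dt u (x, t))) (at (x, t) within (\<lambda>x. (x, t)) ` UNIV)"
    by (rule has_derivative_subset[OF C1_half_plane_derivative[OF assms]]) (use assms(2) in \<open>auto simp: half_plane_def\<close>)
  ultimately have "((u \<circ> (\<lambda>x. (x, t))) has_derivative ((\<lambda>v. fst v * dx u (x, t) + snd v * dt u (x, t)) \<circ> (\<lambda>v. (v, 0)))) (at x)"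
    by (rule diff_chain_within)
  then show ?thesis by (simp add: o_def has_field_derivative_def mult_commute_abs)
qed

text \<open>Taken one-sided, forward in time, so that the initial time \<open>t = 0\<close> is
  included.\<close>

lemma C1_half_plane_dt:
  assumes "C1_on half_plane u" "0 \<le> t"
  shows "((\<lambda>s. u (x, t + s)) has_vector_derivative dt u (x, t)) (at 0 within {0..1})"
proof -
  have "((\<lambda>s. (x, t + s)) has_derivative (\<lambda>v. (0, v))) (at 0 within {0..1})" by (auto intro!: derivative_eq_intros)
  moreover have "(u has_derivative (\<lambda>v. fst v * dx u (x, t) + snd v * dt u (x, t))) (at (x, t + 0) within (\<lambda>s. (x, t + s)) ` {0..1})"
  proof -
    have "(\<lambda>s. (x, t + s)) ` {0..1} \<subseteq> half_plane" using assms(2) by (auto simp: half_plane_def)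
    then show ?thesis using has_derivative_subset[OF C1_half_plane_derivative[OF assms]] by simp
  qed
  ultimately have "((u \<circ> (\<lambda>s. (x, t + s))) has_derivative ((\<lambda>v. fst v * dx u (x, t) + snd v * dt u (x, t)) \<circ> (\<lambda>v. (0, v)))) (at 0 within {0..1})"
    by (rule diff_chain_within)
  then show ?thesis by (simp add: o_def has_vector_derivative_def)
qed

section \<open>Derivatives of the potential and of its trace\<close>

context surface
begin

lemma linear_pair_eqI:
  fixes D D' :: "real \<times> real \<Rightarrow> real"
  assumes "linear D" "linear D'" "D (1, c) = D' (1, c)" "D (0, d) = D' (0, d)" "d \<noteq> 0"
  shows "D = D'"
proof
  fix v :: "real \<times> real"
  have v: "v = fst v *\<^sub>R (1, c) + ((snd v - c * fst v) / d) *\<^sub>R (0, d)"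
    using assms(5) by (simp add: prod_eq_iff)
  have "E v = fst v *\<^sub>R E (1, c) + ((snd v - c * fst v) / d) *\<^sub>R E (0, d)" if "linear E" for E :: "real \<times> real \<Rightarrow> real"
    by (subst v) (simp only: linear_add[OF that] linear_scale[OF that])
  then show "D v = D' v" using assms by metis
qed

text \<open>A derivative is determined along the velocity of any curve that starts at the point and
  stays in the domain. Through every point, boundary included, there are two with independent
  velocities: the curve of constant relative height \<open>\<theta>\<close>, parallel to the surface
  in scaled coordinates, and a vertical segment.\<close>

lemma closed_fluid_derivative_unique:
  fixes u :: "real \<times> real \<Rightarrow> real"
  assumes t: "0 \<le> t" and p: "(x, y) \<in> closed_fluid h \<eta> t"
    and D: "(u has_derivative D) (at (x, y) within closed_fluid h \<eta> t)"
      "(u has_derivative D') (at (x, y) within closed_fluid h \<eta> t)"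
  shows "D = D'"
proof -
  define H where "H x = \<eta> (x, t) + h" for x
  have H: "0 < H x" for x using \<eta>_above[OF t, of x] by (simp add: H_def)
  define \<theta> where "\<theta> = (y + h) / H x"
  have y: "y = \<theta> * H x - h" using H[of x] by (simp add: \<theta>_def)
  have \<theta>: "0 \<le> \<theta>" "\<theta> \<le> 1" using p H[of x] by (auto simp: \<theta>_def closed_fluid_def H_def)
  have lin: "linear D" "linear D'" using D by (auto intro: has_derivative_linear)
  have "D (1, \<theta> * dx \<eta> (x, t)) = D' (1, \<theta> * dx \<eta> (x, t))"
  proof (rule has_derivative_unique_along_curve[where c = "\<lambda>s. (x + s, \<theta> * H (x + s) - h)" and \<delta> = 1])
    have "((\<lambda>s. \<eta> (s + x, t)) has_real_derivative dx \<eta> (x, t)) (at 0)"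
      using C1_half_plane_dx[OF \<eta>_C1 t, of x] DERIV_shift[of "\<lambda>z. \<eta> (z, t)" "dx \<eta> (x, t)" 0 x] by simp
    then have "((\<lambda>s. \<eta> (x + s, t)) has_vector_derivative dx \<eta> (x, t)) (at 0)"
      by (simp add: add.commute has_real_derivative_iff_has_vector_derivative)
    then have "((\<lambda>s. (x + s, \<theta> * H (x + s) - h)) has_vector_derivative (1, \<theta> * dx \<eta> (x, t))) (at 0)"
      unfolding H_def by (auto intro!: derivative_eq_intros has_vector_derivative_Pair)
    then show "((\<lambda>s. (x + s, \<theta> * H (x + s) - h)) has_vector_derivative (1, \<theta> * dx \<eta> (x, t))) (at 0 within {0..1})"
      by (rule has_vector_derivative_at_within)
    show "(x + s, \<theta> * H (x + s) - h) \<in> closed_fluid h \<eta> t" for s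
    proof -
      have "0 \<le> \<theta> * H (x + s)" "\<theta> * H (x + s) \<le> H (x + s)"
        using \<theta> H[of "x + s"] mult_left_le_one_le[of "H (x + s)" \<theta>] by auto
      moreover have "\<eta> (x + s, t) = H (x + s) - h" by (simp add: H_def)
      ultimately show ?thesis unfolding closed_fluid_def by simp
    qed
  qed (use D y in simp_all)
  moreover obtain d where d: "d \<noteq> 0" "D (0, d) = D' (0, d)"
  proof -
    \<comment> \<open>The segment goes upwards, up to the surface, unless the point already lies on
      the surface; then it goes down to the bottom. Measured in relative height, it never leaves the
      interval from 0 to 1.\<close>
    define e where "e = (if \<theta> < 1 then 1 - \<theta> else - 1)"
    define d where "d = e * H x"
    have "D (0, d) = D' (0, d)"
    proof (rule has_derivative_unique_along_curve[where c = "\<lambda>s. (x, y + s * d)" and \<delta> = 1])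
      show "((\<lambda>s. (x, y + s * d)) has_vector_derivative (0, d)) (at 0 within {0..1})"
        by (auto intro!: derivative_eq_intros has_vector_derivative_Pair)
      fix s :: real assume s: "s \<in> {0..1}"
      have "0 \<le> \<theta> + s * e" "\<theta> + s * e \<le> 1"
        using s \<theta> mult_left_le_one_le[of "1 - \<theta>" s] by (auto simp: e_def)
      then have "0 \<le> (\<theta> + s * e) * H x" 
        "(\<theta> + s * e) * H x \<le> 1 * H x"
        using H[of x] by (auto intro!: mult_right_mono simp del: mult_1)
      moreover have "(\<theta> + s * e) * H x = y + s * d + h"
        by (simp add: d_def y algebra_simps)
      moreover have "\<eta> (x, t) = H x - h" by (simp add: H_def)
      ultimately show "(x, y + s * d) \<in> closed_fluid h \<eta> t" unfolding closed_fluid_def by simp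
    qed (use D in simp_all)
    moreover have "d \<noteq> 0" using H[of x] by (auto simp: d_def e_def)
    ultimately show thesis using that by blast
  qed
  ultimately show ?thesis using linear_pair_eqI[OF lin] by blast
qed

lemma closed_fluid_dderiv:
  fixes u :: "real \<times> real \<Rightarrow> real"
  assumes "0 \<le> t" "(x, y) \<in> closed_fluid h \<eta> t"
    and "(u has_derivative D) (at (x, y) within closed_fluid h \<eta> t)"
  shows "dderiv (closed_fluid h \<eta> t) v u (x, y) = D v"
  using closed_fluid_derivative_unique[OF assms(1,2) _ assms(3)] assms(3)
    frechet_derivative_works[of u] differentiableI unfolding dderiv_def by metis

lemma at_time_derivative:
  assumes "(\<phi> has_derivative D) (at (x, y, t) within spacetime h \<eta>)" "0 \<le> t"
  shows "(at_time \<phi> t has_derivative (\<lambda>v. D (fst v, snd v, 0))) (at (x, y) within closed_fluid h \<eta> t)"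
proof -
  let ?f = "\<lambda>p. (fst p, snd p, t)"
  have "(?f has_derivative (\<lambda>v. (fst v, snd v, 0))) (at (x, y) within closed_fluid h \<eta> t)"
    by (auto intro!: derivative_eq_intros)
  moreover have "(\<phi> has_derivative D) (at (?f (x, y)) within ?f ` closed_fluid h \<eta> t)"
    unfolding fst_conv snd_conv
    by (rule has_derivative_subset[OF assms(1)]) (use assms(2) in \<open>auto simp: closed_fluid_def spacetime_def\<close>)
  ultimately have "((\<phi> \<circ> ?f) has_derivative (D \<circ> (\<lambda>v. (fst v, snd v, 0)))) (at (x, y) within closed_fluid h \<eta> t)"
    by (rule diff_chain_within)
  then show ?thesis by (simp add: o_def at_time_def case_prod_unfold)
qed

lemma surface_curve_time:
  assumes "0 \<le> t"
  shows "((\<lambda>s. (x, \<eta> (x, t + s), t + s)) has_vector_derivative (0, dt \<eta> (x, t), 1)) (at 0 within {0..1})"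
  by (intro has_vector_derivative_Pair C1_half_plane_dt[OF \<eta>_C1 assms]) (auto intro!: derivative_eq_intros)

text \<open>The time direction leaves the space-time domain when the surface sinks, so the derivative in that
  direction is recovered from the motion along the surface and the vertical direction.\<close>

lemma surface_time_derivative:
  assumes t: "0 \<le> t" and D: "(\<phi> has_derivative D) (at_surface x t)"
  shows "D (0, 0, 1) = D (0, dt \<eta> (x, t), 1) - dt \<eta> (x, t) * D (0, 1, 0)"
    and "dderiv (spacetime h \<eta>) (0, 0, 1) \<phi> (x, \<eta> (x, t), t) = D (0, 0, 1)"
proof -
  have split: "E (0, 0, 1) = E (0, dt \<eta> (x, t), 1) - dt \<eta> (x, t) * E (0, 1, 0)"
    if "(\<phi> has_derivative E) (at_surface x t)" for E
  proof -
    have lin: "linear E" using that by (rule has_derivative_linear)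
    have "(0, 0, 1) = (0, dt \<eta> (x, t), 1) - dt \<eta> (x, t) *\<^sub>R (0, 1, 0 :: real)" by (simp add: prod_eq_iff)
    then show ?thesis by (metis linear_diff[OF lin] linear_scale[OF lin] real_scaleR_def)
  qed
  show "D (0, 0, 1) = D (0, dt \<eta> (x, t), 1) - dt \<eta> (x, t) * D (0, 1, 0)" by (rule split[OF D])
  let ?E = "frechet_derivative \<phi> (at_surface x t)"
  have E: "(\<phi> has_derivative ?E) (at_surface x t)"
    using D by (auto simp: differentiable_def simp flip: frechet_derivative_works)
  have "(x, \<eta> (x, t)) \<in> closed_fluid h \<eta> t" using \<eta>_above[OF t, of x] by (simp add: closed_fluid_def)
  from closed_fluid_derivative_unique[OF t this at_time_derivative[OF E t] at_time_derivative[OF D t]]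
  have "?E (0, 1, 0) = D (0, 1, 0)" by (metis fst_conv snd_conv)
  moreover have "?E (0, dt \<eta> (x, t), 1) = D (0, dt \<eta> (x, t), 1)"
  proof (rule has_derivative_unique_along_curve[OF _ _ surface_curve_time[OF t]])
    show "(x, \<eta> (x, t + s), t + s) \<in> spacetime h \<eta>" if "s \<in> {0..1}" for s
      using that t \<eta>_above[of "t + s" x] by (simp add: spacetime_def)
  qed (use E D in auto)
  ultimately show "dderiv (spacetime h \<eta>) (0, 0, 1) \<phi> (x, \<eta> (x, t), t) = D (0, 0, 1)"
    unfolding dderiv_def split[OF E] split[OF D] by simp
qed

lemma trace_derivatives:
  assumes t: "0 \<le> t" and D: "(\<phi> has_derivative D) (at_surface x t)"
    and \<xi>: "C1_on half_plane \<xi>" and tr: "is_trace \<phi> \<eta> \<xi>"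
  shows "dx \<xi> (x, t) = pot_x h \<eta> \<phi> (x, \<eta> (x, t), t) + pot_y h \<eta> \<phi> (x, \<eta> (x, t), t) * dx \<eta> (x, t)"
    and "pot_t h \<eta> \<phi> (x, \<eta> (x, t), t) = dt \<xi> (x, t) - pot_y h \<eta> \<phi> (x, \<eta> (x, t), t) * dt \<eta> (x, t)"
proof -
  let ?y = "\<eta> (x, t)"
  have in_cf: "(x, ?y) \<in> closed_fluid h \<eta> t" using \<eta>_above[OF t, of x] by (simp add: closed_fluid_def)
  note atD = at_time_derivative[OF D t]
  have px: "pot_x h \<eta> \<phi> (x, ?y, t) = D (1, 0, 0)" and py: "pot_y h \<eta> \<phi> (x, ?y, t) = D (0, 1, 0)"
    using closed_fluid_dderiv[OF t in_cf atD] by (simp_all add: pot_x_def pot_y_def)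
  have lin: "linear D" using D by (rule has_derivative_linear)
  have "(\<lambda>z. (z, \<eta> (z, t), t)) ` UNIV \<subseteq> spacetime h \<eta>"
    using \<eta>_above[OF t] t by (auto simp: spacetime_def less_imp_le)
  then have "(\<phi> has_derivative D) (at (x, ?y, t) within (\<lambda>z. (z, \<eta> (z, t), t)) ` UNIV)"
    by (rule has_derivative_subset[OF D])
  moreover have "((\<lambda>z. (z, \<eta> (z, t), t)) has_derivative (\<lambda>v. v *\<^sub>R (1, dx \<eta> (x, t), 0))) (at x)"
  proof -
    have "((\<lambda>z. (z, \<eta> (z, t), t)) has_vector_derivative (1, dx \<eta> (x, t), 0)) (at x)"
      using C1_half_plane_dx[OF \<eta>_C1 t]
      by (intro has_vector_derivative_Pair) (auto simp: has_real_derivative_iff_has_vector_derivative)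
    then show ?thesis by (simp add: has_vector_derivative_def)
  qed
  ultimately have "((\<phi> \<circ> (\<lambda>z. (z, \<eta> (z, t), t))) has_derivative (D \<circ> (\<lambda>v. v *\<^sub>R (1, dx \<eta> (x, t), 0)))) (at x)"
    by (intro diff_chain_within)
  moreover have "\<phi> \<circ> (\<lambda>z. (z, \<eta> (z, t), t)) = (\<lambda>z. \<xi> (z, t))" using tr t by (auto simp: is_trace_def)
  moreover have "D \<circ> (\<lambda>v. v *\<^sub>R (1, dx \<eta> (x, t), 0)) = (\<lambda>v. v * D (1, dx \<eta> (x, t), 0))"
    using linear_scale[OF lin] by (simp add: o_def fun_eq_iff del: scaleR_Pair)
  ultimately have "((\<lambda>z. \<xi> (z, t)) has_real_derivative D (1, dx \<eta> (x, t), 0)) (at x)"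
    by (simp add: has_field_derivative_def mult_commute_abs)
  with C1_half_plane_dx[OF \<xi> t] have "dx \<xi> (x, t) = D (1, dx \<eta> (x, t), 0)" using DERIV_unique by blast
  also have "(1, dx \<eta> (x, t), 0) = (1, 0, 0) + dx \<eta> (x, t) *\<^sub>R (0, 1, 0 :: real)" by (simp add: prod_eq_iff)
  also have "D \<dots> = D (1, 0, 0) + dx \<eta> (x, t) * D (0, 1, 0)"
    by (simp only: linear_add[OF lin] linear_scale[OF lin] real_scaleR_def)
  finally show "dx \<xi> (x, t) = pot_x h \<eta> \<phi> (x, ?y, t) + pot_y h \<eta> \<phi> (x, ?y, t) * dx \<eta> (x, t)"
    by (simp add: px py)
  have "(\<lambda>s. (x, \<eta> (x, t + s), t + s)) ` {0..1} \<subseteq> spacetime h \<eta>"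
    using \<eta>_above[of "t + _" x] t by (auto simp: spacetime_def less_imp_le)
  then have "(\<phi> has_derivative D) (at (x, \<eta> (x, t + 0), t + 0) within (\<lambda>s. (x, \<eta> (x, t + s), t + s)) ` {0..1})"
    using has_derivative_subset[OF D] by simp
  then have "((\<phi> \<circ> (\<lambda>s. (x, \<eta> (x, t + s), t + s))) has_derivative (D \<circ> (\<lambda>v. v *\<^sub>R (0, dt \<eta> (x, t), 1)))) (at 0 within {0..1})"
    using surface_curve_time[OF t, of x] by (intro diff_chain_within) (simp_all add: has_vector_derivative_def)
  moreover have "D \<circ> (\<lambda>v. v *\<^sub>R (0, dt \<eta> (x, t), 1)) = (\<lambda>v. v *\<^sub>R D (0, dt \<eta> (x, t), 1))"
    using linear_scale[OF lin] by (simp add: o_def fun_eq_iff del: scaleR_Pair)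
  ultimately have "((\<lambda>s. \<phi> (x, \<eta> (x, t + s), t + s)) has_vector_derivative D (0, dt \<eta> (x, t), 1)) (at 0 within {0..1})"
    by (simp add: has_vector_derivative_def o_def)
  then have "((\<lambda>s. \<xi> (x, t + s)) has_vector_derivative D (0, dt \<eta> (x, t), 1)) (at 0 within {0..1})"
    by (rule has_vector_derivative_transform[rotated 2]) (use tr t in \<open>auto simp: is_trace_def\<close>)
  with C1_half_plane_dt[OF \<xi> t, of x] have "dt \<xi> (x, t) = D (0, dt \<eta> (x, t), 1)"
    using vector_derivative_unique_within[of 0 "{0..1}"] by (auto simp: trivial_limit_within islimpt_Icc)
  with surface_time_derivative[OF t D]
  show "pot_t h \<eta> \<phi> (x, ?y, t) = dt \<xi> (x, t) - pot_y h \<eta> \<phi> (x, ?y, t) * dt \<eta> (x, t)"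
    by (simp add: pot_t_def py mult.commute)
qed

end

section \<open>The nonlocal integrand in exponential form\<close>

lemma (in channel) nonlocal_integrable:
  "integrable lborel (\<lambda>x. modes H G k x)"
proof (rule Bochner_Integration.integrable_bound)
  show "integrable lborel (\<lambda>x. 2 * exp (\<bar>k\<bar> * S) * norm (G x))" using G_int by simp
  show "(\<lambda>x. modes H G k x)
      \<in> borel_measurable lborel" by measurable
  have "norm (modes H G k x)
      \<le> 2 * exp (\<bar>k\<bar> * S) * norm (G x)" for x
  proof -
    have b: "norm (exp (- \<i> * of_real k * graph H x)) \<le> exp (\<bar>k\<bar> * S)"
      "norm (exp (- \<i> * of_real (- k) * graph H x)) \<le> exp (\<bar>- k\<bar> * S)"
      using H_pos[of x] H_le[of x] by (intro norm_exp_strip_le; simp add: graph_def)+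
    have "norm (exp (- \<i> * of_real k * cnj (graph H x))) = norm (cnj (exp (- \<i> * of_real (- k) * graph H x)))"
      by (simp add: exp_cnj)
    then have "norm (exp (- \<i> * of_real k * cnj (graph H x))) \<le> exp (\<bar>k\<bar> * S)"
      using b(2) unfolding complex_mod_cnj by simp
    then have "norm (exp (- \<i> * of_real k * graph H x) * G x) + norm (exp (- \<i> * of_real k * cnj (graph H x)) * cnj (G x))
        \<le> exp (\<bar>k\<bar> * S) * norm (G x) + exp (\<bar>k\<bar> * S) * norm (G x)"
      unfolding norm_mult complex_mod_cnj by (intro add_mono mult_right_mono b(1)) auto
    then show ?thesis
      using norm_triangle_ineq4[of "exp (- \<i> * of_real k * graph H x) * G x"
          "exp (- \<i> * of_real k * cnj (graph H x)) * cnj (G x)"] by linarith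
  qed
  then show "AE x in lborel. norm (modes H G k x)
      \<le> norm (2 * exp (\<bar>k\<bar> * S) * norm (G x))" by simp
qed

lemma nonlocal_integrand_eq:
  fixes A \<psi> H k x :: real
  shows "exp (- \<i> * of_real (k * x)) * (of_real (A * sinh (k * H)) - \<i> * of_real (\<psi> * cosh (k * H))) =
    (1/2) * (exp (- \<i> * of_real k * Complex x H) * Complex A (- \<psi>)
      - exp (- \<i> * of_real k * cnj (Complex x H)) * cnj (Complex A (- \<psi>)))"
proof -
  have "- \<i> * of_real k * Complex x H = - \<i> * of_real (k * x) + of_real (k * H)"
    "- \<i> * of_real k * cnj (Complex x H) = - \<i> * of_real (k * x) + of_real (- (k * H))"
    by (simp_all add: complex_eq_iff)
  then have e: "exp (- \<i> * of_real k * Complex x H) = exp (- \<i> * of_real (k * x)) * of_real (exp (k * H))"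
    "exp (- \<i> * of_real k * cnj (Complex x H)) = exp (- \<i> * of_real (k * x)) * of_real (exp (- (k * H)))"
    by (simp_all only: exp_add exp_of_real)
  have c: "Complex A (- \<psi>) = of_real A - \<i> * of_real \<psi>" "cnj (Complex A (- \<psi>)) = of_real A + \<i> * of_real \<psi>"
    by (simp_all add: complex_eq_iff)
  have s: "of_real (A * sinh (k * H)) = of_real A * (of_real (exp (k * H)) - of_real (exp (- (k * H)))) / (2 :: complex)"
    "of_real (\<psi> * cosh (k * H)) = of_real \<psi> * (of_real (exp (k * H)) + of_real (exp (- (k * H)))) / (2 :: complex)"
    by (simp_all add: sinh_def cosh_def)
  show ?thesis unfolding e c s by (simp add: field_simps)
qed

section \<open>Decaying functions\<close>

lemma half_plane_tendsto:
  assumes "continuous_on half_plane u" "xn \<longlonglongrightarrow> x" "tn \<longlonglongrightarrow> t" "\<And>n. 0 \<le> tn n"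
  shows "(\<lambda>n. u (xn n, tn n)) \<longlonglongrightarrow> u (x, t)"
proof -
  have "0 \<le> t" using assms(3,4) by (intro LIMSEQ_le_const) auto
  moreover have "(\<lambda>n. (xn n, tn n)) \<longlonglongrightarrow> (x, t)" using assms(2,3) by (rule tendsto_Pair)
  ultimately show ?thesis
    using assms(4) by (intro continuous_on_tendsto_compose[OF assms(1)]) (auto simp: half_plane_def)
qed

lemma half_plane_section_continuous:
  assumes "continuous_on half_plane u" "0 \<le> t"
  shows "continuous_on A (\<lambda>x. u (x, t))"
  by (rule continuous_on_compose2[OF assms(1)]) (use assms(2) in \<open>auto simp: half_plane_def intro!: continuous_intros\<close>)

lemma decaying_dominated:
  assumes "decaying u" "0 \<le> T"
  obtains M where "integrable lborel M" "(M \<longlongrightarrow> 0) at_infinity" "\<And>x t. t \<in> {0..T} \<Longrightarrow> \<bar>u (x, t)\<bar> \<le> M x"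
proof -
  obtain M where M: "integrable lborel M" "(M \<longlongrightarrow> 0) at_infinity" "\<forall>x. \<forall>t\<in>{0..T}. \<bar>u (x, t)\<bar> \<le> M x"
    using assms(1)[unfolded decaying_def, rule_format, OF assms(2)] by (elim exE conjE)
  show thesis by (rule that[OF M(1,2)]) (use M(3) in simp)
qed

lemma decaying_small_outside:
  assumes "decaying u" "0 \<le> T" "\<epsilon> > 0"
  obtains R where "R \<ge> 0" "\<And>x t. t \<in> {0..T} \<Longrightarrow> R \<le> \<bar>x\<bar> \<Longrightarrow> \<bar>u (x, t)\<bar> < \<epsilon>"
proof -
  obtain M where int: "integrable lborel M"
    and M: "(M \<longlongrightarrow> 0) at_infinity" "\<And>x t. t \<in> {0..T} \<Longrightarrow> \<bar>u (x, t)\<bar> \<le> M x"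
    by (rule decaying_dominated[OF assms(1,2)]) (rule that)
  have "\<forall>\<^sub>F x in at_infinity. M x < \<epsilon>" using order_tendstoD(2)[OF M(1) assms(3)] .
  then obtain b where b: "\<And>x. b \<le> norm x \<Longrightarrow> M x < \<epsilon>" by (auto simp: eventually_at_infinity)
  show thesis
  proof (rule that[of "max b 0"])
    show "\<bar>u (x, t)\<bar> < \<epsilon>" if "t \<in> {0..T}" "max b 0 \<le> \<bar>x\<bar>" for x t
      using M(2)[OF that(1), of x] b[of x] that(2) by simp
  qed simp
qed

lemma compact_time_slab: "compact ({- R..R::real} \<times> {0..T::real})" "{- R..R} \<times> {0..T} \<subseteq> half_plane"
  by (auto simp: half_plane_def intro!: compact_Times)

text \<open>The integrable majorant in \<open>decaying\<close> may itself be unbounded. Its limit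
  gives a bound only for large \<open>\<bar>x\<bar>\<close>; on the remaining compact slab
  continuity supplies one.\<close>

lemma decaying_bounded:
  assumes "decaying u" "continuous_on half_plane u" "0 \<le> T"
  obtains K where "K \<ge> 0" "\<And>x t. t \<in> {0..T} \<Longrightarrow> \<bar>u (x, t)\<bar> \<le> K"
proof -
  obtain R where "R \<ge> 0" and R: "\<And>x t. t \<in> {0..T} \<Longrightarrow> R \<le> \<bar>x\<bar> \<Longrightarrow> \<bar>u (x, t)\<bar> < 1"
    by (rule decaying_small_outside[OF assms(1,3) zero_less_one]) (rule that)
  have "bounded (u ` ({- R..R} \<times> {0..T}))"
    by (intro compact_imp_bounded compact_continuous_image continuous_on_subset[OF assms(2)] compact_time_slab)
  then obtain K where "\<forall>v\<in>u ` ({- R..R} \<times> {0..T}). norm v \<le> K" unfolding bounded_iff ..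
  then have K: "\<bar>u p\<bar> \<le> K" if "p \<in> {- R..R} \<times> {0..T}" for p
    using that unfolding real_norm_def by blast
  show thesis
  proof (rule that[of "max K 1"])
    show "\<bar>u (x, t)\<bar> \<le> max K 1" if t: "t \<in> {0..T}" for x t
    proof (cases "R \<le> \<bar>x\<bar>")
      case True then show ?thesis using R[OF t, of x] by simp
    next
      case False
      then have "(x, t) \<in> {- R..R} \<times> {0..T}" using t by auto
      from K[OF this] show ?thesis by simp
    qed
  qed simp
qed

section \<open>The family of channels\<close>

locale surface_data = surface h \<eta> for h \<eta> +
  fixes \<xi> :: "real \<times> real \<Rightarrow> real" and \<gamma> :: real
  assumes \<xi>_C1: "C1_on half_plane \<xi>"
    and decay: "decaying \<eta>" "decaying (dx \<eta>)" "decaying (dt \<eta>)" "decaying (dx \<xi>)"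
begin

definition depth :: "real \<Rightarrow> real \<Rightarrow> real" where "depth t x = \<eta> (x, t) + h"

definition slope :: "real \<Rightarrow> real \<Rightarrow> real" where "slope t x = dx \<eta> (x, t)"

text \<open>The boundary value of the field times the tangent vector of the surface.\<close>

definition data :: "real \<Rightarrow> real \<Rightarrow> complex" where
  "data t x = Complex (dx \<xi> (x, t)) (- (dt \<eta> (x, t) - \<gamma> * \<eta> (x, t) * dx \<eta> (x, t)))"

abbreviation channel_at_time :: "real \<Rightarrow> real \<Rightarrow> real \<Rightarrow> real \<Rightarrow> real \<Rightarrow> bool" where
  "channel_at_time t \<equiv> channel (depth t) (slope t) (data t)"

lemma continuous_derivatives:
  "continuous_on half_plane \<eta>" "continuous_on half_plane (dx \<eta>)" "continuous_on half_plane (dt \<eta>)"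
  "continuous_on half_plane (dx \<xi>)"
  using \<eta>_C1 \<xi>_C1 by (auto simp: C1_on_def dx_def dt_def differentiable_imp_continuous_on)

lemma norm_data_le:
  "norm (data t x) \<le> \<bar>dx \<xi> (x, t)\<bar> + (\<bar>dt \<eta> (x, t)\<bar> + \<bar>\<gamma>\<bar> * (\<bar>\<eta> (x, t)\<bar> * \<bar>dx \<eta> (x, t)\<bar>))"
proof -
  have "\<bar>dt \<eta> (x, t) - \<gamma> * \<eta> (x, t) * dx \<eta> (x, t)\<bar> \<le> \<bar>dt \<eta> (x, t)\<bar> + \<bar>\<gamma>\<bar> * (\<bar>\<eta> (x, t)\<bar> * \<bar>dx \<eta> (x, t)\<bar>)"
    using abs_triangle_ineq4[of "dt \<eta> (x, t)" "\<gamma> * \<eta> (x, t) * dx \<eta> (x, t)"] by (simp add: abs_mult mult.assoc)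
  then show ?thesis
    using norm_Complex_le[of "dx \<xi> (x, t)" "- (dt \<eta> (x, t) - \<gamma> * \<eta> (x, t) * dx \<eta> (x, t))"]
    unfolding data_def abs_minus_cancel by linarith
qed

text \<open>In the product of \<open>\<eta>\<close> and \<open>dx \<eta>\<close> one factor is
  bounded and the other has an integrable majorant tending to 0, so the product inherits such a
  majorant.\<close>

lemma data_dominated:
  assumes T: "0 \<le> T"
  obtains M B where "integrable lborel M" "(M \<longlongrightarrow> 0) at_infinity"
    "\<And>x t. t \<in> {0..T} \<Longrightarrow> norm (data t x) \<le> M x" "\<And>x t. t \<in> {0..T} \<Longrightarrow> norm (data t x) \<le> B"
proof -
  obtain K where K: "K \<ge> 0" "\<And>x t. t \<in> {0..T} \<Longrightarrow> \<bar>\<eta> (x, t)\<bar> \<le> K"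
    by (rule decaying_bounded[OF decay(1) continuous_derivatives(1) T]) (rule that)
  obtain K1 where "K1 \<ge> 0" and K1: "\<And>x t. t \<in> {0..T} \<Longrightarrow> \<bar>dx \<eta> (x, t)\<bar> \<le> K1"
    by (rule decaying_bounded[OF decay(2) continuous_derivatives(2) T]) (rule that)
  obtain K2 where "K2 \<ge> 0" and K2: "\<And>x t. t \<in> {0..T} \<Longrightarrow> \<bar>dt \<eta> (x, t)\<bar> \<le> K2"
    by (rule decaying_bounded[OF decay(3) continuous_derivatives(3) T]) (rule that)
  obtain K3 where "K3 \<ge> 0" and K3: "\<And>x t. t \<in> {0..T} \<Longrightarrow> \<bar>dx \<xi> (x, t)\<bar> \<le> K3"
    by (rule decaying_bounded[OF decay(4) continuous_derivatives(4) T]) (rule that)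
  obtain M1 where M1: "integrable lborel M1" "(M1 \<longlongrightarrow> 0) at_infinity" "\<And>x t. t \<in> {0..T} \<Longrightarrow> \<bar>dx \<eta> (x, t)\<bar> \<le> M1 x"
    by (rule decaying_dominated[OF decay(2) T]) (rule that)
  obtain M2 where M2: "integrable lborel M2" "(M2 \<longlongrightarrow> 0) at_infinity" "\<And>x t. t \<in> {0..T} \<Longrightarrow> \<bar>dt \<eta> (x, t)\<bar> \<le> M2 x"
    by (rule decaying_dominated[OF decay(3) T]) (rule that)
  obtain M3 where M3: "integrable lborel M3" "(M3 \<longlongrightarrow> 0) at_infinity" "\<And>x t. t \<in> {0..T} \<Longrightarrow> \<bar>dx \<xi> (x, t)\<bar> \<le> M3 x"
    by (rule decaying_dominated[OF decay(4) T]) (rule that)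
  show thesis
  proof (rule that[of "\<lambda>x. M3 x + (M2 x + \<bar>\<gamma>\<bar> * (K * M1 x))" "K3 + (K2 + \<bar>\<gamma>\<bar> * (K * K1))"])
    show "integrable lborel (\<lambda>x. M3 x + (M2 x + \<bar>\<gamma>\<bar> * (K * M1 x)))"
      by (intro Bochner_Integration.integrable_add integrable_mult_right M1 M2 M3)
    have "((\<lambda>x. M3 x + (M2 x + \<bar>\<gamma>\<bar> * (K * M1 x))) \<longlongrightarrow> 0 + (0 + \<bar>\<gamma>\<bar> * (K * 0))) at_infinity"
      by (intro tendsto_intros M1 M2 M3)
    then show "((\<lambda>x. M3 x + (M2 x + \<bar>\<gamma>\<bar> * (K * M1 x))) \<longlongrightarrow> 0) at_infinity" by simp
    show "norm (data t x) \<le> M3 x + (M2 x + \<bar>\<gamma>\<bar> * (K * M1 x))" if "t \<in> {0..T}" for x t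
      by (rule order_trans[OF norm_data_le])
         (intro add_mono mult_left_mono mult_mono M1(3) M2(3) M3(3) K(2) that K(1) abs_ge_zero)
    show "norm (data t x) \<le> K3 + (K2 + \<bar>\<gamma>\<bar> * (K * K1))" if "t \<in> {0..T}" for x t
      by (rule order_trans[OF norm_data_le])
         (intro add_mono mult_left_mono mult_mono K1 K2 K3 K(2) that K(1) abs_ge_zero)
  qed
qed

text \<open>One set of constants for a whole time interval is what lets the limit in space and time
  be taken under the integral.\<close>

lemma channel_uniform:
  assumes T: "0 \<le> T"
  obtains m S L B where "\<And>t. t \<in> {0..T} \<Longrightarrow> channel_at_time t m S L B"
proof -
  obtain K where "K \<ge> 0" and K: "\<And>x t. t \<in> {0..T} \<Longrightarrow> \<bar>\<eta> (x, t)\<bar> \<le> K"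
    by (rule decaying_bounded[OF decay(1) continuous_derivatives(1) T]) (rule that)
  obtain L where "L \<ge> 0" and L: "\<And>x t. t \<in> {0..T} \<Longrightarrow> \<bar>dx \<eta> (x, t)\<bar> \<le> L"
    by (rule decaying_bounded[OF decay(2) continuous_derivatives(2) T]) (rule that)
  obtain M B where M: "integrable lborel M" "(M \<longlongrightarrow> 0) at_infinity" "\<And>x t. t \<in> {0..T} \<Longrightarrow> norm (data t x) \<le> M x"
    and B: "\<And>x t. t \<in> {0..T} \<Longrightarrow> norm (data t x) \<le> B"
    by (rule data_dominated[OF T]) (rule that)
  obtain R where R: "R \<ge> 0" "\<And>x t. t \<in> {0..T} \<Longrightarrow> R \<le> \<bar>x\<bar> \<Longrightarrow> \<bar>\<eta> (x, t)\<bar> < h / 2"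
    by (rule decaying_small_outside[OF decay(1) T half_gt_zero[OF h_pos]]) (rule that)
  have "(0, 0) \<in> {- R..R} \<times> {0..T}" using R(1) T by simp
  then have "{- R..R} \<times> {0..T} \<noteq> {}" by blast
  then obtain p where p: "p \<in> {- R..R} \<times> {0..T}" "\<And>q. q \<in> {- R..R} \<times> {0..T} \<Longrightarrow> \<eta> p \<le> \<eta> q"
    using continuous_attains_inf[OF compact_time_slab(1) _ continuous_on_subset[OF continuous_derivatives(1) compact_time_slab(2)]]
    by blast
  \<comment> \<open>Beyond \<open>R\<close> the depth exceeds \<open>h / 2\<close>; on the compact
    slab it attains its minimum at \<open>p\<close>, which is positive because the surface stays
    strictly above the bottom.\<close>
  define m where "m = min (h / 2) (\<eta> p + h)"
  have p_hp: "p \<in> half_plane" using p(1) compact_time_slab(2) by blast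
  have "0 < m" using h_pos surface_above[OF p_hp] by (simp add: m_def)
  have m: "m \<le> depth t x" if t: "t \<in> {0..T}" for t x
  proof (cases "R \<le> \<bar>x\<bar>")
    case True
    then have "\<bar>\<eta> (x, t)\<bar> < h / 2" using R(2)[OF t] by simp
    moreover have "m \<le> h / 2" unfolding m_def by (rule min.cobounded1)
    ultimately show ?thesis unfolding depth_def by linarith
  next
    case False
    then have "(x, t) \<in> {- R..R} \<times> {0..T}" using t by auto
    from p(2)[OF this] show ?thesis by (simp add: depth_def m_def)
  qed
  show thesis
  proof (rule that[of m "K + h" L B], unfold_locales)
    fix t assume t: "t \<in> {0..T}"
    then have t0: "0 \<le> t" by simp
    show "(depth t has_real_derivative slope t x) (at x)" for x
      unfolding depth_def[abs_def] slope_def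
      using DERIV_add[OF C1_half_plane_dx[OF \<eta>_C1 t0] DERIV_const[of h]] by simp
    show "continuous_on UNIV (slope t)"
      unfolding slope_def[abs_def] by (rule half_plane_section_continuous[OF continuous_derivatives(2) t0])
    show cd: "continuous_on UNIV (data t)"
      unfolding data_def[abs_def] Complex_eq
      by (intro continuous_intros half_plane_section_continuous continuous_derivatives t0)
    show "integrable lborel (data t)"
    proof (rule Bochner_Integration.integrable_bound[OF M(1)])
      show "data t \<in> borel_measurable lborel" using cd by (simp add: borel_measurable_continuous_onI)
      show "AE x in lborel. norm (data t x) \<le> norm (M x)"
        by (intro AE_I2) (use M(3)[OF t] in \<open>simp add: order_trans[OF _ abs_ge_self]\<close>)
    qed
    show "depth t x \<le> K + h" for x using K[OF t, of x] by (simp add: depth_def)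
    show "\<bar>slope t x\<bar> \<le> L" "norm (data t x) \<le> B" for x using L[OF t, of x] B[OF t, of x] by (simp_all add: slope_def)
    show "m \<le> depth t x" for x using m[OF t] .
  qed (rule \<open>0 < m\<close>)
qed

lemma channel_at:
  assumes "0 \<le> t"
  obtains m S L B where "channel_at_time t m S L B"
proof -
  obtain m S L B where ch: "\<And>s. s \<in> {0..t} \<Longrightarrow> channel (depth s) (slope s) (data s) m S L B"
    by (rule channel_uniform[OF assms]) (rule that)
  show thesis by (rule that[OF ch]) (use assms in simp)
qed

lemma data_at_infinity:
  assumes "0 \<le> t"
  shows "(data t \<longlongrightarrow> 0) at_infinity"
proof -
  obtain M B where M: "integrable lborel M" "(M \<longlongrightarrow> 0) at_infinity"
      "\<And>x s. s \<in> {0..t} \<Longrightarrow> norm (data s x) \<le> M x" "\<And>x s. s \<in> {0..t} \<Longrightarrow> norm (data s x) \<le> B"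
    by (rule data_dominated[OF assms]) (rule that)
  show ?thesis
    by (rule Lim_null_comparison[OF always_eventually M(2)]) (use M(3) assms in simp)
qed

definition field :: "real \<Rightarrow> complex \<Rightarrow> complex" where
  "field t z = surface_field (depth t) (slope t) (data t) (Re z) (depth t (Re z) - Im z)"

definition field_at :: "real \<times> real \<times> real \<Rightarrow> complex" where
  "field_at = (\<lambda>(x, y, t). field t (Complex x (y + h)))"

lemma field_eq_bulk:
  assumes "channel_at_time t m S L B"
  shows "field t = channel.bulk_field (depth t) (slope t) (data t)"
  by (rule ext) (simp add: field_def channel.bulk_field_def[OF assms])

text \<open>The times of a convergent sequence lie in a bounded interval, so all the channels
  involved share their constants and \<open>surface_field_tendsto\<close> applies to them as a
  sequence.\<close>

lemma field_at_continuous: "continuous_on (spacetime h \<eta>) field_at"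
  unfolding continuous_on_sequentially
proof safe
  fix pn x y t assume pn: "\<forall>n. pn n \<in> spacetime h \<eta>" and lim: "pn \<longlonglongrightarrow> (x, y, t)"
    and in_st: "(x, y, t) \<in> spacetime h \<eta>"
  define xn yn tn where "xn n = fst (pn n)" and "yn n = fst (snd (pn n))" and "tn n = snd (snd (pn n))" for n
  have pn_eq: "pn n = (xn n, yn n, tn n)" for n by (simp add: xn_def yn_def tn_def)
  have x: "xn \<longlonglongrightarrow> x" and y: "yn \<longlonglongrightarrow> y" and t: "tn \<longlonglongrightarrow> t"
    using tendsto_fst[OF lim] tendsto_fst[OF tendsto_snd[OF lim]] tendsto_snd[OF tendsto_snd[OF lim]]
    by (simp_all add: xn_def[abs_def] yn_def[abs_def] tn_def[abs_def])
  have tn0: "0 \<le> tn n" and yn: "- h \<le> yn n" "yn n \<le> \<eta> (xn n, tn n)" for n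
    using pn by (auto simp: pn_eq spacetime_def)
  have t0: "0 \<le> t" using in_st by (simp add: spacetime_def)
  obtain T where T: "\<And>n. \<bar>tn n\<bar> \<le> T" using convergent_imp_Bseq[of tn] t by (auto simp: convergent_def Bseq_def)
  have tT: "t \<le> T" by (rule LIMSEQ_le_const2[OF t]) (use T abs_le_D1 in blast)
  have "0 \<le> T" using T[of 0] by linarith
  obtain m S L B where ch: "\<And>t. t \<in> {0..T} \<Longrightarrow> channel_at_time t m S L B"
    by (rule channel_uniform[OF \<open>0 \<le> T\<close>]) (rule that)
  note hp = half_plane_tendsto[OF _ _ t tn0]
  show "(field_at \<circ> pn) \<longlonglongrightarrow> field_at (x, y, t)"
    unfolding o_def pn_eq field_at_def field_def prod.case complex.sel
  proof (rule surface_field_tendsto)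
    show "channel (depth (tn n)) (slope (tn n)) (data (tn n)) m S L B" for n
      using tn0[of n] T[of n] by (intro ch) auto
    show "channel_at_time t m S L B" using t0 tT by (intro ch) auto
    show "(\<lambda>n. depth (tn n) (un n)) \<longlonglongrightarrow> depth t u" if "un \<longlonglongrightarrow> u" for un u
      unfolding depth_def by (intro tendsto_intros hp continuous_derivatives that)
    then show "(\<lambda>n. depth (tn n) (xn n) - (yn n + h)) \<longlonglongrightarrow> depth t x - (y + h)"
      using x by (intro tendsto_intros y) auto
    show "(\<lambda>n. slope (tn n) (un n)) \<longlonglongrightarrow> slope t u" if "un \<longlonglongrightarrow> u" for un u
      unfolding slope_def by (intro hp continuous_derivatives that)
    show "(\<lambda>n. data (tn n) (un n)) \<longlonglongrightarrow> data t u" if "un \<longlonglongrightarrow> u" for un u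
      unfolding data_def by (intro tendsto_intros tendsto_Complex hp continuous_derivatives that)
    show "0 \<le> depth (tn n) (xn n) - (yn n + h)" "depth (tn n) (xn n) - (yn n + h) \<le> depth (tn n) (xn n)" for n
      using yn[of n] by (simp_all add: depth_def)
  qed (fact x)
qed

text \<open>On the surface the interval of integration degenerates, so the trace is
  \<open>\<xi>\<close> by construction, at all times and without any property of the field.\<close>

definition potential :: "real \<times> real \<times> real \<Rightarrow> real" where
  "potential = (\<lambda>(x, y, t). \<xi> (x, t) + integral {y + h..depth t x} (\<lambda>\<sigma>. Im (field t (Complex x \<sigma>))))"

lemma surface_in_spacetime: "0 \<le> t \<Longrightarrow> (x, \<eta> (x, t), t) \<in> spacetime h \<eta>"
  using \<eta>_above[of t x] by (simp add: spacetime_def)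

lemma potential_trace: "is_trace potential \<eta> \<xi>"
  by (simp add: is_trace_def potential_def depth_def)

lemma height_derivative:
  assumes t: "0 \<le> t"
  shows "((\<lambda>q. \<eta> (fst q, snd (snd q)) - fst (snd q)) has_derivative
      (\<lambda>v. fst v * dx \<eta> (x, t) + snd (snd v) * dt \<eta> (x, t) - fst (snd v))) (at (x, y, t) within spacetime h \<eta>)"
    and "((\<lambda>q. \<xi> (fst q, snd (snd q))) has_derivative
      (\<lambda>v. fst v * dx \<xi> (x, t) + snd (snd v) * dt \<xi> (x, t))) (at (x, y, t) within spacetime h \<eta>)"
proof -
  let ?f = "\<lambda>q::real\<times>real\<times>real. (fst q, snd (snd q))"
  have f: "(?f has_derivative ?f) (at (x, y, t) within spacetime h \<eta>)" by (auto intro!: derivative_eq_intros)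
  have img: "?f ` spacetime h \<eta> \<subseteq> half_plane" by (auto simp: spacetime_def half_plane_def)
  have *: "((\<lambda>q. u (fst q, snd (snd q))) has_derivative
      (\<lambda>v. fst v * dx u (x, t) + snd (snd v) * dt u (x, t))) (at (x, y, t) within spacetime h \<eta>)"
    if u: "C1_on half_plane u" for u
  proof -
    have "(u has_derivative (\<lambda>v. fst v * dx u (x, t) + snd v * dt u (x, t))) (at (?f (x, y, t)) within ?f ` spacetime h \<eta>)"
      using has_derivative_subset[OF C1_half_plane_derivative[OF u t] img] by simp
    from diff_chain_within[OF f this] show ?thesis by (simp add: o_def)
  qed
  show "((\<lambda>q. \<eta> (fst q, snd (snd q)) - fst (snd q)) has_derivative
      (\<lambda>v. fst v * dx \<eta> (x, t) + snd (snd v) * dt \<eta> (x, t) - fst (snd v))) (at (x, y, t) within spacetime h \<eta>)"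
    by (intro has_derivative_diff *[OF \<eta>_C1]) (auto intro!: derivative_eq_intros)
  show "((\<lambda>q. \<xi> (fst q, snd (snd q))) has_derivative
      (\<lambda>v. fst v * dx \<xi> (x, t) + snd (snd v) * dt \<xi> (x, t))) (at (x, y, t) within spacetime h \<eta>)"
    by (rule *[OF \<xi>_C1])
qed

lemma vertical_integrand_continuous:
  assumes "0 \<le> t" "- h \<le> y"
  shows "continuous_on {y + h..depth t x} (\<lambda>\<sigma>. Im (field t (Complex x \<sigma>)))"
proof -
  have "continuous_on {y + h..depth t x} (\<lambda>\<sigma>. field_at (x, \<sigma> - h, t))"
    by (rule continuous_on_compose2[OF field_at_continuous])
       (use assms in \<open>auto simp: spacetime_def depth_def intro!: continuous_intros\<close>)
  then show ?thesis by (auto simp: field_at_def intro!: continuous_intros)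
qed

text \<open>
  At the surface the vertical integral is the product of a continuous mean value with the height
  below the surface, which vanishes there; hence it is differentiable in space and time although the
  field itself is only continuous.
\<close>

lemma potential_surface_derivative:
  fixes x t :: real
  assumes t: "0 \<le> t"
  defines "c \<equiv> Im (field_at (x, \<eta> (x, t), t))"
  shows "(potential has_derivative (\<lambda>v. (fst v * dx \<xi> (x, t) + snd (snd v) * dt \<xi> (x, t))
      + c * (fst v * dx \<eta> (x, t) + snd (snd v) * dt \<eta> (x, t) - fst (snd v))))
    (at_surface x t)"
proof -
  let ?p = "(x, \<eta> (x, t), t)" and ?F = "at (x, \<eta> (x, t), t) within spacetime h \<eta>"
  define g where "g q = \<eta> (fst q, snd (snd q)) - fst (snd q)" for q :: "real \<times> real \<times> real"
  define J where "J q = integral {fst (snd q) + h..depth (snd (snd q)) (fst q)}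
    (\<lambda>\<sigma>. Im (field (snd (snd q)) (Complex (fst q) \<sigma>)))" for q :: "real \<times> real \<times> real"
  define g' where "g' v = fst v * dx \<eta> (x, t) + snd (snd v) * dt \<eta> (x, t) - fst (snd v)" for v :: "real \<times> real \<times> real"
  have g: "(g has_derivative g') ?F"
    using height_derivative(1)[OF t] by (simp add: g_def[abs_def] g'_def[abs_def])
  have gp: "g ?p = 0" by (simp add: g_def)
  have p: "?p \<in> spacetime h \<eta>" by (rule surface_in_spacetime[OF t])
  obtain K where K: "K > 0" "\<And>v. norm (g' v) \<le> norm v * K"
    using bounded_linear.pos_bounded[OF has_derivative_bounded_linear[OF g]] by blast
  obtain \<delta>0 where \<delta>0: "\<delta>0 > 0" "\<And>q. q \<in> spacetime h \<eta> \<Longrightarrow> norm (q - ?p) < \<delta>0 \<Longrightarrow>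
      norm (g q - g ?p - g' (q - ?p)) \<le> 1 * norm (q - ?p)"
    using g[unfolded has_derivative_within_alt] zero_less_one by blast
  have g_lip: "\<bar>g q\<bar> \<le> (K + 1) * norm (q - ?p)" if "q \<in> spacetime h \<eta>" "norm (q - ?p) < \<delta>0" for q
    using \<delta>0(2)[OF that] K(2)[of "q - ?p"] unfolding gp real_norm_def by (simp add: algebra_simps)
  have R: "((\<lambda>q. J q - c * g q) has_derivative (\<lambda>v. 0)) ?F"
    unfolding has_derivative_within_alt
  proof (intro conjI allI impI)
    fix e :: real assume e: "e > 0"
    \<comment> \<open>The interval of integration has length \<open>g q\<close>, at most
      \<open>K + 1\<close> times the distance to the surface point; an integrand of size
      \<open>\<epsilon>\<close> then contributes at most \<open>e\<close> times that
      distance.\<close>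
    define \<epsilon> where "\<epsilon> = e / (K + 1)"
    have \<epsilon>: "\<epsilon> > 0" using e K(1) by (simp add: \<epsilon>_def)
    obtain \<delta> where \<delta>: "\<delta> > 0" "\<And>q. q \<in> spacetime h \<eta> \<Longrightarrow> dist q ?p < \<delta> \<Longrightarrow> dist (field_at q) (field_at ?p) < \<epsilon>"
      using field_at_continuous[unfolded continuous_on_iff, rule_format, OF p \<epsilon>] by blast
    \<comment> \<open>Every point of the vertical segment above \<open>q\<close> must be within
      \<open>\<delta>\<close> of the surface point. In units of the distance of \<open>q\<close>,
      the displacements in \<open>x\<close> and \<open>t\<close> cost 1 each and the height costs
      \<open>K + 2\<close>, in total \<open>K + 4\<close>.\<close>
    define d where "d = min \<delta>0 (\<delta> / (K + 4))"
    have "d > 0" using \<delta>(1) \<delta>0(1) K(1) by (simp add: d_def)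
    moreover have "norm ((J q - c * g q) - (J ?p - c * g ?p) - 0) \<le> e * norm (q - ?p)"
      if q: "q \<in> spacetime h \<eta>" "norm (q - ?p) < d" for q
    proof -
      obtain x' y' t' where q_eq: "q = (x', y', t')" by (cases q) auto
      have st: "0 \<le> t'" "- h \<le> y'" "y' \<le> \<eta> (x', t')" using q(1) by (auto simp: q_eq spacetime_def)
      have g_eq: "g q = depth t' x' - (y' + h)" by (simp add: g_def q_eq depth_def)
      have g0: "0 \<le> g q" using st(3) by (simp add: g_def q_eq)
      have lip: "\<bar>g q\<bar> \<le> (K + 1) * norm (q - ?p)" using g_lip[OF q(1)] q(2) by (simp add: d_def)
      have comp: "\<bar>x' - x\<bar> \<le> norm (q - ?p)" "\<bar>y' - \<eta> (x, t)\<bar> \<le> norm (q - ?p)" "\<bar>t' - t\<bar> \<le> norm (q - ?p)"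
        using norm_fst_le[of "x' - x" "(y' - \<eta> (x, t), t' - t)"] norm_snd_le[of "(y' - \<eta> (x, t), t' - t)" "x' - x"]
          norm_fst_le[of "y' - \<eta> (x, t)" "t' - t"] norm_snd_le[of "t' - t" "y' - \<eta> (x, t)"] by (simp_all add: q_eq)
      have near: "\<bar>Im (field t' (Complex x' \<sigma>)) - c\<bar> \<le> \<epsilon>" if \<sigma>: "\<sigma> \<in> {y' + h..depth t' x'}" for \<sigma>
      proof -
        have "\<bar>\<sigma> - h - y'\<bar> \<le> g q" using \<sigma> by (auto simp: g_eq)
        then have s: "\<bar>\<sigma> - h - \<eta> (x, t)\<bar> \<le> norm (q - ?p) + (K + 1) * norm (q - ?p)"
          using comp(2) lip by linarith
        have "dist (x', \<sigma> - h, t') ?p \<le> \<bar>x' - x\<bar> + (\<bar>\<sigma> - h - \<eta> (x, t)\<bar> + \<bar>t' - t\<bar>)"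
        proof -
          have "dist (\<sigma> - h, t') (\<eta> (x, t), t) \<le> \<bar>\<sigma> - h - \<eta> (x, t)\<bar> + \<bar>t' - t\<bar>"
            unfolding dist_Pair_Pair dist_real_def by (rule sqrt_sum_squares_le_sum_abs[THEN order_trans]) simp
          moreover have "dist (x', \<sigma> - h, t') ?p \<le> \<bar>x' - x\<bar> + dist (\<sigma> - h, t') (\<eta> (x, t), t)"
            unfolding dist_Pair_Pair[of x'] dist_real_def[of x'] by (rule sqrt_sum_squares_le_sum_abs[THEN order_trans]) simp
          ultimately show ?thesis by linarith
        qed
        also have "\<dots> \<le> (K + 4) * norm (q - ?p)" using comp s by (simp add: algebra_simps)
        also have "\<dots> < (K + 4) * (\<delta> / (K + 4))" using q(2) K(1) by (intro mult_strict_left_mono) (auto simp: d_def)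
        also have "\<dots> = \<delta>" using K(1) by simp
        finally have "dist (field_at (x', \<sigma> - h, t')) (field_at ?p) < \<epsilon>"
          using st \<sigma> by (intro \<delta>(2)) (auto simp: spacetime_def depth_def)
        then have "norm (field t' (Complex x' \<sigma>) - field_at ?p) < \<epsilon>" by (simp add: field_at_def dist_norm)
        then show ?thesis
          using abs_Im_le_cmod[of "field t' (Complex x' \<sigma>) - field_at ?p"] by (simp add: c_def)
      qed
      have cont: "continuous_on {y' + h..depth t' x'} (\<lambda>\<sigma>. Im (field t' (Complex x' \<sigma>)))"
        using st(1,2) by (rule vertical_integrand_continuous)
      have "J q - c * g q = integral {y' + h..depth t' x'} (\<lambda>\<sigma>. Im (field t' (Complex x' \<sigma>)) - c)"
      proof -
        have "integral {y' + h..depth t' x'} (\<lambda>\<sigma>. c) = c * g q"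
          using g0 by (simp add: g_eq mult.commute)
        moreover have "J q = integral {y' + h..depth t' x'} (\<lambda>\<sigma>. Im (field t' (Complex x' \<sigma>)))"
          by (simp add: J_def q_eq)
        ultimately show ?thesis
          using Henstock_Kurzweil_Integration.integral_diff[OF integrable_continuous_real[OF cont] integrable_const_ivl[of c]]
          by (simp only:)
      qed
      also have "norm \<dots> \<le> \<epsilon> * (depth t' x' - (y' + h))"
        by (rule integral_bound) (use near g0 g_eq cont in \<open>auto intro!: continuous_intros\<close>)
      also have "\<dots> \<le> \<epsilon> * ((K + 1) * norm (q - ?p))" using lip g0 \<epsilon> unfolding g_eq by (intro mult_left_mono) auto
      also have "\<dots> = e * norm (q - ?p)" using K(1) by (simp add: \<epsilon>_def)
      finally have "norm (J q - c * g q) \<le> e * norm (q - ?p)" .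
      moreover have "J ?p = 0" by (simp add: J_def depth_def)
      ultimately show ?thesis by (simp add: gp)
    qed
    ultimately show "\<exists>d>0. \<forall>q\<in>spacetime h \<eta>. norm (q - ?p) < d \<longrightarrow>
        norm ((J q - c * g q) - (J ?p - c * g ?p) - 0) \<le> e * norm (q - ?p)" by blast
  qed simp
  have "((\<lambda>q. \<xi> (fst q, snd (snd q)) + ((J q - c * g q) + c * g q)) has_derivative
      (\<lambda>v. (fst v * dx \<xi> (x, t) + snd (snd v) * dt \<xi> (x, t)) + (0 + c * g' v))) ?F"
    by (intro has_derivative_add height_derivative(2)[OF t] R has_derivative_mult_right g)
  moreover have "(\<lambda>q. \<xi> (fst q, snd (snd q)) + ((J q - c * g q) + c * g q)) = potential"
    by (auto simp: potential_def J_def fun_eq_iff)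
  ultimately show ?thesis by (simp add: g'_def)
qed

end

section \<open>Solving the boundary value problem\<close>

context surface_data
begin

lemma open_fluid:
  assumes "0 \<le> t"
  shows "open (fluid h \<eta> t)"
proof -
  have "continuous_on UNIV (\<lambda>x. \<eta> (x, t))"
    by (rule half_plane_section_continuous[OF continuous_derivatives(1) assms])
  then have c: "continuous_on UNIV (\<lambda>p::real\<times>real. \<eta> (fst p, t))"
    by (rule continuous_on_compose2) (auto intro!: continuous_intros)
  have "fluid h \<eta> t = {p. - h < snd p} \<inter> {p. snd p < \<eta> (fst p, t)}" by (auto simp: fluid_def)
  moreover have "open \<dots>" by (intro open_Int open_Collect_less continuous_intros c)
  ultimately show ?thesis by simp
qed

lemma fluid_subset: "fluid h \<eta> t \<subseteq> closed_fluid h \<eta> t"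
  by (auto simp: fluid_def closed_fluid_def)

text \<open>Integrability is automatic from the decay of the data, so only the value of the integral
  carries information; the constant factor 1/2 is irrelevant for its vanishing.\<close>

lemma nonlocal_iff:
  "nonlocal_equation \<gamma> h \<xi> \<eta> \<longleftrightarrow> (\<forall>t\<ge>0. \<forall>k.
     (LINT x|lborel. modes (depth t) (data t) k x) = 0)"
proof -
  have "has_bochner_integral lborel
       (\<lambda>x. exp (- \<i> * of_real (k * x)) *
          (of_real (dx \<xi> (x, t) * sinh (k * (\<eta> (x, t) + h)))
           - \<i> * of_real ((dt \<eta> (x, t) - \<gamma> * \<eta> (x, t) * dx \<eta> (x, t)) * cosh (k * (\<eta> (x, t) + h)))))
       0 \<longleftrightarrow>
     (LINT x|lborel. modes (depth t) (data t) k x) = 0"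
    (is "has_bochner_integral lborel ?f 0 \<longleftrightarrow> integral\<^sup>L lborel ?g = 0") if t: "0 \<le> t" for t k
  proof -
    obtain m S L B where "channel_at_time t m S L B" using channel_at[OF t] by blast
    then have int: "integrable lborel ?g" by (rule channel.nonlocal_integrable)
    have fg: "?f = (\<lambda>x. (1/2) * ?g x)"
      by (rule ext) (simp only: nonlocal_integrand_eq graph_def depth_def data_def)
    have "integral\<^sup>L lborel ?f = (1/2) * integral\<^sup>L lborel ?g" unfolding fg by (rule integral_mult_right_zero)
    moreover have "integrable lborel ?f" unfolding fg using int by (rule integrable_mult_right)
    moreover have "(1/2) * z = 0 \<longleftrightarrow> z = 0" for z :: complex by simp
    ultimately show ?thesis unfolding has_bochner_integral_iff by (simp only: simp_thms)
  qed
  then show ?thesis unfolding nonlocal_equation_def by blast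
qed

text \<open>The variables stand for values at one surface point: \<open>px\<close>,
  \<open>py\<close> for the gradient of the potential, \<open>e\<close>, \<open>ex\<close>,
  \<open>et\<close> for the elevation and its derivatives, \<open>xx\<close>, \<open>xt\<close> for
  the derivatives of the trace, and \<open>I\<close> for the nonlocal term. The term
  \<open>xt - py * et\<close> is the time derivative of the potential.\<close>

lemma bernoulli_iff:
  assumes "px + py * ex = xx" and "py - (px - \<gamma> * e) * ex = et"
  shows "xt - py * et - \<gamma> * I + 1/2 * py\<^sup>2 + 1/2 * (px - \<gamma> * e)\<^sup>2 + g * e =
    xt + 1/2 * xx\<^sup>2 - \<gamma> * I + g * e + \<gamma> * e * (2 * et * ex - 2 * xx + \<gamma> * e) / (2 * (1 + ex\<^sup>2))
     - (et + ex * xx)\<^sup>2 / (2 * (1 + ex\<^sup>2))"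
proof -
  define q where "q = 1 + ex\<^sup>2"
  have q: "q \<noteq> 0" unfolding q_def by (smt (verit) zero_le_power2)
  \<comment> \<open>The denominator \<open>q\<close> divides the combined numerator:
    \<open>et + ex * xx\<close> is \<open>q * py + \<gamma> * e * ex\<close>, and the terms in
    \<open>(\<gamma> * e)^2\<close> without an explicit \<open>q\<close> add up to
    \<open>1 + 2 * ex^2 - ex^2\<close>, which is \<open>q\<close> again.\<close>
  have "\<gamma> * e * (2 * et * ex - 2 * xx + \<gamma> * e) - (et + ex * xx)\<^sup>2
      = q * (- 2 * \<gamma> * e * px + (\<gamma> * e)\<^sup>2 - q * py\<^sup>2 - 2 * py * (\<gamma> * e) * ex)"
    unfolding assms[symmetric] q_def by (simp add: power2_eq_square algebra_simps)
  then have "\<gamma> * e * (2 * et * ex - 2 * xx + \<gamma> * e) / (2 * q) - (et + ex * xx)\<^sup>2 / (2 * q)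
      = (- 2 * \<gamma> * e * px + (\<gamma> * e)\<^sup>2 - q * py\<^sup>2 - 2 * py * (\<gamma> * e) * ex) / 2"
    using q by (simp flip: diff_divide_distrib)
  moreover have "- py * et + 1/2 * py\<^sup>2 + 1/2 * (px - \<gamma> * e)\<^sup>2 =
      1/2 * xx\<^sup>2 + (- 2 * \<gamma> * e * px + (\<gamma> * e)\<^sup>2 - q * py\<^sup>2 - 2 * py * (\<gamma> * e) * ex) / 2"
    unfolding assms[symmetric] q_def by (simp add: power2_eq_square field_simps)
  ultimately show ?thesis unfolding q_def by linarith
qed

lemma below_depth_iff: "0 \<le> t \<Longrightarrow> z \<in> below_graph (depth t) \<longleftrightarrow> (Re z, Im z - h) \<in> closed_fluid h \<eta> t"
  by (auto simp: below_graph_def closed_fluid_def depth_def)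

abbreviation kinematic :: "(real \<times> real \<times> real \<Rightarrow> real) \<Rightarrow> real \<Rightarrow> real \<Rightarrow> bool" where
  "kinematic \<phi> x t \<equiv> pot_y h \<eta> \<phi> (x, \<eta> (x, t), t)
      - (pot_x h \<eta> \<phi> (x, \<eta> (x, t), t) - \<gamma> * \<eta> (x, t)) * dx \<eta> (x, t) = dt \<eta> (x, t)"

abbreviation dynamic ::
  "real \<Rightarrow> real \<Rightarrow> real \<Rightarrow> (real \<times> real \<times> real \<Rightarrow> real) \<Rightarrow> real \<Rightarrow> real \<Rightarrow> bool" where
  "dynamic g \<sigma> \<rho> \<phi> x t \<equiv> (let y = \<eta> (x, t) in
        pot_t h \<eta> \<phi> (x, y, t) - \<gamma> * inv_dx (dt \<eta>) (x, t)
          + 1/2 * (pot_y h \<eta> \<phi> (x, y, t))\<^sup>2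
          + 1/2 * (pot_x h \<eta> \<phi> (x, y, t) - \<gamma> * y)\<^sup>2 + g * y
          = surface_tension \<sigma> \<rho> \<eta> (x, t))"

lemma surface_bernoulli_iff:
  assumes "\<And>t x. 0 \<le> t \<Longrightarrow> \<phi> differentiable (at_surface x t)"
    and tr: "is_trace \<phi> \<eta> \<xi>"
    and kin: "\<And>t x. 0 \<le> t \<Longrightarrow> kinematic \<phi> x t"
  shows "(\<forall>t\<ge>0. \<forall>x. dynamic g \<sigma> \<rho> \<phi> x t) \<longleftrightarrow> surface_bernoulli \<gamma> g \<sigma> \<rho> \<xi> \<eta>"
proof -
  have "pot_t h \<eta> \<phi> (x, \<eta> (x, t), t) - \<gamma> * inv_dx (dt \<eta>) (x, t)
          + 1/2 * (pot_y h \<eta> \<phi> (x, \<eta> (x, t), t))\<^sup>2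
          + 1/2 * (pot_x h \<eta> \<phi> (x, \<eta> (x, t), t) - \<gamma> * \<eta> (x, t))\<^sup>2 + g * \<eta> (x, t)
     = dt \<xi> (x, t) + 1/2 * (dx \<xi> (x, t))\<^sup>2 - \<gamma> * inv_dx (dt \<eta>) (x, t) + g * \<eta> (x, t)
     + \<gamma> * \<eta> (x, t) * (2 * dt \<eta> (x, t) * dx \<eta> (x, t) - 2 * dx \<xi> (x, t) + \<gamma> * \<eta> (x, t)) / (2 * (1 + (dx \<eta> (x, t))\<^sup>2))
     - (dt \<eta> (x, t) + dx \<eta> (x, t) * dx \<xi> (x, t))\<^sup>2 / (2 * (1 + (dx \<eta> (x, t))\<^sup>2))" if t: "0 \<le> t" for x t
  proof -
    obtain D where D: "(\<phi> has_derivative D) (at_surface x t)"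
      using assms(1)[OF t] by (auto simp: differentiable_def)
    note T = trace_derivatives[OF t D \<xi>_C1 tr]
    show ?thesis unfolding T(2) by (rule bernoulli_iff[OF T(1)[symmetric] kin[OF t]])
  qed
  note eq = this
  show ?thesis
    unfolding surface_bernoulli_def Let_def by (intro iff_allI imp_cong refl) (simp only: eq)
qed

lemma bvp_imp_nonlocal:
  assumes adm: "admissible_potential h \<eta> \<phi>" and tr: "is_trace \<phi> \<eta> \<xi>"
    and harm: "\<And>t p. 0 \<le> t \<Longrightarrow> p \<in> fluid h \<eta> t \<Longrightarrow> laplacian (fluid h \<eta> t) (at_time \<phi> t) p = 0"
    and bottom: "\<And>t x. 0 \<le> t \<Longrightarrow> pot_y h \<eta> \<phi> (x, - h, t) = 0"
    and kin: "\<And>t x. 0 \<le> t \<Longrightarrow> kinematic \<phi> x t"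
  shows "nonlocal_equation \<gamma> h \<xi> \<eta>"
  unfolding nonlocal_iff
proof (intro allI impI)
  fix t k :: real assume t: "0 \<le> t"
  obtain m S L B where ch: "channel_at_time t m S L B" using channel_at[OF t] by blast
  interpret channel "depth t" "slope t" "data t" m S L B by (rule ch)
  define f where "f z = Complex (pot_x h \<eta> \<phi> (Re z, Im z - h, t)) (- pot_y h \<eta> \<phi> (Re z, Im z - h, t))" for z
  have C2: "C2_on (fluid h \<eta> t) (at_time \<phi> t)" using adm t by (simp add: admissible_potential_def)
  \<comment> \<open>Harmonicity refers to derivatives in the open fluid, boundary values and
    continuity to derivatives in the closed one. At interior points the two agree, so
    \<open>f\<close> is both holomorphic inside and continuous up to the boundary.\<close>
  have pot_inside: "pot_x h \<eta> \<phi> (x, y, t) = dderiv (fluid h \<eta> t) (1, 0) (at_time \<phi> t) (x, y)"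
    "pot_y h \<eta> \<phi> (x, y, t) = dderiv (fluid h \<eta> t) (0, 1) (at_time \<phi> t) (x, y)"
    if xy: "(x, y) \<in> fluid h \<eta> t" for x y
  proof -
    have "at_time \<phi> t differentiable (at (x, y) within fluid h \<eta> t)"
      using C2 xy by (auto simp: C2_on_def C1_on_def differentiable_on_def)
    then have D: "(at_time \<phi> t has_derivative (\<lambda>v. dderiv (fluid h \<eta> t) v (at_time \<phi> t) (x, y))) (at (x, y))"
      using dderiv_has_derivative[of "at_time \<phi> t" "(x, y)" "fluid h \<eta> t"]
        at_within_open[OF xy open_fluid[OF t]] by (simp only:)
    have xy': "(x, y) \<in> closed_fluid h \<eta> t" using xy fluid_subset by blast
    show "pot_x h \<eta> \<phi> (x, y, t) = dderiv (fluid h \<eta> t) (1, 0) (at_time \<phi> t) (x, y)"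
      "pot_y h \<eta> \<phi> (x, y, t) = dderiv (fluid h \<eta> t) (0, 1) (at_time \<phi> t) (x, y)"
      using closed_fluid_dderiv[OF t xy' has_derivative_at_withinI[OF D]] by (simp_all add: pot_x_def pot_y_def)
  qed
  have f_cont: "continuous_on (below_graph (depth t)) f"
  proof -
    have "continuous_on (below_graph (depth t)) (\<lambda>z. u (Re z, Im z - h, t))" if "continuous_on (spacetime h \<eta>) u" for u :: "_ \<Rightarrow> real"
      by (rule continuous_on_compose2[OF that])
         (use t in \<open>auto simp: below_graph_def spacetime_def depth_def intro!: continuous_intros\<close>)
    then show ?thesis using adm unfolding f_def Complex_eq admissible_potential_def
      by (auto intro!: continuous_intros)
  qed
  have strip: "strip_function (depth t) (slope t) f"
    by unfold_locales (use H_deriv a_cont H_pos f_cont in auto)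
  have "f field_differentiable at z" if z: "0 < Im z" "Im z < depth t (Re z)" for z
  proof -
    have zf: "(Re z, Im z - h) \<in> fluid h \<eta> t" using z by (auto simp: fluid_def depth_def)
    have op: "open {z. 0 * depth t (Re z) < Im z \<and> Im z < depth t (Re z)}"
      by (rule open_graph_regions[OF H_cont])
    obtain D where D: "((\<lambda>z. Complex (dderiv (fluid h \<eta> t) (1, 0) (at_time \<phi> t) (Re z, Im z - h))
        (- dderiv (fluid h \<eta> t) (0, 1) (at_time \<phi> t) (Re z, Im z - h))) has_field_derivative D) (at z)"
      using harmonic_imp_holomorphic[OF open_fluid[OF t] C2 harm[OF t] zf] by (auto simp: field_differentiable_def)
    have "(f has_field_derivative D) (at z)"
    proof (rule has_field_derivative_transform_within_open[OF D op])
      show "z \<in> {z. 0 * depth t (Re z) < Im z \<and> Im z < depth t (Re z)}" using z by simp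
      fix w assume "w \<in> {z. 0 * depth t (Re z) < Im z \<and> Im z < depth t (Re z)}"
      then have "(Re w, Im w - h) \<in> fluid h \<eta> t" by (auto simp: fluid_def depth_def)
      then show "Complex (dderiv (fluid h \<eta> t) (1, 0) (at_time \<phi> t) (Re w, Im w - h))
        (- dderiv (fluid h \<eta> t) (0, 1) (at_time \<phi> t) (Re w, Im w - h)) = f w"
        by (simp add: f_def pot_inside)
    qed
    then show ?thesis by (auto simp: field_differentiable_def)
  qed
  then have hol: "f holomorphic_on {z. 0 * depth t (Re z) < Im z \<and> Im z < depth t (Re z)}"
    by (auto simp: holomorphic_on_def intro: field_differentiable_at_within)
  show "(LINT x|lborel. modes (depth t) (data t) k x) = 0"
  proof (rule nonlocal_integral_zero[OF strip H_le hol])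
    fix x
    have "\<phi> differentiable (at_surface x t)"
      using adm t by (simp add: admissible_potential_def)
    then obtain D where D: "(\<phi> has_derivative D) (at_surface x t)"
      unfolding differentiable_def ..
    have fx: "f (Complex x (depth t x)) = Complex (pot_x h \<eta> \<phi> (x, \<eta> (x, t), t)) (- pot_y h \<eta> \<phi> (x, \<eta> (x, t), t))"
      by (simp add: f_def depth_def)
    show "f (Complex x (depth t x)) * Complex 1 (slope t x) = data t x"
      unfolding fx data_def slope_def trace_derivatives(1)[OF t D \<xi>_C1 tr] kin[OF t, symmetric]
      by (simp add: complex_eq_iff algebra_simps)
    show "Im (f (Complex x 0)) = 0" using bottom[OF t, of x] by (simp add: f_def)
  next
    fix \<epsilon> :: real assume "\<epsilon> > 0"
    then have "\<epsilon> / 2 > 0" by simp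
    moreover have "\<forall>\<epsilon>>0. \<exists>R. \<forall>(x, y)\<in>closed_fluid h \<eta> t. \<bar>x\<bar> > R \<longrightarrow>
        \<bar>pot_x h \<eta> \<phi> (x, y, t)\<bar> < \<epsilon> \<and> \<bar>pot_y h \<eta> \<phi> (x, y, t)\<bar> < \<epsilon>"
      using adm t unfolding admissible_potential_def by (elim conjE) (erule allE, erule mp, assumption)
    ultimately obtain R where "\<forall>(x, y)\<in>closed_fluid h \<eta> t. \<bar>x\<bar> > R \<longrightarrow>
        \<bar>pot_x h \<eta> \<phi> (x, y, t)\<bar> < \<epsilon> / 2 \<and> \<bar>pot_y h \<eta> \<phi> (x, y, t)\<bar> < \<epsilon> / 2"
      by (elim allE impE exE) (assumption | rule that)+
    then have R: "\<bar>pot_x h \<eta> \<phi> (x, y, t)\<bar> < \<epsilon> / 2 \<and> \<bar>pot_y h \<eta> \<phi> (x, y, t)\<bar> < \<epsilon> / 2"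
      if "(x, y) \<in> closed_fluid h \<eta> t" "\<bar>x\<bar> > R" for x y
      using that by fast
    have "norm (f z) \<le> \<epsilon>" if "z \<in> below_graph (depth t)" "\<bar>Re z\<bar> > R" for z
    proof -
      have "(Re z, Im z - h) \<in> closed_fluid h \<eta> t" using that(1) below_depth_iff[OF t] by blast
      from R[OF this that(2)] show ?thesis
        using norm_Complex_le[of "pot_x h \<eta> \<phi> (Re z, Im z - h, t)" "- pot_y h \<eta> \<phi> (Re z, Im z - h, t)"]
        unfolding f_def by simp
    qed
    then show "\<exists>R. \<forall>z\<in>below_graph (depth t). \<bar>Re z\<bar> > R \<longrightarrow> norm (f z) \<le> \<epsilon>" by blast
  qed (rule nonlocal_integrable)
qed

end

section \<open>The potential reconstructed from the nonlocal equation\<close>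

locale nonlocal_data = surface_data +
  assumes nonlocal: "nonlocal_equation \<gamma> h \<xi> \<eta>"
begin

lemma vanishing:
  assumes "0 \<le> t" "depth t (Re z) < Im z"
  shows "cauchy (depth t) (data t) z = 0"
proof -
  obtain m S L B where ch: "channel_at_time t m S L B" using channel_at[OF assms(1)] by blast
  show ?thesis
    by (rule channel.cauchy_vanishes_above[OF ch _ assms(2)]) (use nonlocal assms(1) in \<open>simp add: nonlocal_iff\<close>)
qed

lemma field_eq_cauchy:
  assumes "0 \<le> t" "0 \<le> Im z" "Im z < depth t (Re z)"
  shows "field t z = cauchy (depth t) (data t) z"
proof -
  obtain m S L B where ch: "channel_at_time t m S L B" using channel_at[OF assms(1)] by blast
  show ?thesis
    unfolding field_eq_bulk[OF ch] using vanishing[OF assms(1)] assms(2,3) by (rule channel.bulk_field_eq_cauchy[OF ch])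
qed

lemma potential_Re_primitive:
  assumes t: "0 \<le> t"
  obtains P C where
    "\<And>z. - depth t (Re z) < Im z \<Longrightarrow> Im z < depth t (Re z) \<Longrightarrow>
       (P has_field_derivative cauchy (depth t) (data t) z) (at z)"
    "\<And>x y. - h \<le> y \<Longrightarrow> y < \<eta> (x, t) \<Longrightarrow> at_time potential t (x, y) = Re (P (Complex x (y + h))) + C"
proof -
  obtain m S L B where ch: "channel_at_time t m S L B" using channel_at[OF t] by blast
  interpret channel "depth t" "slope t" "data t" m S L B by (rule ch)
  have \<xi>: "((\<lambda>x. \<xi> (x, t)) has_real_derivative Re (data t x)) (at x)" for x
    using C1_half_plane_dx[OF \<xi>_C1 t] by (simp add: data_def)
  obtain P C where P: "\<And>z. - depth t (Re z) < Im z \<Longrightarrow> Im z < depth t (Re z) \<Longrightarrow>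
       (P has_field_derivative cauchy (depth t) (data t) z) (at z)"
    and C: "\<And>x y. 0 \<le> y \<Longrightarrow> y < depth t x \<Longrightarrow> \<xi> (x, t) + vertical_integral x y = Re (P (Complex x y)) + C"
    using potential_eq_Re_primitive[OF vanishing[OF t] \<xi>] by blast
  show thesis
  proof (rule that[OF P])
    show "at_time potential t (x, y) = Re (P (Complex x (y + h))) + C" if "- h \<le> y" "y < \<eta> (x, t)" for x y
      using C[of "y + h" x] that
      by (simp add: at_time_def potential_def vertical_integral_def field_eq_bulk[OF ch] depth_def)
  qed
qed

lemma field_at_surface:
  assumes "0 \<le> t"
  shows "field_at (x, \<eta> (x, t), t) * Complex 1 (dx \<eta> (x, t)) = data t x"
proof -
  obtain m S L B where ch: "channel_at_time t m S L B" using channel_at[OF assms] by blast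
  have "field_at (x, \<eta> (x, t), t) = data t x / Complex 1 (slope t x)"
    using channel.bulk_field_top[OF ch, of x] by (simp add: field_at_def field_eq_bulk[OF ch] depth_def)
  then show ?thesis by (simp add: slope_def)
qed

text \<open>Multiplication by the tangent separates directions: the real part is the derivative of
  the trace along the surface, the imaginary part is the kinematic condition.\<close>

lemma field_at_surface_components:
  assumes "0 \<le> t"
  shows "dx \<xi> (x, t) = Re (field_at (x, \<eta> (x, t), t)) - Im (field_at (x, \<eta> (x, t), t)) * dx \<eta> (x, t)"
    and "\<gamma> * \<eta> (x, t) * dx \<eta> (x, t) - dt \<eta> (x, t) =
      Re (field_at (x, \<eta> (x, t), t)) * dx \<eta> (x, t) + Im (field_at (x, \<eta> (x, t), t))"
  using field_at_surface[OF assms, of x] by (auto simp: data_def complex_eq_iff)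

text \<open>On the surface no primitive is at hand, and the derivative comes from the space-time
  expansion there. Everywhere below, even on the bottom, the potential is locally the real part of a
  holomorphic primitive, since the Cauchy integral extends across the bottom.\<close>

lemma potential_derivative:
  assumes t: "0 \<le> t" and p: "(x, y) \<in> closed_fluid h \<eta> t"
  shows "(at_time potential t has_derivative
      (\<lambda>v. fst v * Re (field_at (x, y, t)) - snd v * Im (field_at (x, y, t)))) (at (x, y) within closed_fluid h \<eta> t)"
proof (cases "y = \<eta> (x, t)")
  case True
  have "(at_time potential t has_derivative (\<lambda>v. (fst v * dx \<xi> (x, t) + 0 * dt \<xi> (x, t))
      + Im (field_at (x, \<eta> (x, t), t)) * (fst v * dx \<eta> (x, t) + 0 * dt \<eta> (x, t) - snd v)))
      (at (x, \<eta> (x, t)) within closed_fluid h \<eta> t)"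
    using at_time_derivative[OF potential_surface_derivative[OF t] t] by (simp only: fst_conv snd_conv)
  then show ?thesis unfolding True
    by (rule has_derivative_eq_rhs) (rule ext, simp add: field_at_surface_components(1)[OF t] algebra_simps)
next
  case False
  then have y: "- h \<le> y" "y < \<eta> (x, t)" using p by (auto simp: closed_fluid_def)
  obtain P C where P: "\<And>z. - depth t (Re z) < Im z \<Longrightarrow> Im z < depth t (Re z) \<Longrightarrow>
       (P has_field_derivative cauchy (depth t) (data t) z) (at z)"
    and C: "\<And>x y. - h \<le> y \<Longrightarrow> y < \<eta> (x, t) \<Longrightarrow> at_time potential t (x, y) = Re (P (Complex x (y + h))) + C"
    by (rule potential_Re_primitive[OF t]) (rule that)
  have "0 < depth t x" using \<eta>_above[OF t, of x] by (simp add: depth_def)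
  then have "(P has_field_derivative field_at (x, y, t)) (at (Complex x (y + h)))"
    using P[of "Complex x (y + h)"] field_eq_cauchy[OF t, of "Complex x (y + h)"] y by (simp add: field_at_def depth_def)
  from has_derivative_add[OF has_derivative_Re[OF has_derivative_holomorphic_shift[OF this]] has_derivative_const[of C]]
  have "((\<lambda>p. Re (P (Complex (fst p) (snd p + h))) + C) has_derivative
      (\<lambda>v. fst v * Re (field_at (x, y, t)) - snd v * Im (field_at (x, y, t)))) (at (x, y))"
    by (rule has_derivative_eq_rhs) (rule ext, simp)
  then have d: "((\<lambda>p. Re (P (Complex (fst p) (snd p + h))) + C) has_derivative
      (\<lambda>v. fst v * Re (field_at (x, y, t)) - snd v * Im (field_at (x, y, t)))) (at (x, y) within closed_fluid h \<eta> t)"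
    by (rule has_derivative_at_withinI)
  \<comment> \<open>The representation by \<open>Re P\<close> is known strictly below the surface
    only, so a neighbourhood of the point that avoids the surface is needed before the derivative
    can be transferred.\<close>
  have "continuous_on UNIV (\<lambda>p::real\<times>real. \<eta> (fst p, t))"
    by (rule continuous_on_compose2[OF half_plane_section_continuous[OF continuous_derivatives(1) t, of UNIV]])
       (auto intro!: continuous_intros)
  then have "open {p::real\<times>real. snd p < \<eta> (fst p, t)}" by (intro open_Collect_less continuous_intros)
  moreover have "(x, y) \<in> {p. snd p < \<eta> (fst p, t)}" using y by simp
  ultimately obtain e where e: "e > 0" "\<And>q. dist q (x, y) < e \<Longrightarrow> q \<in> {p. snd p < \<eta> (fst p, t)}"
    unfolding open_dist by blast
  show ?thesis
  proof (rule has_derivative_transform_within[OF d e(1) p])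
    fix q assume q: "q \<in> closed_fluid h \<eta> t" "dist q (x, y) < e"
    obtain x' y' where q_eq: "q = (x', y')" by (cases q)
    have "- h \<le> y'" "y' < \<eta> (x', t)" using q e(2)[OF q(2)] by (auto simp: q_eq closed_fluid_def)
    from C[OF this] show "Re (P (Complex (fst q) (snd q + h))) + C = at_time potential t q" by (simp add: q_eq)
  qed
qed

lemma potential_gradient:
  assumes "0 \<le> t" "(x, y) \<in> closed_fluid h \<eta> t"
  shows "pot_x h \<eta> potential (x, y, t) = Re (field_at (x, y, t))"
    and "pot_y h \<eta> potential (x, y, t) = - Im (field_at (x, y, t))"
  using closed_fluid_dderiv[OF assms potential_derivative[OF assms]] by (simp_all add: pot_x_def pot_y_def)

lemma potential_gradient_continuous:
  "continuous_on (spacetime h \<eta>) (pot_x h \<eta> potential)"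
  "continuous_on (spacetime h \<eta>) (pot_y h \<eta> potential)"
proof -
  have *: "pot_x h \<eta> potential p = Re (field_at p)" "pot_y h \<eta> potential p = - Im (field_at p)"
    if "p \<in> spacetime h \<eta>" for p
    using that potential_gradient by (cases p; auto simp: spacetime_def closed_fluid_def)+
  show "continuous_on (spacetime h \<eta>) (pot_x h \<eta> potential)"
    using continuous_on_Re[OF field_at_continuous] by (subst continuous_on_cong[OF refl *(1)])
  show "continuous_on (spacetime h \<eta>) (pot_y h \<eta> potential)"
    using continuous_on_minus[OF continuous_on_Im[OF field_at_continuous]] by (subst continuous_on_cong[OF refl *(2)])
qed

lemma potential_inside:
  assumes t: "0 \<le> t"
  shows "C2_on (fluid h \<eta> t) (at_time potential t)"
    and "p \<in> fluid h \<eta> t \<Longrightarrow> laplacian (fluid h \<eta> t) (at_time potential t) p = 0"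
proof -
  obtain m S L B where ch: "channel_at_time t m S L B" using channel_at[OF t] by blast
  let ?V = "{z. (- 1) * depth t (Re z) < Im z \<and> Im z < depth t (Re z)}"
  have V: "open ?V" by (rule open_graph_regions[OF channel.H_cont[OF ch]])
  obtain P C where P: "\<And>z. - depth t (Re z) < Im z \<Longrightarrow> Im z < depth t (Re z) \<Longrightarrow>
       (P has_field_derivative cauchy (depth t) (data t) z) (at z)"
    and C: "\<And>x y. - h \<le> y \<Longrightarrow> y < \<eta> (x, t) \<Longrightarrow> at_time potential t (x, y) = Re (P (Complex x (y + h))) + C"
    by (rule potential_Re_primitive[OF t]) (rule that)
  have P': "(P has_field_derivative cauchy (depth t) (data t) z) (at z)" if "z \<in> ?V" for z
    using that by (intro P) auto
  have SV: "Complex x (y + h) \<in> ?V" if "(x, y) \<in> fluid h \<eta> t" for x y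
    using that \<eta>_above[OF t, of x] by (auto simp: fluid_def depth_def)
  have u: "at_time potential t (x, y) = Re (P (Complex x (y + h))) + C" if "(x, y) \<in> fluid h \<eta> t" for x y
    using that by (intro C) (auto simp: fluid_def)
  note R = holomorphic_imp_harmonic[OF V P' open_fluid[OF t] SV u]
  show "C2_on (fluid h \<eta> t) (at_time potential t)"
    and "p \<in> fluid h \<eta> t \<Longrightarrow> laplacian (fluid h \<eta> t) (at_time potential t) p = 0"
    using R by blast+
qed

lemma potential_admissible: "admissible_potential h \<eta> potential"
  unfolding admissible_potential_def
proof (intro conjI allI impI)
  fix t :: real assume t: "0 \<le> t"
  show "C2_on (fluid h \<eta> t) (at_time potential t)" using potential_inside(1)[OF t] .
  show "at_time potential t differentiable_on closed_fluid h \<eta> t"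
    unfolding differentiable_on_def differentiable_def using potential_derivative[OF t] by fast
  show "potential differentiable (at_surface x t)" for x
    unfolding differentiable_def using potential_surface_derivative[OF t] by blast
  fix \<epsilon> :: real assume \<epsilon>: "\<epsilon> > 0"
  obtain m S L B where ch: "channel_at_time t m S L B" using channel_at[OF t] by blast
  obtain R where R: "\<And>z. z \<in> below_graph (depth t) \<Longrightarrow> \<bar>Re z\<bar> > R \<Longrightarrow> norm (field t z) < \<epsilon>"
    using channel.bulk_field_decays[OF ch data_at_infinity[OF t] \<epsilon>] unfolding field_eq_bulk[OF ch] by blast
  have "\<bar>pot_x h \<eta> potential (x, y, t)\<bar> < \<epsilon> \<and> \<bar>pot_y h \<eta> potential (x, y, t)\<bar> < \<epsilon>"
    if xy: "(x, y) \<in> closed_fluid h \<eta> t" "\<bar>x\<bar> > R" for x y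
  proof -
    have "norm (field t (Complex x (y + h))) < \<epsilon>"
      using xy by (intro R) (auto simp: below_graph_def closed_fluid_def depth_def)
    then have "norm (field_at (x, y, t)) < \<epsilon>" by (simp add: field_at_def)
    then show ?thesis
      unfolding potential_gradient[OF t xy(1)]
      using abs_Re_le_cmod[of "field_at (x, y, t)"] abs_Im_le_cmod[of "field_at (x, y, t)"] by simp
  qed
  then show "\<exists>R. \<forall>(x, y)\<in>closed_fluid h \<eta> t. \<bar>x\<bar> > R \<longrightarrow>
        \<bar>pot_x h \<eta> potential (x, y, t)\<bar> < \<epsilon> \<and> \<bar>pot_y h \<eta> potential (x, y, t)\<bar> < \<epsilon>"
    by (intro exI[of _ R] ballI) (simp add: case_prod_unfold)
qed (fact potential_gradient_continuous)+

lemma potential_kinematic: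
  assumes t: "0 \<le> t"
  shows "kinematic potential x t"
proof -
  have "(x, \<eta> (x, t)) \<in> closed_fluid h \<eta> t" using \<eta>_above[OF t, of x] by (simp add: closed_fluid_def)
  then show ?thesis
    unfolding potential_gradient[OF t \<open>(x, \<eta> (x, t)) \<in> closed_fluid h \<eta> t\<close>]
    using field_at_surface_components(2)[OF t, of x] by (simp add: algebra_simps)
qed

lemma potential_bottom:
  assumes t: "0 \<le> t"
  shows "pot_y h \<eta> potential (x, - h, t) = 0"
proof -
  obtain m S L B where ch: "channel_at_time t m S L B" using channel_at[OF t] by blast
  have d: "0 < depth t x" using \<eta>_above[OF t, of x] by (simp add: depth_def)
  have p: "(x, - h) \<in> closed_fluid h \<eta> t" using \<eta>_above[OF t, of x] by (simp add: closed_fluid_def)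
  have "field t (Complex x 0) = cauchy (depth t) (data t) (Complex x 0)"
    using field_eq_cauchy[OF t, of "Complex x 0"] d by simp
  moreover have "Im (cauchy (depth t) (data t) (Complex x 0)) = 0"
    by (rule channel.cauchy_real_on_axis[OF ch]) simp
  ultimately show ?thesis unfolding potential_gradient[OF t p] by (simp add: field_at_def)
qed

end

theorem proposition2:
  fixes \<gamma> h g \<sigma> \<rho> :: real and \<eta> \<xi> :: "real \<times> real \<Rightarrow> real"
  assumes "h > 0" and "g > 0" and "\<sigma> \<ge> 0" and "\<rho> > 0"
    and "admissible_surface h \<eta>" and "admissible_trace \<xi>"
  shows "(\<exists>\<phi>. admissible_potential h \<eta> \<phi> \<and> is_trace \<phi> \<eta> \<xi> \<and> solves_bvp \<gamma> h g \<sigma> \<rho> \<phi> \<eta>)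
     \<longleftrightarrow> nonlocal_equation \<gamma> h \<xi> \<eta> \<and> surface_bernoulli \<gamma> g \<sigma> \<rho> \<xi> \<eta>"
proof -
  interpret surface_data h \<eta> \<xi> \<gamma>
    by unfold_locales
       (use assms(1,5,6) in \<open>auto simp: admissible_surface_def admissible_trace_def C2_on_def\<close>)
  \<comment> \<open>The bottom normal retains only the vertical velocity, so the shear term drops
    out of the bottom condition. Separating the four conditions lets the kinematic one be used when
    the Bernoulli equations are compared.\<close>
  have bvp: "solves_bvp \<gamma> h g \<sigma> \<rho> \<phi> \<eta> \<longleftrightarrow>
      (\<forall>t\<ge>0. \<forall>p\<in>fluid h \<eta> t. laplacian (fluid h \<eta> t) (at_time \<phi> t) p = 0) \<and>
      (\<forall>t\<ge>0. \<forall>x. pot_y h \<eta> \<phi> (x, - h, t) = 0) \<and>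
      (\<forall>t\<ge>0. \<forall>x. kinematic \<phi> x t) \<and>
      (\<forall>t\<ge>0. \<forall>x. dynamic g \<sigma> \<rho> \<phi> x t)" for \<phi>
  proof -
    have "(- u * w + v = z) = (v - u * w = z)" for u v w z :: real by auto
    then show ?thesis
      unfolding solves_bvp_def Let_def inner_Pair inner_real_def by auto
  qed
  show ?thesis
  proof
    assume "\<exists>\<phi>. admissible_potential h \<eta> \<phi> \<and> is_trace \<phi> \<eta> \<xi> \<and> solves_bvp \<gamma> h g \<sigma> \<rho> \<phi> \<eta>"
    then obtain \<phi> where adm: "admissible_potential h \<eta> \<phi>" and tr: "is_trace \<phi> \<eta> \<xi>"
      and sol: "solves_bvp \<gamma> h g \<sigma> \<rho> \<phi> \<eta>" by blast
    have diff: "\<phi> differentiable (at_surface x t)" if "0 \<le> t" for x t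
      using adm that by (simp add: admissible_potential_def)
    note sol' = sol[unfolded bvp]
    have kin: "kinematic \<phi> x t" if "0 \<le> t" for x t
      using sol' that by blast
    have "nonlocal_equation \<gamma> h \<xi> \<eta>"
      by (rule bvp_imp_nonlocal[OF adm tr]) (use sol' in blast)+
    moreover have "surface_bernoulli \<gamma> g \<sigma> \<rho> \<xi> \<eta>"
      using surface_bernoulli_iff[OF diff tr kin] sol' by blast
    ultimately show "nonlocal_equation \<gamma> h \<xi> \<eta> \<and> surface_bernoulli \<gamma> g \<sigma> \<rho> \<xi> \<eta>" ..
  next
    assume R: "nonlocal_equation \<gamma> h \<xi> \<eta> \<and> surface_bernoulli \<gamma> g \<sigma> \<rho> \<xi> \<eta>"
    then interpret nonlocal_data h \<eta> \<xi> \<gamma> by unfold_locales blast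
    have diff: "potential differentiable (at_surface x t)" if "0 \<le> t" for x t
      using potential_admissible that by (simp add: admissible_potential_def)
    have "solves_bvp \<gamma> h g \<sigma> \<rho> potential \<eta>"
      unfolding bvp
      by (intro conjI allI impI ballI surface_bernoulli_iff[OF diff potential_trace potential_kinematic, THEN iffD2, rule_format]
          potential_inside(2) potential_bottom potential_kinematic R[THEN conjunct2])
    then show "\<exists>\<phi>. admissible_potential h \<eta> \<phi> \<and> is_trace \<phi> \<eta> \<xi> \<and> solves_bvp \<gamma> h g \<sigma> \<rho> \<phi> \<eta>"
      using potential_admissible potential_trace by blast
  qed
qed

end
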